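(* Every constructible tropical linear space is series-parallel.
   Context: A function $p:\binom{[n]}{d}\to\mathbb{R}$ is a tropical Plücker vector if for every $S\in\binom{[n]}{d-2}$ and distinct $i,j,k,l\notin S$, the minimum of $p_{S\cup\{i,j\}}+p_{S\cup\{k,l\}}$, $p_{S\cup\{i,k\}}+p_{S\cup\{j,l\}}$, $p_{S\cup\{i,l\}}+p_{S\cup\{j,k\}}$ is attained at least twice. Its tropical linear space is $L(p)=\{x\in\mathbb{R}^n:$ for every $J\in\binom{[n]}{d+1}$ the minimum over $j\in J$ of $p_{J\setminus\{j\}}+x_j$ is attained at least twice$\}$ (a $d$-dimensional tropical linear space in $n$-space). For $w\in\mathbb{R}^n$ let $M_w$ be the set of $I$ minimizing $p_I-\sum_{i\in I}w_i$; faces of $L(p)$ are closures of the sets $\{w:M_w=\mathcal{M}\}$ contained in $L(p)$. Let $e_I=\sum_{i\in I}e_i$ and $\Delta(d,n)=\mathrm{conv}\{e_I:I\in\binom{[n]}{d}\}$. The regular subdivision $\mathcal{D}_p$ of $\Delta(d,n)$ is obtained by projecting to $\Delta(d,n)$ the lower faces (outward normal with negative last coordinate) of $\mathrm{conv}\{(e_I,p_I)\}\subset\mathbb{R}^n\times\mathbb{R}$. For a matroid $M$ on $[n]$, $P_M=\mathrm{conv}\{e_B: B \text{ a basis of } M\}$. A matroid is series-parallel if it is the cycle matroid of a graph obtained from a single edge joining two distinct vertices by repeatedly applying series extension (subdividing an edge into two edges) and parallel extension (adding an edge parallel to an existing edge). $L(p)$ is series-parallel if every maximal cell of $\mathcal{D}_p$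 is $P_M$ for a series-parallel matroid $M$. Dual: $p^\perp_I=p_{[n]\setminus I}$ on $\binom{[n]}{n-d}$ and $L(p)^\perp=L(p^\perp)$. Stable intersection: for $p$ on $\binom{[n]}{d}$, $p'$ on $\binom{[n]}{d'}$, $d+d'\ge n$, $q_J=\min\{p_I+p'_{I'}:|I|=d,|I'|=d',I\cap I'=J\}$ for $J\in\binom{[n]}{d+d'-n}$. Two tropical linear spaces $L,L'$ meet transversely if whenever faces $F$ of $L$ and $F'$ of $L'$ have intersecting relative interiors, the direction spaces of their affine hulls together span $\mathbb{R}^n$; then $L(p)\cap L(p')=L(q)$. A tropical hyperplane is an $(n-1)$-dimensional tropical linear space in $n$-space. The constructible tropical linear spaces form the smallest class containing all tropical hyperplanes and closed under $L\mapsto L^\perp$ and under $(L,L')\mapsto L\cap L'=L(q)$ for $L,L'$ in the same $\mathbb{R}^n$ with $d+d'\ge n$ meeting transversely.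
   Formalization: The tropical linear space is assumed to have dimension d > 0; for d = 0 (e.g. the stable intersection of the disjoint hyperplanes x1 = x2 and x1 = x2 + 1 in the plane) the only cell comes from a matroid of loops, which is not series-parallel, so the claim fails. *)

theory Defs
  imports "HOL-Analysis.Analysis"
begin

text \<open>The ground set \<open>[n]\<close> is a finite type \<open>'n\<close>, so \<open>n = CARD('n)\<close>. A function on the
  \<open>d\<close>-subsets of \<open>[n]\<close> is a function on all subsets whose values on sets of cardinality
  other than \<open>d\<close> are never used.\<close>

subsection \<open>Tropical linear spaces\<close>

definition min3_attained_twice :: "real \<Rightarrow> real \<Rightarrow> real \<Rightarrow> bool" where
  "min3_attained_twice a b c \<longleftrightarrow>
     (a = b \<and> a \<le> c) \<or> (a = c \<and> a \<le> b) \<or> (b = c \<and> b \<le> a)"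

definition min_attained_twice :: "'a set \<Rightarrow> ('a \<Rightarrow> real) \<Rightarrow> bool" where
  "min_attained_twice A f \<longleftrightarrow>
     (\<exists>a\<in>A. \<exists>b\<in>A. a \<noteq> b \<and> f a = f b \<and> (\<forall>c\<in>A. f a \<le> f c))"

definition tropical_plucker :: "nat \<Rightarrow> ('n::finite set \<Rightarrow> real) \<Rightarrow> bool" where
  "tropical_plucker d p \<longleftrightarrow> d \<le> CARD('n) \<and>
     (\<forall>S i j k l. card S + 2 = d \<longrightarrow> distinct [i, j, k, l] \<longrightarrow> {i, j, k, l} \<inter> S = {} \<longrightarrow>
        min3_attained_twice
          (p (S \<union> {i, j}) + p (S \<union> {k, l}))
          (p (S \<union> {i, k}) + p (S \<union> {j, l}))
          (p (S \<union> {i, l}) + p (S \<union> {j, k})))"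

definition tropical_linear_space :: "nat \<Rightarrow> ('n::finite set \<Rightarrow> real) \<Rightarrow> (real ^ 'n) set" where
  "tropical_linear_space d p =
     {x. \<forall>J. card J = d + 1 \<longrightarrow> min_attained_twice J (\<lambda>j. p (J - {j}) + x $ j)}"

definition minimizers :: "nat \<Rightarrow> ('n::finite set \<Rightarrow> real) \<Rightarrow> real ^ 'n \<Rightarrow> 'n set set" where
  "minimizers d p w =
     {I. card I = d \<and>
         (\<forall>I'. card I' = d \<longrightarrow> p I - (\<Sum>i\<in>I. w $ i) \<le> p I' - (\<Sum>i\<in>I'. w $ i))}"

definition tls_faces :: "nat \<Rightarrow> ('n::finite set \<Rightarrow> real) \<Rightarrow> (real ^ 'n) set set" where
  "tls_faces d p =
     {closure C | C. (\<exists>M. C = {w. minimizers d p w = M}) \<and> C \<noteq> {} \<and>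
                     C \<subseteq> tropical_linear_space d p}"

subsection \<open>Regular subdivisions of hypersimplices\<close>

definition indicator_vec :: "'n::finite set \<Rightarrow> real ^ 'n" where
  "indicator_vec I = (\<Sum>i\<in>I. axis i 1)"

definition lifted_hypersimplex ::
    "nat \<Rightarrow> ('n::finite set \<Rightarrow> real) \<Rightarrow> ((real ^ 'n) \<times> real) set" where
  "lifted_hypersimplex d p = convex hull {(indicator_vec I, p I) | I. card I = d}"

definition lower_face :: "((real ^ 'n::finite) \<times> real) set \<Rightarrow> ((real ^ 'n) \<times> real) set \<Rightarrow> bool" where
  "lower_face F P \<longleftrightarrow> F \<noteq> {} \<and>
     (\<exists>a b. snd a < 0 \<and> P \<subseteq> {x. a \<bullet> x \<le> b} \<and> F = P \<inter> {x. a \<bullet> x = b})"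

definition regular_subdivision :: "nat \<Rightarrow> ('n::finite set \<Rightarrow> real) \<Rightarrow> (real ^ 'n) set set" where
  "regular_subdivision d p = {fst ` F | F. lower_face F (lifted_hypersimplex d p)}"

definition maximal_cell :: "nat \<Rightarrow> ('n::finite set \<Rightarrow> real) \<Rightarrow> (real ^ 'n) set \<Rightarrow> bool" where
  "maximal_cell d p C \<longleftrightarrow> C \<in> regular_subdivision d p \<and>
     (\<forall>D\<in>regular_subdivision d p. C \<subseteq> D \<longrightarrow> D = C)"

subsection \<open>Series-parallel matroids\<close>

text \<open>A multigraph is given by a set \<open>E\<close> of edge labels and a function \<open>ends\<close> that maps each
  label in \<open>E\<close> to its set of end vertices (a singleton for a loop). Matroids are represented
  by their sets of bases.\<close>

text \<open>For length 1 a cycle is a loop, for length 2 a pair of parallel edges.\<close>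

definition graph_cycle :: "('e \<Rightarrow> 'v set) \<Rightarrow> 'e set \<Rightarrow> bool" where
  "graph_cycle ends C \<longleftrightarrow>
     (\<exists>es vs. es \<noteq> [] \<and> length vs = length es \<and> distinct es \<and> distinct vs \<and> set es = C \<and>
        (\<forall>i<length es. ends (es ! i) = {vs ! i, vs ! (Suc i mod length es)}))"

definition forest :: "('e \<Rightarrow> 'v set) \<Rightarrow> 'e set \<Rightarrow> bool" where
  "forest ends A \<longleftrightarrow> \<not> (\<exists>C\<subseteq>A. graph_cycle ends C)"

definition cycle_matroid_bases :: "'e set \<Rightarrow> ('e \<Rightarrow> 'v set) \<Rightarrow> 'e set set" where
  "cycle_matroid_bases E ends =
     {B. B \<subseteq> E \<and> forest ends B \<and> (\<forall>A. B \<subseteq> A \<longrightarrow> A \<subseteq> E \<longrightarrow> forest ends A \<longrightarrow> A = B)}"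

inductive series_parallel_graph :: "'e set \<Rightarrow> ('e \<Rightarrow> 'v set) \<Rightarrow> bool" where
  single_edge:
    "u \<noteq> v \<Longrightarrow> ends e = {u, v} \<Longrightarrow> series_parallel_graph {e} ends"
| parallel_extension:
    "series_parallel_graph E ends \<Longrightarrow> e \<in> E \<Longrightarrow> f \<notin> E \<Longrightarrow>
     series_parallel_graph (insert f E) (ends(f := ends e))"
| series_extension:
    "series_parallel_graph E ends \<Longrightarrow> e \<in> E \<Longrightarrow> f \<notin> E \<Longrightarrow> ends e = {u, v} \<Longrightarrow>
     w \<notin> \<Union>(ends ` E) \<Longrightarrow>
     series_parallel_graph (insert f E) (ends(e := {u, w}, f := {w, v}))"

definition series_parallel_matroid :: "'n::finite set set \<Rightarrow> bool" where
  "series_parallel_matroid M \<longleftrightarrow>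
     (\<exists>ends :: 'n \<Rightarrow> nat set. series_parallel_graph UNIV ends \<and>
        M = cycle_matroid_bases UNIV ends)"

definition matroid_polytope :: "'n::finite set set \<Rightarrow> (real ^ 'n) set" where
  "matroid_polytope M = convex hull (indicator_vec ` M)"

definition series_parallel_tls :: "nat \<Rightarrow> ('n::finite set \<Rightarrow> real) \<Rightarrow> bool" where
  "series_parallel_tls d p \<longleftrightarrow>
     (\<forall>C. maximal_cell d p C \<longrightarrow>
        (\<exists>M. series_parallel_matroid M \<and> C = matroid_polytope M))"

subsection \<open>Constructible tropical linear spaces\<close>

definition dual_plucker :: "('n::finite set \<Rightarrow> real) \<Rightarrow> 'n set \<Rightarrow> real" where
  "dual_plucker p I = p (UNIV - I)"

definition stable_intersection ::
    "nat \<Rightarrow> ('n::finite set \<Rightarrow> real) \<Rightarrow> nat \<Rightarrow> ('n set \<Rightarrow> real) \<Rightarrow> 'n set \<Rightarrow> real" where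
  "stable_intersection d p d' p' J =
     Min {p I + p' I' | I I'. card I = d \<and> card I' = d' \<and> I \<inter> I' = J}"

definition direction_space :: "(real ^ 'n::finite) set \<Rightarrow> (real ^ 'n) set" where
  "direction_space F = {x - y | x y. x \<in> affine hull F \<and> y \<in> affine hull F}"

definition meet_transversely ::
    "nat \<Rightarrow> ('n::finite set \<Rightarrow> real) \<Rightarrow> nat \<Rightarrow> ('n set \<Rightarrow> real) \<Rightarrow> bool" where
  "meet_transversely d p d' p' \<longleftrightarrow>
     (\<forall>F\<in>tls_faces d p. \<forall>F'\<in>tls_faces d' p'.
        rel_interior F \<inter> rel_interior F' \<noteq> {} \<longrightarrow>
        span (direction_space F \<union> direction_space F') = UNIV)"

inductive constructible :: "(real ^ 'n::finite) set \<Rightarrow> bool" where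
  hyperplane:
    "tropical_plucker (CARD('n) - 1) p \<Longrightarrow>
     constructible (tropical_linear_space (CARD('n) - 1) p)"
| dual:
    "tropical_plucker d p \<Longrightarrow> constructible (tropical_linear_space d p) \<Longrightarrow>
     constructible (tropical_linear_space (CARD('n) - d) (dual_plucker p))"
| transverse_intersection:
    "tropical_plucker d p \<Longrightarrow> constructible (tropical_linear_space d p) \<Longrightarrow>
     tropical_plucker d' p' \<Longrightarrow> constructible (tropical_linear_space d' p') \<Longrightarrow>
     CARD('n) \<le> d + d' \<Longrightarrow> meet_transversely d p d' p' \<Longrightarrow>
     constructible
       (tropical_linear_space (d + d' - CARD('n)) (stable_intersection d p d' p'))"

end

theory Submission
  imports Defs
begin

text \<open>The maximal cells of the regular subdivision are the connected ones among the sets \<open>M\<^sub>w\<close> of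
  minimizers. The valuations all of whose cells are direct sums of connected series-parallel
  matroids, loops and coloops are closed under duality, since these sums are. In the dual picture,
  the cells of a stable intersection are the products \<open>{A \<union> B | A \<inter> B = {}}\<close> of cells \<open>M\<close> and
  \<open>M'\<close>. Transversality says that the spaces of weights that are constant on \<open>M\<close> and on \<open>M'\<close>
  together span everything, and a weight constant on a connected summand has equal coordinates
  there. So two connected summands that meet share exactly one element, and then their product is
  again a connected series-parallel matroid. Merging the summands one at a time shows that the
  product is a direct sum of the same kind. Since constructibility is a property of the set
  \<open>L(p)\<close>, one also needs that \<open>L(p)\<close> determines \<open>d\<close>, and \<open>p\<close> up to a constant. For this the stable
  intersection has to be a tropical Pluecker vector: a violated three-term relation would give a
  cell with two bases \<open>S \<union> {i, j}\<close>, \<open>S \<union> {k, l}\<close>, which is no series-parallel matroid.\<close>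

subsection \<open>Disjoint products of set families\<close>

definition disjoint_product :: "'a set set \<Rightarrow> 'a set set \<Rightarrow> 'a set set" (infixl "\<otimes>" 70) where
  "A \<otimes> B = {I \<union> J | I J. I \<in> A \<and> J \<in> B \<and> I \<inter> J = {}}"

lemma disjoint_productI: "I \<in> A \<Longrightarrow> J \<in> B \<Longrightarrow> I \<inter> J = {} \<Longrightarrow> I \<union> J \<in> A \<otimes> B"
  unfolding disjoint_product_def by blast

lemma disjoint_productE:
  assumes "K \<in> A \<otimes> B"
  obtains I J where "K = I \<union> J" "I \<in> A" "J \<in> B" "I \<inter> J = {}"
  using assms unfolding disjoint_product_def by blast

interpretation disjoint_product: abel_semigroup "(\<otimes>)"
proof
  fix A B C :: "'a set set"
  have "A \<otimes> B \<otimes> C =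
      {I \<union> J \<union> L | I J L. I \<in> A \<and> J \<in> B \<and> L \<in> C \<and> I \<inter> J = {} \<and> (I \<union> J) \<inter> L = {}}"
    unfolding disjoint_product_def by blast
  also have "\<dots> = {I \<union> (J \<union> L) | I J L. I \<in> A \<and> J \<in> B \<and> L \<in> C \<and> J \<inter> L = {} \<and> I \<inter> (J \<union> L) = {}}"
    unfolding Int_Un_distrib Int_Un_distrib2 Un_empty Un_assoc by blast
  also have "\<dots> = A \<otimes> (B \<otimes> C)"
    unfolding disjoint_product_def by blast
  finally show "A \<otimes> B \<otimes> C = A \<otimes> (B \<otimes> C)" .
  show "A \<otimes> B = B \<otimes> A"
    unfolding disjoint_product_def by (auto simp: Un_commute Int_commute)
qed

lemmas disjoint_product_ac =
  disjoint_product.assoc disjoint_product.commute disjoint_product.left_commute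

lemma disjoint_product_Un_left: "(A \<union> B) \<otimes> C = A \<otimes> C \<union> B \<otimes> C"
  and disjoint_product_Un_right: "C \<otimes> (A \<union> B) = C \<otimes> A \<union> C \<otimes> B"
  unfolding disjoint_product_def by blast+

text \<open>Set families with \<open>\<union>\<close> and \<open>\<otimes>\<close> form a commutative semiring, and these rules normalize
  polynomials over it.\<close>

lemmas disjoint_product_algebra =
  disjoint_product_Un_left disjoint_product_Un_right disjoint_product_ac Un_ac

lemma disjoint_product_unit [simp]: "{{}} \<otimes> A = A" "A \<otimes> {{}} = A"
  and disjoint_product_empty [simp]: "{} \<otimes> A = {}" "A \<otimes> {} = {}"
  unfolding disjoint_product_def by auto

lemma disjoint_product_singleton_square: "{{e}} \<otimes> {{e}} = {}"
  unfolding disjoint_product_def by auto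

lemma disjoint_product_singleton: "A \<subseteq> Pow E \<Longrightarrow> e \<notin> E \<Longrightarrow> {{e}} \<otimes> A = insert e ` A"
  unfolding disjoint_product_def by blast

lemma disjoint_product_subset_Pow: "A \<subseteq> Pow E \<Longrightarrow> B \<subseteq> Pow E' \<Longrightarrow> A \<otimes> B \<subseteq> Pow (E \<union> E')"
  unfolding disjoint_product_def by blast

lemma disjoint_product_nonempty:
  assumes "A \<subseteq> Pow E" "B \<subseteq> Pow E'" "E \<inter> E' = {}" "A \<noteq> {}" "B \<noteq> {}"
  shows "A \<otimes> B \<noteq> {}"
proof -
  obtain I J where "I \<in> A" "J \<in> B" using assms(4,5) by blast
  moreover from this have "I \<inter> J = {}" using assms(1-3) by blast
  ultimately show ?thesis using disjoint_productI by blast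
qed

lemma disjoint_product_image_Diff:
  assumes "A \<subseteq> Pow E" "B \<subseteq> Pow E'" "E \<inter> E' = {}"
  shows "(-) (E \<union> E') ` (A \<otimes> B) = ((-) E ` A) \<otimes> ((-) E' ` B)"
proof -
  have diff_Un: "(E \<union> E') - (I \<union> J) = (E - I) \<union> (E' - J)"
    "I \<inter> J = {}" "(E - I) \<inter> (E' - J) = {}"
    if "I \<in> A" "J \<in> B" for I J
    using that assms by blast+
  show ?thesis
  proof (intro equalityI subsetI)
    fix K assume "K \<in> (-) (E \<union> E') ` (A \<otimes> B)"
    then obtain I J where "K = (E \<union> E') - (I \<union> J)" "I \<in> A" "J \<in> B"
      by (elim imageE disjoint_productE) metis
    then show "K \<in> ((-) E ` A) \<otimes> ((-) E' ` B)"
      using diff_Un [of I J] disjoint_productI [of "E - I" _ "E' - J"] by simp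
  next
    fix K assume "K \<in> ((-) E ` A) \<otimes> ((-) E' ` B)"
    then obtain I J where "K = (E - I) \<union> (E' - J)" "I \<in> A" "J \<in> B"
      by (elim imageE disjoint_productE) metis
    then show "K \<in> (-) (E \<union> E') ` (A \<otimes> B)"
      using diff_Un [of I J] disjoint_productI [of I A J B] by (metis imageI)
  qed
qed

subsection \<open>Two-terminal series-parallel networks\<close>

datatype 'a net = Edge 'a | Par "'a net" "'a net" | Ser "'a net" "'a net"

primrec edges :: "'a net \<Rightarrow> 'a set" where
  "edges (Edge e) = {e}"
| "edges (Par a b) = edges a \<union> edges b"
| "edges (Ser a b) = edges a \<union> edges b"

primrec wf_net :: "'a net \<Rightarrow> bool" where
  "wf_net (Edge e) \<longleftrightarrow> True"
| "wf_net (Par a b) \<longleftrightarrow> wf_net a \<and> wf_net b \<and> edges a \<inter> edges b = {}"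
| "wf_net (Ser a b) \<longleftrightarrow> wf_net a \<and> wf_net b \<and> edges a \<inter> edges b = {}"

text \<open>\<open>trees\<close> collects the spanning trees, and \<open>cuts\<close> the spanning forests with two components
  that separate the terminals.\<close>

fun trees :: "'a net \<Rightarrow> 'a set set" and cuts :: "'a net \<Rightarrow> 'a set set" where
  "trees (Edge e) = {{e}}"
| "trees (Par a b) = trees a \<otimes> cuts b \<union> cuts a \<otimes> trees b"
| "trees (Ser a b) = trees a \<otimes> trees b"
| "cuts (Edge e) = {{}}"
| "cuts (Par a b) = cuts a \<otimes> cuts b"
| "cuts (Ser a b) = trees a \<otimes> cuts b \<union> cuts a \<otimes> trees b"

lemma edges_nonempty [simp]: "edges a \<noteq> {}"
  and finite_edges [simp]: "finite (edges a)"
  by (induction a) auto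

lemma trees_subset: "trees a \<subseteq> Pow (edges a)"
  and cuts_subset: "cuts a \<subseteq> Pow (edges a)"
  by (induction a) (auto elim!: disjoint_productE)

lemma finite_tree: "I \<in> trees a \<Longrightarrow> finite I"
  and finite_cut: "I \<in> cuts a \<Longrightarrow> finite I"
  using trees_subset cuts_subset finite_subset [OF _ finite_edges] by (metis PowD subsetD)+

lemma trees_nonempty: "wf_net a \<Longrightarrow> trees a \<noteq> {}"
  and cuts_nonempty: "wf_net a \<Longrightarrow> cuts a \<noteq> {}"
  by (induction a)
    (simp_all add: disjoint_product_nonempty [OF trees_subset trees_subset]
      disjoint_product_nonempty [OF trees_subset cuts_subset]
      disjoint_product_nonempty [OF cuts_subset cuts_subset])

primrec cut_rank :: "'a net \<Rightarrow> nat" where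
  "cut_rank (Edge e) = 0"
| "cut_rank (Par a b) = cut_rank a + cut_rank b"
| "cut_rank (Ser a b) = Suc (cut_rank a + cut_rank b)"

lemma card_tree: "I \<in> trees a \<Longrightarrow> card I = Suc (cut_rank a)"
  and card_cut: "I \<in> cuts a \<Longrightarrow> card I = cut_rank a"
  by (induction a arbitrary: I)
    (auto elim!: disjoint_productE simp: card_Un_disjoint finite_tree finite_cut)

primrec dual_net :: "'a net \<Rightarrow> 'a net" where
  "dual_net (Edge e) = Edge e"
| "dual_net (Par a b) = Ser (dual_net a) (dual_net b)"
| "dual_net (Ser a b) = Par (dual_net a) (dual_net b)"

lemma edges_dual_net [simp]: "edges (dual_net a) = edges a"
  by (induction a) auto

lemma wf_dual_net [simp]: "wf_net (dual_net a) \<longleftrightarrow> wf_net a"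
  by (induction a) auto

lemma cuts_dual_net: "wf_net a \<Longrightarrow> cuts (dual_net a) = (-) (edges a) ` trees a"
  and trees_dual_net: "wf_net a \<Longrightarrow> trees (dual_net a) = (-) (edges a) ` cuts a"
  by (induction a)
    (simp_all add: image_Un Un_commute disjoint_product_image_Diff [OF trees_subset trees_subset]
      disjoint_product_image_Diff [OF trees_subset cuts_subset]
      disjoint_product_image_Diff [OF cuts_subset trees_subset]
      disjoint_product_image_Diff [OF cuts_subset cuts_subset])

subsection \<open>Blocks\<close>

text \<open>The spanning trees of a parallel connection do not depend on the choice of the terminals, so
  any edge can be made parallel to the rest of the network.\<close>

definition block :: "'a net \<Rightarrow> bool" where
  "block x \<longleftrightarrow> wf_net x \<and> (\<exists>a b. x = Par a b)"

lemma blockI: "wf_net (Par a b) \<Longrightarrow> block (Par a b)"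
  by (simp add: block_def)

lemma blockE:
  assumes "block x"
  obtains a b where "x = Par a b" "wf_net a" "wf_net b" "edges a \<inter> edges b = {}"
  using assms by (auto simp: block_def)

lemma block_wf: "block x \<Longrightarrow> wf_net x"
  by (simp add: block_def)

lemma Par_reroot:
  assumes "wf_net (Par a b)" "e \<in> edges a"
  shows "\<exists>c. wf_net (Par (Edge e) c) \<and> edges (Par (Edge e) c) = edges (Par a b) \<and>
    trees (Par (Edge e) c) = trees (Par a b)"
  using assms
proof (induction a arbitrary: b)
  case (Edge x)
  then show ?case by auto
next
  case (Par x y)
  consider "e \<in> edges x" | "e \<in> edges y" using Par.prems by auto
  then show ?case
  proof cases
    assume "e \<in> edges x"
    with Par.IH(1) [of "Par y b"] Par.prems show ?thesis
      by (auto simp: disjoint_product_algebra)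
  next
    assume "e \<in> edges y"
    with Par.IH(2) [of "Par x b"] Par.prems show ?thesis
      by (auto simp: disjoint_product_algebra)
  qed
next
  case (Ser x y)
  consider "e \<in> edges x" | "e \<in> edges y" using Ser.prems by auto
  then show ?case
  proof cases
    assume "e \<in> edges x"
    with Ser.IH(1) [of "Ser y b"] Ser.prems show ?thesis
      by (auto simp: disjoint_product_algebra)
  next
    assume "e \<in> edges y"
    with Ser.IH(2) [of "Ser x b"] Ser.prems show ?thesis
      by (auto simp: disjoint_product_algebra)
  qed
qed

lemma block_reroot:
  assumes "block x" "e \<in> edges x"
  obtains c where "block (Par (Edge e) c)" "edges (Par (Edge e) c) = edges x"
    "trees (Par (Edge e) c) = trees x"
proof -
  obtain a b where x_Par: "x = Par a b" "wf_net (Par a b)" "wf_net (Par b a)"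
    using assms(1) by (auto elim!: blockE)
  have "edges (Par b a) = edges x" "trees (Par b a) = trees x"
    using x_Par(1) by (auto simp: disjoint_product_algebra)
  moreover have "e \<in> edges a \<or> e \<in> edges b" using assms(2) x_Par(1) by simp
  ultimately show thesis
    using Par_reroot [OF x_Par(2)] Par_reroot [OF x_Par(3)] that x_Par(1) blockI by metis
qed

text \<open>In the semiring of set families \<open>x = {{e}}\<close> satisfies \<open>x\<^sup>2 = 0\<close>, and so the product of
  \<open>x C + T\<close> and \<open>x C' + T'\<close> is \<open>x (C T' + T C') + T T'\<close>.\<close>

lemma block_merge:
  assumes "block x" "block y" "edges x \<inter> edges y = {e}"
  obtains z where "block z" "edges z = edges x \<union> edges y" "trees z = trees x \<otimes> trees y"
proof -
  obtain a where rerooted_x: "block (Par (Edge e) a)" "edges (Par (Edge e) a) = edges x"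
    "trees (Par (Edge e) a) = trees x"
    using block_reroot [OF assms(1)] assms(3) by blast
  obtain b where rerooted_y: "block (Par (Edge e) b)" "edges (Par (Edge e) b) = edges y"
    "trees (Par (Edge e) b) = trees y"
    using block_reroot [OF assms(2)] assms(3) by blast
  let ?z = "Par (Edge e) (Ser a b)"
  have "block ?z"
    using block_wf [OF rerooted_x(1)] block_wf [OF rerooted_y(1)]
      rerooted_x(2) rerooted_y(2) assms(3)
    by (intro blockI) auto
  moreover have "edges ?z = edges x \<union> edges y"
    using rerooted_x(2) rerooted_y(2) by auto
  moreover have "trees ?z = trees x \<otimes> trees y"
    unfolding rerooted_x(3) [symmetric] rerooted_y(3) [symmetric]
    by (simp add: disjoint_product_algebra disjoint_product_singleton_square)
  ultimately show thesis using that by blast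
qed

lemma block_other_edge:
  assumes "block x"
  obtains f where "f \<in> edges x" "f \<noteq> e"
proof -
  obtain a b where x_Par: "x = Par a b" "edges a \<inter> edges b = {}"
    using assms by (auto elim: blockE)
  obtain f g where "f \<in> edges a" "g \<in> edges b"
    using edges_nonempty [of a] edges_nonempty [of b] by blast
  with x_Par have "f \<in> edges x" "g \<in> edges x" "f \<noteq> g" by auto
  then show thesis using that by metis
qed

subsection \<open>Constant weights\<close>

definition weight_constant :: "('a \<Rightarrow> real) \<Rightarrow> 'a set set \<Rightarrow> bool" where
  "weight_constant u A \<longleftrightarrow> (\<forall>I\<in>A. \<forall>J\<in>A. sum u I = sum u J)"

lemma weight_constantI: "(\<And>I. I \<in> A \<Longrightarrow> sum u I = c) \<Longrightarrow> weight_constant u A"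
  by (simp add: weight_constant_def)

lemma weight_constantD: "weight_constant u A \<Longrightarrow> I \<in> A \<Longrightarrow> J \<in> A \<Longrightarrow> sum u I = sum u J"
  unfolding weight_constant_def by blast

lemma weight_constant_mono: "weight_constant u A \<Longrightarrow> B \<subseteq> A \<Longrightarrow> weight_constant u B"
  unfolding weight_constant_def by blast

lemma weight_constant_mult:
  assumes "weight_constant u A"
  shows "weight_constant (\<lambda>x. c * u x) A"
  unfolding weight_constant_def
proof (intro ballI)
  fix I J assume "I \<in> A" "J \<in> A"
  then have "sum u I = sum u J" by (rule weight_constantD [OF assms])
  then show "(\<Sum>x\<in>I. c * u x) = (\<Sum>x\<in>J. c * u x)" by (simp flip: sum_distrib_left)
qed

lemma weight_constant_uminus: "weight_constant u A \<Longrightarrow> weight_constant (\<lambda>x. - u x) A"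
  using weight_constant_mult [of u A "- 1"] by simp

lemma weight_constant_add:
  assumes "weight_constant u A" "weight_constant v A"
  shows "weight_constant (\<lambda>x. u x + v x) A"
  unfolding weight_constant_def
proof (intro ballI)
  fix I J assume "I \<in> A" "J \<in> A"
  then have "sum u I = sum u J" "sum v I = sum v J"
    using weight_constantD [OF assms(1), of I J] weight_constantD [OF assms(2), of I J] by simp_all
  then show "(\<Sum>x\<in>I. u x + v x) = (\<Sum>x\<in>J. u x + v x)" by (simp add: sum.distrib)
qed

lemma weight_constant_diff:
  assumes "weight_constant u A" "weight_constant v A"
  shows "weight_constant (\<lambda>x. u x - v x) A"
  using weight_constant_add [OF assms(1) weight_constant_uminus [OF assms(2)]] by simp

lemma weight_constant_vanishing:
  assumes "A \<subseteq> Pow E" "\<And>x. x \<in> E \<Longrightarrow> u x = 0"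
  shows "weight_constant u A"
  using assms by (intro weight_constantI [where c = 0] sum.neutral) auto

lemma weight_constant_disjoint_product:
  assumes "weight_constant u A" "weight_constant u B"
    and "\<And>I. I \<in> A \<Longrightarrow> finite I" "\<And>J. J \<in> B \<Longrightarrow> finite J"
  shows "weight_constant u (A \<otimes> B)"
  unfolding weight_constant_def
proof (intro ballI)
  fix K L assume K_in: "K \<in> A \<otimes> B" and L_in: "L \<in> A \<otimes> B"
  obtain I J where K_split: "K = I \<union> J" "I \<in> A" "J \<in> B" "I \<inter> J = {}"
    using K_in by (rule disjoint_productE)
  obtain I' J' where L_split: "L = I' \<union> J'" "I' \<in> A" "J' \<in> B" "I' \<inter> J' = {}"
    using L_in by (rule disjoint_productE)
  have "sum u I = sum u I'" "sum u J = sum u J'"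
    using weight_constantD [OF assms(1)] weight_constantD [OF assms(2)] K_split L_split by blast+
  then show "sum u K = sum u L"
    using K_split L_split assms(3,4) by (simp add: sum.union_disjoint)
qed

lemma
  assumes "A \<subseteq> Pow E" "B \<subseteq> Pow E'" "E \<inter> E' = {}" "finite E" "finite E'" "I \<in> A" "J \<in> B"
  shows Un_in_disjoint_product: "I \<union> J \<in> A \<otimes> B"
    and sum_Un_disjoint_product: "sum u (I \<union> J) = sum u I + (sum u J :: real)"
proof -
  have "I \<subseteq> E" "J \<subseteq> E'" using assms(1,2,6,7) by auto
  then have "I \<inter> J = {}" "finite I" "finite J" using assms(3-5) finite_subset by blast+
  then show "I \<union> J \<in> A \<otimes> B" "sum u (I \<union> J) = sum u I + sum u J"
    using assms(6,7) by (simp_all add: disjoint_productI sum.union_disjoint)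
qed

lemma weight_constant_factor:
  assumes "weight_constant u (A \<otimes> B)" "A \<subseteq> Pow E" "B \<subseteq> Pow E'" "E \<inter> E' = {}"
    and "finite E" "finite E'" "B \<noteq> {}"
  shows "weight_constant u A"
  unfolding weight_constant_def
proof (intro ballI)
  fix I I' assume "I \<in> A" "I' \<in> A"
  obtain J where "J \<in> B" using assms(7) by blast
  note union = Un_in_disjoint_product [OF assms(2-6) _ \<open>J \<in> B\<close>]
    sum_Un_disjoint_product [OF assms(2-6) _ \<open>J \<in> B\<close>]
  have "sum u (I \<union> J) = sum u (I' \<union> J)"
    using assms(1) union(1) [OF \<open>I \<in> A\<close>] union(1) [OF \<open>I' \<in> A\<close>] by (rule weight_constantD)
  then show "sum u I = sum u I'" by (simp add: union(2) \<open>I \<in> A\<close> \<open>I' \<in> A\<close>)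
qed

lemma weight_constant_trees_factor:
  assumes "weight_constant u A" "trees a \<otimes> N \<subseteq> A" "N \<subseteq> Pow (edges b)" "N \<noteq> {}"
    and "edges a \<inter> edges b = {}"
  shows "weight_constant u (trees a)"
  using weight_constant_factor [OF weight_constant_mono [OF assms(1,2)] trees_subset assms(3,5)]
    assms(4) by simp

lemma weight_constant_parallel_edge:
  assumes "wf_net (Par (Edge e) c)" "weight_constant u (trees (Par (Edge e) c))" "f \<in> edges c"
  shows "u f = u e"
  using assms
proof (induction c)
  case (Edge f)
  then show ?case using weight_constantD [OF Edge.prems(2), of "{e}" "{f}"] by simp
next
  case (Par a b)
  have "weight_constant u (trees (Par (Edge e) a))"
    by (rule weight_constant_trees_factor [OF Par.prems(2) _ cuts_subset cuts_nonempty, of _ b])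
      (use Par.prems(1) in \<open>auto simp: disjoint_product_algebra\<close>)
  moreover have "weight_constant u (trees (Par (Edge e) b))"
    by (rule weight_constant_trees_factor [OF Par.prems(2) _ cuts_subset cuts_nonempty, of _ a])
      (use Par.prems(1) in \<open>auto simp: disjoint_product_algebra\<close>)
  ultimately show ?case using Par.IH Par.prems(1,3) by auto
next
  case (Ser a b)
  have "weight_constant u (trees (Par (Edge e) a))"
    by (rule weight_constant_trees_factor [OF Ser.prems(2) _ trees_subset trees_nonempty, of _ b])
      (use Ser.prems(1) in \<open>auto simp: disjoint_product_algebra\<close>)
  moreover have "weight_constant u (trees (Par (Edge e) b))"
    by (rule weight_constant_trees_factor [OF Ser.prems(2) _ trees_subset trees_nonempty, of _ a])
      (use Ser.prems(1) in \<open>auto simp: disjoint_product_algebra\<close>)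
  ultimately show ?case using Ser.IH Ser.prems(1,3) by auto
qed

lemma weight_constant_block:
  assumes "block x" "weight_constant u (trees x)" "e \<in> edges x" "f \<in> edges x"
  shows "u e = u f"
proof -
  obtain c where rerooted: "block (Par (Edge e) c)" "edges (Par (Edge e) c) = edges x"
    "trees (Par (Edge e) c) = trees x"
    using block_reroot [OF assms(1,3)] by blast
  have "weight_constant u (trees (Par (Edge e) c))" using assms(2) unfolding rerooted(3) .
  note parallel = weight_constant_parallel_edge [OF block_wf [OF rerooted(1)] this]
  have "f = e \<or> f \<in> edges c" using assms(4) rerooted(2) by auto
  then show ?thesis using parallel by auto
qed

subsection \<open>Direct sums of networks\<close>

inductive net_sum :: "('a net \<Rightarrow> bool) \<Rightarrow> 'a set \<Rightarrow> 'a set set \<Rightarrow> bool" for Q where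
  empty: "net_sum Q {} {{}}"
| loop: "net_sum Q E M \<Longrightarrow> e \<notin> E \<Longrightarrow> net_sum Q (insert e E) M"
| summand: "net_sum Q E M \<Longrightarrow> Q x \<Longrightarrow> wf_net x \<Longrightarrow> edges x \<inter> E = {} \<Longrightarrow>
    net_sum Q (edges x \<union> E) (trees x \<otimes> M)"

definition block_or_coloop :: "'a net \<Rightarrow> bool" where
  "block_or_coloop x \<longleftrightarrow> block x \<or> (\<exists>e. x = Edge e)"

abbreviation series_parallel_sum :: "'a set \<Rightarrow> 'a set set \<Rightarrow> bool" where
  "series_parallel_sum \<equiv> net_sum block_or_coloop"

lemma block_or_coloopI: "block x \<Longrightarrow> block_or_coloop x"
  and block_or_coloop_Edge: "block_or_coloop (Edge e)"
  by (simp_all add: block_or_coloop_def)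

lemma net_sum_finite: "net_sum Q E M \<Longrightarrow> finite E"
  by (induction rule: net_sum.induct) auto

lemma net_sum_subset: "net_sum Q E M \<Longrightarrow> M \<subseteq> Pow E"
  by (induction rule: net_sum.induct)
    (auto dest: trees_subset [THEN subsetD] elim!: disjoint_productE)

lemma net_sum_finite_member: "net_sum Q E M \<Longrightarrow> I \<in> M \<Longrightarrow> finite I"
  using net_sum_finite [of Q E M] net_sum_subset [of Q E M] finite_subset by blast

lemma net_sum_nonempty: "net_sum Q E M \<Longrightarrow> M \<noteq> {}"
proof (induction rule: net_sum.induct)
  case (summand E M x)
  then show ?case
    using disjoint_product_nonempty [OF trees_subset net_sum_subset] trees_nonempty by metis
qed simp_all

lemma net_sum_weaken:
  assumes "net_sum Q E M" "\<And>x. Q x \<Longrightarrow> R x"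
  shows "net_sum R E M"
  using assms by (induction rule: net_sum.induct) (auto intro: net_sum.intros)

lemma net_sum_superset:
  assumes "net_sum Q E M" "E \<subseteq> E'" "finite E'"
  shows "net_sum Q E' M"
proof -
  have "net_sum Q (E \<union> D) M" if "finite D" for D
    using that
  proof (induction D)
    case (insert e D)
    then show ?case
      using net_sum.loop [of Q "E \<union> D" M e] by (cases "e \<in> E") (auto simp: insert_absorb)
  qed (simp add: assms(1))
  from this [of E'] show ?thesis using assms(2,3) by (simp add: Un_absorb1)
qed

lemma net_sum_disjoint_product:
  assumes "net_sum Q E M" "net_sum Q E' M'" "E \<inter> E' = {}"
  shows "net_sum Q (E \<union> E') (M \<otimes> M')"
  using assms(1,3)
proof (induction rule: net_sum.induct)
  case empty
  then show ?case using assms(2) by simp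
next
  case (loop E M e)
  then show ?case using net_sum.loop [of Q "E \<union> E'" "M \<otimes> M'" e] by simp
next
  case (summand E M x)
  then have "edges x \<inter> (E \<union> E') = {}" "E \<inter> E' = {}" by auto
  then show ?case
    using net_sum.summand [OF summand.IH summand.hyps(2,3)]
    by (simp add: Un_assoc disjoint_product.assoc)
qed

lemma net_sum_single: "Q x \<Longrightarrow> wf_net x \<Longrightarrow> net_sum Q (edges x) (trees x)"
  using net_sum.summand [OF net_sum.empty, of Q x] by simp

lemma series_parallel_sum_trees: "wf_net a \<Longrightarrow> series_parallel_sum (edges a) (trees a)"
  and series_parallel_sum_cuts: "wf_net a \<Longrightarrow> series_parallel_sum (edges a) (cuts a)"
proof (induction a)
  case (Edge e)
  { case 1 show ?case
    using net_sum_single [of block_or_coloop "Edge e"] block_or_coloop_Edge [of e] by simp }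
  { case 2 show ?case using net_sum.loop [OF net_sum.empty] by simp }
next
  case (Par a b)
  { case 1 then show ?case by (intro net_sum_single block_or_coloopI blockI) }
  { case 2 then show ?case using Par.IH by (simp add: net_sum_disjoint_product) }
next
  case (Ser a b)
  { case 1 then show ?case using Ser.IH by (simp add: net_sum_disjoint_product) }
  { case 2 then have "wf_net (Par a b)" by simp
    then have "series_parallel_sum (edges (Par a b)) (trees (Par a b))"
      by (intro net_sum_single block_or_coloopI blockI)
    then show ?case by simp }
qed

lemma series_parallel_sum_Diff: "series_parallel_sum E M \<Longrightarrow> series_parallel_sum E ((-) E ` M)"
proof (induction rule: net_sum.induct)
  case empty
  then show ?case using net_sum.empty by simp
next
  case (loop E M e)
  have "(-) ({e} \<union> E) ` ({{}} \<otimes> M) = trees (Edge e) \<otimes> ((-) E ` M)"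
    using disjoint_product_image_Diff [of "{{}}" "{e}" M E] net_sum_subset [OF loop.hyps(1)]
      loop.hyps(2)
    by simp
  then show ?case
    using net_sum.summand [OF loop.IH, of "Edge e"] block_or_coloop_Edge [of e] loop.hyps(2) by simp
next
  case (summand E M x)
  have "series_parallel_sum (edges x) ((-) (edges x) ` trees x)"
    using series_parallel_sum_cuts [of "dual_net x"] summand.hyps(3) by (simp add: cuts_dual_net)
  then show ?case
    using net_sum_disjoint_product [OF _ summand.IH summand.hyps(4)]
      disjoint_product_image_Diff
        [OF trees_subset net_sum_subset [OF summand.hyps(1)] summand.hyps(4)]
    by simp
qed

lemma net_sum_weight_constant_summand:
  assumes "net_sum Q E M" "wf_net x" "edges x \<inter> E = {}" "weight_constant u (trees x \<otimes> M)"
  shows "weight_constant u (trees x)" "weight_constant u M"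
proof -
  note sub = net_sum_subset [OF assms(1)] and fin = net_sum_finite [OF assms(1)]
  show "weight_constant u (trees x)"
    using weight_constant_factor [OF assms(4) trees_subset sub assms(3) finite_edges fin]
      net_sum_nonempty [OF assms(1)] .
  have "weight_constant u (M \<otimes> trees x)" using assms(4) by (simp add: disjoint_product.commute)
  then show "weight_constant u M"
    using assms(2,3) trees_nonempty
    by (intro weight_constant_factor [OF _ sub trees_subset _ fin finite_edges]) auto
qed

lemma series_parallel_sum_parallel_class:
  assumes "series_parallel_sum E M" "B \<in> M" "B' \<in> M" "e \<in> B" "e \<notin> B'"
  obtains f where "f \<noteq> e" "\<And>u. weight_constant u M \<Longrightarrow> u f = u e"
proof -
  have "\<exists>f. f \<noteq> e \<and> (\<forall>u. weight_constant u M \<longrightarrow> u f = u e)"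
    using assms
  proof (induction arbitrary: B B' rule: net_sum.induct)
    case (summand E M x)
    note factors = net_sum_weight_constant_summand [OF summand.hyps(1,3,4)]
    obtain T C where B_split: "B = T \<union> C" "T \<in> trees x" "C \<in> M"
      using summand.prems(1) by (rule disjoint_productE)
    obtain T' C' where B'_split: "B' = T' \<union> C'" "T' \<in> trees x" "C' \<in> M"
      using summand.prems(2) by (rule disjoint_productE)
    show ?case
    proof (cases "e \<in> edges x")
      case True
      then have "x \<noteq> Edge e'" for e' using B'_split summand.prems(4) by auto
      then have "block x" using summand.hyps(2) by (simp add: block_or_coloop_def)
      then obtain f where "f \<in> edges x" "f \<noteq> e" by (rule block_other_edge)
      moreover have "u f = u e" if "weight_constant u (trees x \<otimes> M)" for u
        using weight_constant_block [OF \<open>block x\<close> factors(1) [OF that]] calculation(1) True by blast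
      ultimately show ?thesis by blast
    next
      case False
      then have "e \<in> C" "e \<notin> C'"
        using B_split B'_split summand.prems(3,4) trees_subset [of x] by auto
      then obtain f where parallel: "f \<noteq> e" "\<And>u. weight_constant u M \<Longrightarrow> u f = u e"
        using summand.IH [OF B_split(3) B'_split(3)] by blast
      then show ?thesis using factors(2) parallel by blast
    qed
  qed simp_all
  then show thesis using that by blast
qed

lemma sum_indicat_real: "finite I \<Longrightarrow> sum (indicat_real A) I = card (I \<inter> A)"
  by (simp add: indicator_def [abs_def] sum_of_bool_eq)

lemma series_parallel_sum_not_diagonal:
  assumes "series_parallel_sum E M" "distinct [i, j, k, l]" "{i, j, k, l} \<inter> S = {}"
  shows "M \<noteq> {S \<union> {i, j}, S \<union> {k, l}}"
proof
  assume diagonal: "M = {S \<union> {i, j}, S \<union> {k, l}}"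
  obtain f where parallel: "f \<noteq> i" "\<And>u. weight_constant u M \<Longrightarrow> u f = u i"
    using series_parallel_sum_parallel_class [OF assms(1), of "S \<union> {i, j}" "S \<union> {k, l}" i] diagonal
      assms(2,3)
    by auto
  have "finite (S \<union> {i, j})" using net_sum_finite_member [OF assms(1)] diagonal by blast
  then have "finite S" by simp
  define m where "m = (if f = k then l else k)"
  have "sum (indicat_real {i, m}) (S \<union> {a, b}) = 1" if "{a, b} = {i, j} \<or> {a, b} = {k, l}" for a b
  proof -
    have "(S \<union> {a, b}) \<inter> {i, m} = {i} \<or> (S \<union> {a, b}) \<inter> {i, m} = {m}"
      using that assms(2,3) by (auto simp: m_def doubleton_eq_iff)
    then show ?thesis using \<open>finite S\<close> by (auto simp: sum_indicat_real simp del: Un_insert_right)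
  qed
  then have "weight_constant (indicat_real {i, m}) M"
    unfolding diagonal by (intro weight_constantI [where c = 1]) blast
  from parallel(2) [OF this] have "f \<in> {i, m}" by (metis indicator_eq_1_iff insertI1)
  then show False using parallel(1) assms(2) by (auto simp: m_def split: if_splits)
qed

subsection \<open>Connected families\<close>

definition connected_family :: "'a set set \<Rightarrow> bool" where
  "connected_family M \<longleftrightarrow> (\<forall>u. weight_constant u M \<longrightarrow> (\<forall>e f. u e = u f))"

lemma connected_familyD: "connected_family M \<Longrightarrow> weight_constant u M \<Longrightarrow> u e = u f"
  unfolding connected_family_def by blast

lemma connected_family_card_Int:
  assumes "connected_family M" "\<And>I. I \<in> M \<Longrightarrow> finite I \<and> card (I \<inter> A) = c" "e \<in> A"
  shows "A = UNIV"
proof -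
  have "weight_constant (indicat_real A) M"
    using assms(2) by (intro weight_constantI [where c = "real c"]) (simp add: sum_indicat_real)
  then have "indicat_real A e = indicat_real A f" for f by (rule connected_familyD [OF assms(1)])
  then have "f \<in> A" for f using assms(3) by (metis indicator_eq_1_iff)
  then show ?thesis by blast
qed

lemma connected_family_Union:
  assumes "connected_family M" "\<And>I. I \<in> M \<Longrightarrow> finite I" "UNIV \<noteq> {e}"
  shows "e \<in> \<Union>M"
proof (rule ccontr)
  assume "e \<notin> \<Union>M"
  then have "card (I \<inter> {e}) = 0" if "I \<in> M" for I using that by auto
  then show False using connected_family_card_Int [OF assms(1), of "{e}"] assms(2,3) by blast
qed

lemma connected_series_parallel_sum:
  fixes M :: "'a set set"
  assumes "series_parallel_sum UNIV M" "connected_family M" "\<And>e :: 'a. UNIV \<noteq> {e}"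
  obtains x where "block x" "edges x = UNIV" "M = trees x"
  using assms(1)
proof cases
  case (loop E e)
  then have "e \<notin> \<Union>M" using net_sum_subset [OF loop(2)] by blast
  moreover have "e \<in> \<Union>M"
    by (rule connected_family_Union [OF assms(2) net_sum_finite_member [OF assms(1)] assms(3)])
  ultimately show thesis by contradiction
next
  case (summand E N x)
  have "card (I \<inter> edges x) = Suc (cut_rank x)" if "I \<in> M" for I
  proof -
    obtain T B where "I = T \<union> B" "T \<in> trees x" "B \<in> N" "T \<inter> B = {}"
      using \<open>I \<in> M\<close> unfolding summand(2) by (rule disjoint_productE)
    moreover from this have "I \<inter> edges x = T"
      using trees_subset [of x] net_sum_subset [OF summand(3)] summand(6) by blast
    ultimately show ?thesis using card_tree by simp
  qed
  moreover obtain e where "e \<in> edges x" using edges_nonempty [of x] by blast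
  ultimately have spanning: "edges x = UNIV"
    using connected_family_card_Int [OF assms(2)] net_sum_finite_member [OF assms(1)] by metis
  then have "N = {{}}"
    using net_sum_subset [OF summand(3)] net_sum_nonempty [OF summand(3)] summand(6) by auto
  moreover have "x \<noteq> Edge e" for e using spanning assms(3) [of e] by (metis edges.simps(1))
  then have "block x" using summand(4) by (simp add: block_or_coloop_def)
  ultimately show thesis using that [of x] spanning summand(2) by simp
qed simp

subsection \<open>Faces\<close>

definition argmax_weight :: "('a \<Rightarrow> real) \<Rightarrow> 'a set set \<Rightarrow> 'a set set" where
  "argmax_weight u A = {I \<in> A. \<forall>J\<in>A. sum u J \<le> sum u I}"

lemma argmax_weightI: "I \<in> A \<Longrightarrow> (\<And>J. J \<in> A \<Longrightarrow> sum u J \<le> sum u I) \<Longrightarrow> I \<in> argmax_weight u A"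
  by (simp add: argmax_weight_def)

lemma argmax_weightD:
  "I \<in> argmax_weight u A \<Longrightarrow> I \<in> A"
  "I \<in> argmax_weight u A \<Longrightarrow> J \<in> A \<Longrightarrow> sum u J \<le> sum u I"
  by (simp_all add: argmax_weight_def)

lemma argmax_weight_singleton [simp]: "argmax_weight u {I} = {I}"
  by (auto simp: argmax_weight_def)

lemma argmax_weight_nonempty:
  assumes "finite A" "A \<noteq> {}"
  shows "argmax_weight u A \<noteq> {}"
proof -
  obtain I where "I \<in> A" "Max (sum u ` A) = sum u I" using obtains_MAX [OF assms] by metis
  then have "I \<in> argmax_weight u A"
    using assms(1) by (intro argmax_weightI) (auto simp flip: \<open>Max (sum u ` A) = sum u I\<close>)
  then show ?thesis by blast
qed

lemma Un_in_argmax_weight_iff: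
  assumes "A \<subseteq> Pow E" "B \<subseteq> Pow E'" "E \<inter> E' = {}" "finite E" "finite E'" "I \<in> A" "J \<in> B"
  shows "I \<union> J \<in> argmax_weight u (A \<otimes> B) \<longleftrightarrow> I \<in> argmax_weight u A \<and> J \<in> argmax_weight u B"
proof
  note in_product = Un_in_disjoint_product [OF assms(1-5)]
    and sum_Un = sum_Un_disjoint_product [OF assms(1-5)]
  {
    assume max: "I \<union> J \<in> argmax_weight u (A \<otimes> B)"
    have "sum u K + sum u L \<le> sum u I + sum u J" if "K \<in> A" "L \<in> B" for K L
      using argmax_weightD(2) [OF max in_product [OF that]] that assms(6,7) by (simp add: sum_Un)
    from this [OF assms(6)] this [OF _ assms(7)]
    show "I \<in> argmax_weight u A \<and> J \<in> argmax_weight u B"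
      using assms(6,7) by (auto intro!: argmax_weightI)
  next
    assume max: "I \<in> argmax_weight u A \<and> J \<in> argmax_weight u B"
    show "I \<union> J \<in> argmax_weight u (A \<otimes> B)"
    proof (intro argmax_weightI in_product assms(6,7))
      fix H assume "H \<in> A \<otimes> B"
      then obtain K L where "H = K \<union> L" "K \<in> A" "L \<in> B" "K \<inter> L = {}"
        by (rule disjoint_productE)
      then show "sum u H \<le> sum u (I \<union> J)"
        using max assms(6,7) by (auto simp: sum_Un intro: add_mono argmax_weightD(2))
    qed
  }
qed

lemma argmax_weight_disjoint_product:
  assumes "A \<subseteq> Pow E" "B \<subseteq> Pow E'" "E \<inter> E' = {}" "finite E" "finite E'"
  shows "argmax_weight u (A \<otimes> B) = argmax_weight u A \<otimes> argmax_weight u B"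
proof (intro equalityI subsetI)
  fix H assume max: "H \<in> argmax_weight u (A \<otimes> B)"
  obtain K L where "H = K \<union> L" "K \<in> A" "L \<in> B" "K \<inter> L = {}"
    using argmax_weightD(1) [OF max] by (rule disjoint_productE)
  then show "H \<in> argmax_weight u A \<otimes> argmax_weight u B"
    using max Un_in_argmax_weight_iff [OF assms] disjoint_productI by blast
next
  fix H assume "H \<in> argmax_weight u A \<otimes> argmax_weight u B"
  then obtain K L where "H = K \<union> L" "K \<in> argmax_weight u A" "L \<in> argmax_weight u B" "K \<inter> L = {}"
    by (rule disjoint_productE)
  then show "H \<in> argmax_weight u (A \<otimes> B)"
    using Un_in_argmax_weight_iff [OF assms] argmax_weightD(1) by blast
qed

lemma argmax_weight_level:
  assumes "I \<in> argmax_weight u A"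
  shows "argmax_weight u A = {J \<in> A. sum u J = sum u I}"
  using argmax_weightD [OF assms] by (auto simp: argmax_weight_def intro: order_antisym)

lemma argmax_weight_Un_less:
  assumes "I \<in> argmax_weight u A" "J \<in> argmax_weight u B" "sum u J < sum u I"
  shows "argmax_weight u (A \<union> B) = argmax_weight u A"
proof -
  have "I \<in> argmax_weight u (A \<union> B)"
    using argmax_weightD [OF assms(1)] argmax_weightD(2) [OF assms(2)] assms(3)
    by (intro argmax_weightI) force+
  then have "argmax_weight u (A \<union> B) = {K \<in> A \<union> B. sum u K = sum u I}"
    by (rule argmax_weight_level)
  also have "\<dots> = argmax_weight u A"
    unfolding argmax_weight_level [OF assms(1)]
    using assms(3) argmax_weightD(2) [OF assms(2)] by force
  finally show ?thesis .
qed

lemma argmax_weight_Un_eq: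
  assumes "I \<in> argmax_weight u A" "J \<in> argmax_weight u B" "sum u I = sum u J"
  shows "argmax_weight u (A \<union> B) = argmax_weight u A \<union> argmax_weight u B"
proof -
  have "I \<in> argmax_weight u (A \<union> B)"
    using argmax_weightD [OF assms(1)] argmax_weightD(2) [OF assms(2)] assms(3)
    by (intro argmax_weightI) auto
  then have "argmax_weight u (A \<union> B) = {K \<in> A \<union> B. sum u K = sum u I}"
    by (rule argmax_weight_level)
  also have "\<dots> = argmax_weight u A \<union> argmax_weight u B"
    unfolding argmax_weight_level [OF assms(1)] argmax_weight_level [OF assms(2)] assms(3) by blast
  finally show ?thesis .
qed

lemma argmax_weight_Un_cases:
  assumes "finite A" "A \<noteq> {}" "finite B" "B \<noteq> {}"
  obtains (left) "argmax_weight u (A \<union> B) = argmax_weight u A"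
  | (right) "argmax_weight u (A \<union> B) = argmax_weight u B"
  | (both) "argmax_weight u (A \<union> B) = argmax_weight u A \<union> argmax_weight u B"
proof -
  obtain I J where maxima: "I \<in> argmax_weight u A" "J \<in> argmax_weight u B"
    using argmax_weight_nonempty [OF assms(1,2)] argmax_weight_nonempty [OF assms(3,4)] by blast
  consider "sum u J < sum u I" | "sum u I < sum u J" | "sum u I = sum u J" by linarith
  then show thesis
  proof cases
    assume "sum u J < sum u I"
    then show thesis by (intro left argmax_weight_Un_less [OF maxima])
  next
    assume "sum u I < sum u J"
    then show thesis using right argmax_weight_Un_less [OF maxima(2,1)] by (simp add: Un_commute)
  next
    assume "sum u I = sum u J"
    then show thesis by (intro both argmax_weight_Un_eq [OF maxima])
  qed
qed

text \<open>A face of a network, seen through both its trees and its cuts, is again a network on some of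
  the edges, the other edges being split off as a direct summand.\<close>

definition network_pair :: "'a set \<Rightarrow> 'a set set \<Rightarrow> 'a set set \<Rightarrow> bool" where
  "network_pair E T C \<longleftrightarrow> (\<exists>a F N. wf_net a \<and> series_parallel_sum F N \<and> edges a \<inter> F = {} \<and>
     E = edges a \<union> F \<and> T = trees a \<otimes> N \<and> C = cuts a \<otimes> N)"

lemma network_pairI:
  assumes "wf_net a" "series_parallel_sum F N" "edges a \<inter> F = {}"
  shows "network_pair (edges a \<union> F) (trees a \<otimes> N) (cuts a \<otimes> N)"
  using assms unfolding network_pair_def by blast

lemma network_pairE:
  assumes "network_pair E T C"
  obtains a F N where "wf_net a" "series_parallel_sum F N" "edges a \<inter> F = {}" "E = edges a \<union> F"
    "T = trees a \<otimes> N" "C = cuts a \<otimes> N"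
  using assms unfolding network_pair_def by blast

lemma network_pair_series_parallel_sum:
  assumes "network_pair E T C"
  shows "series_parallel_sum E T" "series_parallel_sum E C"
  using assms
  by (auto elim!: network_pairE intro!: net_sum_disjoint_product
      series_parallel_sum_trees series_parallel_sum_cuts)

lemma network_pair_disjoint_product:
  assumes "network_pair E T C" "series_parallel_sum E' N" "E \<inter> E' = {}"
  shows "network_pair (E \<union> E') (T \<otimes> N) (C \<otimes> N)"
proof -
  obtain a F N'
    where first: "wf_net a" "series_parallel_sum F N'" "edges a \<inter> F = {}" "E = edges a \<union> F"
    "T = trees a \<otimes> N'" "C = cuts a \<otimes> N'"
    using assms(1) by (rule network_pairE)
  have "series_parallel_sum (F \<union> E') (N' \<otimes> N)"
    using first(2-4) assms(2,3) by (intro net_sum_disjoint_product) auto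
  then have "network_pair (edges a \<union> (F \<union> E')) (trees a \<otimes> (N' \<otimes> N)) (cuts a \<otimes> (N' \<otimes> N))"
    using first assms(3) by (intro network_pairI) auto
  then show ?thesis by (simp add: first(4-6) disjoint_product.assoc Un_assoc)
qed

lemma
  assumes "network_pair E T C" "network_pair E' T' C'" "E \<inter> E' = {}"
  shows network_pair_Par: "network_pair (E \<union> E') (T \<otimes> C' \<union> C \<otimes> T') (C \<otimes> C')"
    and network_pair_Ser: "network_pair (E \<union> E') (T \<otimes> T') (T \<otimes> C' \<union> C \<otimes> T')"
proof -
  obtain a F N
    where first: "wf_net a" "series_parallel_sum F N" "edges a \<inter> F = {}" "E = edges a \<union> F"
    "T = trees a \<otimes> N" "C = cuts a \<otimes> N"
    using assms(1) by (rule network_pairE)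
  obtain b F' N'
    where second: "wf_net b" "series_parallel_sum F' N'" "edges b \<inter> F' = {}" "E' = edges b \<union> F'"
    "T' = trees b \<otimes> N'" "C' = cuts b \<otimes> N'"
    using assms(2) by (rule network_pairE)
  have sum: "series_parallel_sum (F \<union> F') (N \<otimes> N')"
    using first second assms(3) by (intro net_sum_disjoint_product) auto
  have "network_pair (edges c \<union> (F \<union> F')) (trees c \<otimes> (N \<otimes> N')) (cuts c \<otimes> (N \<otimes> N'))"
    if "c = Par a b \<or> c = Ser a b" for c
    using that first(1,3,4) second(1,3,4) assms(3) by (intro network_pairI sum) auto
  from this [of "Par a b"] this [of "Ser a b"]
  show "network_pair (E \<union> E') (T \<otimes> C' \<union> C \<otimes> T') (C \<otimes> C')"
    "network_pair (E \<union> E') (T \<otimes> T') (T \<otimes> C' \<union> C \<otimes> T')"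
    by (simp_all add: first(4-6) second(4-6) disjoint_product_algebra)
qed

lemma argmax_weight_net_product:
  assumes "wf_net a" "wf_net b" "edges a \<inter> edges b = {}"
    and "A = trees a \<or> A = cuts a" "B = trees b \<or> B = cuts b"
  shows "argmax_weight u (A \<otimes> B) = argmax_weight u A \<otimes> argmax_weight u B"
    and "finite (A \<otimes> B)" "A \<otimes> B \<noteq> {}"
proof -
  have A_sub: "A \<subseteq> Pow (edges a)" "A \<noteq> {}"
    using assms(1,4) trees_subset cuts_subset trees_nonempty cuts_nonempty by metis+
  have B_sub: "B \<subseteq> Pow (edges b)" "B \<noteq> {}"
    using assms(2,5) trees_subset cuts_subset trees_nonempty cuts_nonempty by metis+
  show "argmax_weight u (A \<otimes> B) = argmax_weight u A \<otimes> argmax_weight u B"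
    using A_sub(1) B_sub(1) assms(3) by (intro argmax_weight_disjoint_product) auto
  show "finite (A \<otimes> B)"
    using disjoint_product_subset_Pow [OF A_sub(1) B_sub(1)] by (rule finite_subset) simp
  show "A \<otimes> B \<noteq> {}"
    using A_sub B_sub assms(3) by (intro disjoint_product_nonempty) auto
qed

lemma
  assumes wf: "wf_net a" "wf_net b" and disjoint: "edges a \<inter> edges b = {}"
    and pair_a: "network_pair (edges a) (argmax_weight u (trees a)) (argmax_weight u (cuts a))"
    and pair_b: "network_pair (edges b) (argmax_weight u (trees b)) (argmax_weight u (cuts b))"
  shows network_pair_argmax_weight_Par: "network_pair (edges (Par a b))
      (argmax_weight u (trees (Par a b))) (argmax_weight u (cuts (Par a b)))" (is ?Par)
    and network_pair_argmax_weight_Ser: "network_pair (edges (Ser a b))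
      (argmax_weight u (trees (Ser a b))) (argmax_weight u (cuts (Ser a b)))" (is ?Ser)
proof -
  let ?T = "argmax_weight u (trees a)" and ?C = "argmax_weight u (cuts a)"
  have disjoint': "edges b \<inter> edges a = {}" using disjoint by blast
  note product = argmax_weight_net_product [OF wf disjoint]
  note swap = disjoint_product.commute [of _ ?T] disjoint_product.commute [of _ ?C] Un_commute
  note split_off_b = network_pair_disjoint_product [OF pair_a _ disjoint]
    and split_off_a = network_pair_disjoint_product [OF pair_b _ disjoint']
  have "finite (trees a \<otimes> cuts b)" "trees a \<otimes> cuts b \<noteq> {}"
    "finite (cuts a \<otimes> trees b)" "cuts a \<otimes> trees b \<noteq> {}" by (simp_all add: product)
  then have "?Par \<and> ?Ser"
  proof (cases rule: argmax_weight_Un_cases [where u = u])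
    case left
    then show ?thesis
      using split_off_b [OF network_pair_series_parallel_sum(2) [OF pair_b]]
        split_off_a [OF network_pair_series_parallel_sum(1) [OF pair_a]] by (simp add: product swap)
  next
    case right
    then show ?thesis
      using split_off_a [OF network_pair_series_parallel_sum(2) [OF pair_a]]
        split_off_b [OF network_pair_series_parallel_sum(1) [OF pair_b]] by (simp add: product swap)
  next
    case both
    then show ?thesis
      using network_pair_Par [OF pair_a pair_b disjoint]
        network_pair_Ser [OF pair_a pair_b disjoint]
      by (simp add: product)
  qed
  then show ?Par ?Ser by blast+
qed

lemma network_pair_argmax_weight:
  "wf_net a \<Longrightarrow> network_pair (edges a) (argmax_weight u (trees a)) (argmax_weight u (cuts a))"
proof (induction a)
  case (Edge e)
  then show ?case using network_pairI [of "Edge e" "{}" "{{}}"] by (simp add: net_sum.empty)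
next
  case (Par a b)
  then show ?case by (intro network_pair_argmax_weight_Par) simp_all
next
  case (Ser a b)
  then show ?case by (intro network_pair_argmax_weight_Ser) simp_all
qed

lemma series_parallel_sum_argmax_weight:
  "wf_net a \<Longrightarrow> series_parallel_sum (edges a) (argmax_weight u (trees a))"
  by (rule network_pair_series_parallel_sum(1) [OF network_pair_argmax_weight])

subsection \<open>Transverse families\<close>

definition transverse_families :: "'a set set \<Rightarrow> 'a set set \<Rightarrow> bool" where
  "transverse_families M N \<longleftrightarrow>
     (\<forall>u. \<exists>v v'. (\<forall>x. u x = v x + v' x) \<and> weight_constant v M \<and> weight_constant v' N)"

lemma transverse_familiesE:
  assumes "transverse_families M N"
  obtains v v' where "\<And>x. u x = v x + v' x" "weight_constant v M" "weight_constant v' N"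
  using assms unfolding transverse_families_def by blast

lemma transverse_families_sym: "transverse_families M N \<Longrightarrow> transverse_families N M"
  unfolding transverse_families_def by (metis add.commute)

lemma transverse_families_mono:
  fixes M N N' :: "'a set set"
  assumes "transverse_families M N" "\<And>u. weight_constant u N \<Longrightarrow> weight_constant u N'"
  shows "transverse_families M N'"
  unfolding transverse_families_def
proof
  fix u :: "'a \<Rightarrow> real"
  obtain v v' where "\<And>x. u x = v x + v' x" "weight_constant v M" "weight_constant v' N"
    using transverse_familiesE [OF assms(1), of u] by blast
  moreover from this have "weight_constant v' N'" by (intro assms(2))
  ultimately show "\<exists>v v'. (\<forall>x. u x = v x + v' x) \<and> weight_constant v M \<and> weight_constant v' N'"
    by blast
qed

text \<open>As \<open>trees x\<close> and \<open>N\<close> have disjoint supports, every weight is the sum of one that is constant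
  on \<open>trees x\<close> and one that is constant on \<open>N\<close>. Then the claim is the modular law for the spaces
  of constant weights.\<close>

lemma transverse_families_shift:
  fixes M :: "'a set set"
  assumes "transverse_families M (trees x \<otimes> N)"
    and "net_sum Q E N" "wf_net x" "edges x \<inter> E = {}" "\<And>I. I \<in> M \<Longrightarrow> finite I"
  shows "transverse_families (M \<otimes> trees x) N"
  unfolding transverse_families_def
proof
  fix u :: "'a \<Rightarrow> real"
  define b where "b y = (if y \<in> E then u y else 0)" for y
  define c where "c y = (if y \<in> E then 0 else u y)" for y
  obtain v v' where b_split: "\<And>y. b y = v y + v' y"
    "weight_constant v M" "weight_constant v' (trees x \<otimes> N)"
    using transverse_familiesE [OF assms(1), of b] by blast
  have v'_constant: "weight_constant v' (trees x)" "weight_constant v' N"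
    by (rule net_sum_weight_constant_summand [OF assms(2-4) b_split(3)])+
  have "weight_constant b (trees x)"
    using assms(4) by (intro weight_constant_vanishing [OF trees_subset]) (auto simp: b_def)
  then have "weight_constant (\<lambda>y. b y - v' y) (trees x)"
    using v'_constant(1) by (rule weight_constant_diff)
  then have "weight_constant v (M \<otimes> trees x)"
    using b_split(1,2) assms(5) finite_tree by (intro weight_constant_disjoint_product) auto
  moreover have "weight_constant c N"
    by (rule weight_constant_vanishing [OF net_sum_subset [OF assms(2)]]) (simp add: c_def)
  then have "weight_constant (\<lambda>y. v' y + c y) N" using v'_constant(2) by (intro weight_constant_add)
  moreover have "u y = v y + (v' y + c y)" for y
    using b_split(1) [of y] by (simp add: b_def c_def split: if_splits)
  ultimately show "\<exists>v v'. (\<forall>y. u y = v y + v' y) \<and>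
      weight_constant v (M \<otimes> trees x) \<and> weight_constant v' N"
    by (intro exI [of _ v] exI [of _ "\<lambda>y. v' y + c y"]) simp
qed

lemma transverse_blocks_Int:
  assumes "transverse_families (trees x) (trees y)" "block x" "block y" "e \<in> edges x \<inter> edges y"
  shows "edges x \<inter> edges y = {e}"
proof -
  have "f = e" if "f \<in> edges x \<inter> edges y" for f
  proof -
    obtain v v' where split: "\<And>z. indicat_real {e} z = v z + v' z"
      "weight_constant v (trees x)" "weight_constant v' (trees y)"
      using transverse_familiesE [OF assms(1)] by blast
    have "v f = v e" "v' f = v' e"
      using weight_constant_block [OF assms(2) split(2)]
        weight_constant_block [OF assms(3) split(3)] that assms(4)
      by auto
    then have "indicat_real {e} f = indicat_real {e} e" unfolding split(1) by simp
    then show ?thesis by (simp add: indicator_eq_1_iff)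
  qed
  then show ?thesis using assms(4) by blast
qed

lemma transverse_blocks_merge:
  assumes "transverse_families (trees x) (trees y)" "block x" "block y" "edges x \<inter> edges y \<noteq> {}"
  obtains z where "block z" "edges z = edges x \<union> edges y" "trees z = trees x \<otimes> trees y"
proof -
  obtain e where "e \<in> edges x \<inter> edges y" using assms(4) by blast
  then have "edges x \<inter> edges y = {e}" by (rule transverse_blocks_Int [OF assms(1-3)])
  then show thesis using that by (rule block_merge [OF assms(2,3)])
qed

lemma net_sum_block_merge:
  assumes "net_sum block E M" "block x" "transverse_families (trees x) M"
  shows "net_sum block (edges x \<union> E) (trees x \<otimes> M)"
  using assms
proof (induction arbitrary: x rule: net_sum.induct)
  case empty
  then show ?case by (simp add: net_sum_single block_wf)
next
  case (loop E M e)
  show ?case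
    by (rule net_sum_superset [OF loop.IH [OF loop.prems]])
      (use net_sum_finite [OF loop.hyps(1)] in auto)
next
  case (summand E M y)
  note factors = net_sum_weight_constant_summand [OF summand.hyps(1,3,4)]
  show ?case
  proof (cases "edges x \<inter> edges y = {}")
    case True
    have "transverse_families (trees x) M"
      using summand.prems(2) factors(2) by (rule transverse_families_mono)
    with summand.prems(1) have "net_sum block (edges x \<union> E) (trees x \<otimes> M)"
      by (rule summand.IH)
    from net_sum.summand [OF this summand.hyps(2,3)]
    have "net_sum block (edges y \<union> (edges x \<union> E)) (trees y \<otimes> (trees x \<otimes> M))"
      using summand.hyps(4) True by blast
    then show ?thesis by (simp add: disjoint_product.left_commute Un_left_commute)
  next
    case False
    have "transverse_families (trees x) (trees y)"
      using summand.prems(2) factors(1) by (rule transverse_families_mono)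
    then obtain z where merged: "block z" "edges z = edges x \<union> edges y"
      "trees z = trees x \<otimes> trees y"
      using summand.prems(1) summand.hyps(2) False by (rule transverse_blocks_merge)
    have "transverse_families (trees z) M"
      unfolding merged(3) using summand.prems(2) summand.hyps(1,3,4) finite_tree
      by (intro transverse_families_shift) auto
    then show ?thesis
      using summand.IH [OF merged(1)] by (simp add: merged(2,3) Un_assoc disjoint_product.assoc)
  qed
qed

lemma net_sum_transverse_product:
  assumes "net_sum block E M" "net_sum block E' M'" "transverse_families M M'"
  shows "net_sum block (E \<union> E') (M \<otimes> M')"
  using assms(2,1,3)
proof (induction arbitrary: E M rule: net_sum.induct)
  case empty
  then show ?case by simp
next
  case (loop E' M' e)
  show ?case
    by (rule net_sum_superset [OF loop.IH [OF loop.prems]])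
      (use net_sum_finite [OF loop.prems(1)] net_sum_finite [OF loop.hyps(1)] in auto)
next
  case (summand E' M' x)
  note factors = net_sum_weight_constant_summand [OF summand.hyps(1,3,4)]
  have "transverse_families M (trees x)"
    using summand.prems(2) factors(1) by (rule transverse_families_mono)
  then have "net_sum block (edges x \<union> E) (trees x \<otimes> M)"
    by (rule net_sum_block_merge [OF summand.prems(1) summand.hyps(2) transverse_families_sym])
  moreover have "transverse_families (M \<otimes> trees x) M'"
    by (rule transverse_families_shift [OF summand.prems(2) summand.hyps(1) summand.hyps(3,4)])
      (rule net_sum_finite_member [OF summand.prems(1)])
  ultimately show ?case
    using summand.IH [of "edges x \<union> E" "trees x \<otimes> M"] by (simp add: disjoint_product_ac Un_ac)
qed

lemma series_parallel_sum_coloop_free: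
  assumes "series_parallel_sum E M" "\<Inter>M = {}"
  shows "net_sum block E M"
  using assms
proof (induction rule: net_sum.induct)
  case empty
  show ?case by (rule net_sum.empty)
next
  case (loop E M e)
  then show ?case by (simp add: net_sum.loop)
next
  case (summand E M x)
  have "block x"
  proof (rule ccontr)
    assume "\<not> block x"
    then obtain e where "x = Edge e" using summand.hyps(2) by (auto simp: block_or_coloop_def)
    then have "e \<in> \<Inter>(trees x \<otimes> M)" by (auto elim: disjoint_productE)
    then show False using summand.prems by blast
  qed
  moreover have "\<Inter>M \<subseteq> \<Inter>(trees x \<otimes> M)" by (auto elim!: disjoint_productE)
  ultimately show ?case using summand by (simp add: net_sum.summand)
qed

subsection \<open>Valuated matroids\<close>

lemma card_complement: "card (- I) = CARD('n) - card (I :: 'n::finite set)"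
  by (simp add: Compl_eq_Diff_UNIV card_Diff_subset)

lemma card_swap:
  fixes I :: "'n::finite set"
  shows "i \<in> I \<Longrightarrow> j \<notin> I \<Longrightarrow> card (insert j (I - {i})) = card I"
  by (metis Diff_iff card_Suc_Diff1 card_insert_disjoint finite)

lemma card_Diff_commute:
  fixes I J :: "'n::finite set"
  assumes "card I = card J"
  shows "card (I - J) = card (J - I)"
  using assms by (metis card_le_sym_Diff finite le_antisym order_refl)

lemma exists_set_of_card:
  assumes "k \<le> CARD('n)"
  obtains S :: "'n::finite set" where "card S = k"
  using obtain_subset_with_card_n [OF assms] by metis

lemma finite_obtains_minimizer:
  fixes f :: "'a \<Rightarrow> 'b::linorder"
  assumes "finite A" "A \<noteq> {}"
  obtains a where "a \<in> A" "\<And>b. b \<in> A \<Longrightarrow> f a \<le> f b"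
  using arg_min_if_finite(1) [OF assms] arg_min_least [OF assms] by blast

lemma obtains_abs_bound:
  fixes f :: "'a::finite \<Rightarrow> real"
  obtains K where "\<And>x. \<bar>f x\<bar> \<le> K"
proof
  show "\<bar>f x\<bar> \<le> (\<Sum>y\<in>UNIV. \<bar>f y\<bar>)" for x by (rule member_le_sum) auto
qed

definition valuated_matroid :: "nat \<Rightarrow> ('n::finite set \<Rightarrow> real) \<Rightarrow> bool" where
  "valuated_matroid d p \<longleftrightarrow> (\<forall>I B. card I = d \<longrightarrow> card B = d \<longrightarrow> (\<forall>i\<in>I - B. \<exists>j\<in>B - I.
     p (insert j (I - {i})) + p (insert i (B - {j})) \<le> p I + p B))"

lemma valuated_matroidE:
  assumes "valuated_matroid d p" "card I = d" "card B = d" "i \<in> I" "i \<notin> B"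
  obtains j where "j \<in> B" "j \<notin> I" "p (insert j (I - {i})) + p (insert i (B - {j})) \<le> p I + p B"
  using assms unfolding valuated_matroid_def by blast

lemma tropical_plucker_rank_le: "tropical_plucker d (p :: 'n::finite set \<Rightarrow> real) \<Longrightarrow> d \<le> CARD('n)"
  by (simp add: tropical_plucker_def)

lemma tropical_plucker_three_term:
  assumes "tropical_plucker d p" "card B = d" "j \<in> B" "k \<in> B" "j \<noteq> k" "i \<notin> B" "u \<notin> B" "i \<noteq> u"
  shows "min (p (insert u (B - {k})) + p (insert i (B - {j})))
      (p (insert i (B - {k})) + p (insert u (B - {j}))) \<le> p B + p
        (insert i (insert u (B - {j}) - {k}))"
proof -
  define S where "S = B - {j, k}"
  have B_eq: "B = insert j (insert k S)" using assms(3,4) by (auto simp: S_def)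
  have notin: "j \<notin> S" "k \<notin> S" "i \<notin> S" "u \<notin> S" using assms by (auto simp: S_def)
  have distinct: "distinct [j, k, u, i]" using assms(3-8) by auto
  have "card S + 2 = d" using assms(2,5) notin by (simp add: B_eq)
  moreover have "{j, k, u, i} \<inter> S = {}" using notin by blast
  ultimately have "min3_attained_twice (p (S \<union> {j, k}) + p (S \<union> {u, i}))
      (p (S \<union> {j, u}) + p (S \<union> {k, i})) (p (S \<union> {j, i}) + p (S \<union> {k, u}))"
    using assms(1) distinct unfolding tropical_plucker_def by blast
  moreover have "S \<union> {j, k} = B" "S \<union> {u, i} = insert i (insert u (B - {j}) - {k})"
    "S \<union> {j, u} = insert u (B - {k})" "S \<union> {k, i} = insert i (B - {j})"
    "S \<union> {j, i} = insert i (B - {k})" "S \<union> {k, u} = insert u (B - {j})"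
    using notin distinct by (auto simp: B_eq)
  ultimately show ?thesis unfolding min3_attained_twice_def by simp linarith
qed

lemma tropical_plucker_exchange_step:
  fixes B :: "'n::finite set" and u v :: 'n
  defines "B' \<equiv> insert u (B - {v})"
  assumes "tropical_plucker d p" "card B = d" "v \<in> B" "j \<in> B" "v \<noteq> j" "u \<notin> B" "i \<notin> B" "u \<noteq> i"
    and v_min: "p B' + p (insert v (I - {i})) \<le> p (insert u (B - {j})) + p (insert j (I - {i}))"
    and exchange: "p (insert j (I - {i})) + p (insert i (B' - {j})) \<le> p I + p B'"
  shows "p (insert j (I - {i})) + p (insert i (B - {j})) \<le> p I + p B \<or>
    p (insert v (I - {i})) + p (insert i (B - {v})) \<le> p I + p B"
proof -
  have "min (p (insert u (B - {j})) + p (insert i (B - {v}))) (p (insert i (B - {j})) + p B')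
      \<le> p B + p (insert i (B' - {j}))"
    unfolding B'_def using assms(2-9) by (intro tropical_plucker_three_term) auto
  then show ?thesis using v_min exchange by linarith
qed

text \<open>For a counterexample at minimal distance, \<open>B\<close>
  is moved towards \<open>I\<close> by the exchange of \<open>v\<close> for \<open>u\<close> that minimizes
  \<open>p (B - v + u) + p (I - i + v)\<close>.\<close>

lemma tropical_plucker_exchange:
  assumes "tropical_plucker d p" "card I = d" "card B = d" "i \<in> I" "i \<notin> B"
  shows "\<exists>j\<in>B - I. p (insert j (I - {i})) + p (insert i (B - {j})) \<le> p I + p B"
  using assms(3,5)
proof (induction "card (I - B)" arbitrary: B rule: less_induct)
  case less
  have card_eq: "card (I - B) = card (B - I)"
    using less.prems(1) assms(2) by (intro card_Diff_commute) simp
  then have "B - I \<noteq> {}"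
    using less.prems(2) assms(4) by (metis Diff_iff card_0_eq empty_iff finite)
  show ?case
  proof (cases "I - B = {i}")
    case True
    then obtain j where "B - I = {j}" using card_eq by (metis card_1_singleton_iff One_nat_def)
    with True have "insert j (I - {i}) = B" "insert i (B - {j}) = I" by blast+
    then show ?thesis using \<open>B - I = {j}\<close> by (intro bexI [of _ j]) auto
  next
    case False
    then obtain u where u_in: "u \<in> I" "u \<notin> B" "u \<noteq> i" using assms(4) less.prems by blast
    let ?cost = "\<lambda>v. p (insert u (B - {v})) + p (insert v (I - {i}))"
    obtain v where v_in: "v \<in> B - I" and v_min: "\<And>j. j \<in> B - I \<Longrightarrow> ?cost v \<le> ?cost j"
      using finite_obtains_minimizer [OF _ \<open>B - I \<noteq> {}\<close>, of ?cost] by auto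
    define B' where "B' = insert u (B - {v})"
    have "card (I - B') < card (I - B)"
      using u_in v_in by (intro psubset_card_mono) (auto simp: B'_def)
    moreover have "card B' = d" "i \<notin> B'"
      using card_swap [of v B u] u_in v_in less.prems by (auto simp: B'_def)
    ultimately obtain j where "j \<in> B' - I"
      and IH: "p (insert j (I - {i})) + p (insert i (B' - {j})) \<le> p I + p B'"
      using less.hyps by blast
    then have "j \<in> B - I" "v \<noteq> j" using u_in by (auto simp: B'_def)
    then show ?thesis
      using tropical_plucker_exchange_step [OF assms(1), of B v j u i I] u_in v_in v_min [of j] IH
        less.prems
      unfolding B'_def by blast
  qed
qed

lemma tropical_plucker_valuated_matroid: "tropical_plucker d p \<Longrightarrow> valuated_matroid d p"
  using tropical_plucker_exchange [of d p] unfolding valuated_matroid_def by blast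

lemma tropical_plucker_dual:
  fixes p :: "'n::finite set \<Rightarrow> real"
  assumes "tropical_plucker d p"
  shows "tropical_plucker (CARD('n) - d) (dual_plucker p)"
  unfolding tropical_plucker_def
proof (intro conjI allI impI)
  fix S :: "'n set" and i j k l
  assume card_S: "card S + 2 = CARD('n) - d"
    and dist: "distinct [i, j, k, l]" and disjoint: "{i, j, k, l} \<inter> S = {}"
  define S' where "S' = - (S \<union> {i, j, k, l})"
  have "card (S \<union> {i, j, k, l}) = card S + 4"
    using dist disjoint by (subst card_Un_disjoint) auto
  then have "card S' + 2 = d"
    using card_S tropical_plucker_rank_le [OF assms] card_mono [of UNIV "S \<union> {i, j, k, l}"]
    by (simp add: S'_def card_complement)
  moreover have "{i, j, k, l} \<inter> S' = {}" by (auto simp: S'_def)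
  ultimately have "min3_attained_twice (p (S' \<union> {i, j}) + p (S' \<union> {k, l}))
      (p (S' \<union> {i, k}) + p (S' \<union> {j, l})) (p (S' \<union> {i, l}) + p (S' \<union> {j, k}))"
    using assms dist unfolding tropical_plucker_def by blast
  moreover have "UNIV - (S \<union> {i, j}) = S' \<union> {k, l}" "UNIV - (S \<union> {k, l}) = S' \<union> {i, j}"
    "UNIV - (S \<union> {i, k}) = S' \<union> {j, l}" "UNIV - (S \<union> {j, l}) = S' \<union> {i, k}"
    "UNIV - (S \<union> {i, l}) = S' \<union> {j, k}" "UNIV - (S \<union> {j, k}) = S' \<union> {i, l}"
    using dist disjoint by (auto simp: S'_def)
  ultimately show "min3_attained_twice
      (dual_plucker p (S \<union> {i, j}) + dual_plucker p (S \<union> {k, l}))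
      (dual_plucker p (S \<union> {i, k}) + dual_plucker p (S \<union> {j, l}))
      (dual_plucker p (S \<union> {i, l}) + dual_plucker p (S \<union> {j, k}))"
    unfolding dual_plucker_def by (simp only: add.commute)
qed simp

subsection \<open>Minimizers\<close>

definition reduced_cost :: "('n::finite set \<Rightarrow> real) \<Rightarrow> real ^ 'n \<Rightarrow> 'n set \<Rightarrow> real" where
  "reduced_cost p w I = p I - (\<Sum>i\<in>I. w $ i)"

lemma minimizers_iff:
  "I \<in> minimizers d p w \<longleftrightarrow>
     card I = d \<and> (\<forall>J. card J = d \<longrightarrow> reduced_cost p w I \<le> reduced_cost p w J)"
  by (simp add: minimizers_def reduced_cost_def)

lemma minimizersD:
  "I \<in> minimizers d p w \<Longrightarrow> card I = d"
  "I \<in> minimizers d p w \<Longrightarrow> card J = d \<Longrightarrow> reduced_cost p w I \<le> reduced_cost p w J"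
  by (simp_all add: minimizers_iff)

lemma minimizers_le:
  assumes "I \<in> minimizers d p w" "card J = d" "reduced_cost p w J \<le> reduced_cost p w I"
  shows "J \<in> minimizers d p w"
  using assms unfolding minimizers_iff by (meson order_trans)

lemma minimizers_eq:
  assumes "I \<in> minimizers d p w" "J \<in> minimizers d p w"
  shows "reduced_cost p w I = reduced_cost p w J"
  using minimizersD [OF assms(1)] minimizersD [OF assms(2)] by (intro order_antisym) auto

lemma minimizers_nonempty:
  fixes p :: "'n::finite set \<Rightarrow> real"
  assumes "d \<le> CARD('n)"
  obtains I where "I \<in> minimizers d p w"
proof -
  have "{I :: 'n set. card I = d} \<noteq> {}" using exists_set_of_card [OF assms] by blast
  then obtain I where "I \<in> {I. card I = d}"
    "\<And>J. J \<in> {I. card I = d} \<Longrightarrow> reduced_cost p w I \<le> reduced_cost p w J"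
    using finite_obtains_minimizer [of "{I. card I = d}" "reduced_cost p w"] by auto
  then show thesis using that by (auto simp: minimizers_iff)
qed

lemma minimizers_cong:
  assumes "\<And>I J. card I = d \<Longrightarrow> card J = d \<Longrightarrow> p' I - p I = p' J - p J"
  shows "minimizers d p' w = minimizers d p w"
proof -
  have "reduced_cost p' w I \<le> reduced_cost p' w J \<longleftrightarrow> reduced_cost p w I \<le> reduced_cost p w J"
    if "card I = d" "card J = d" for I J
    using assms [OF that] by (auto simp: reduced_cost_def)
  then show ?thesis by (auto simp: set_eq_iff minimizers_iff)
qed

lemma minimizers_full: "minimizers CARD('n) p w = {UNIV :: 'n::finite set}"
proof -
  have "card I = CARD('n) \<longleftrightarrow> I = UNIV" for I :: "'n set" by (metis card_subset_eq finite subset_UNIV)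
  then show ?thesis by (auto simp: minimizers_iff)
qed

lemma minimizers_zero: "minimizers 0 p w = {{}}"
  by (auto simp: minimizers_iff)

lemma minimizers_dual:
  fixes p :: "'n::finite set \<Rightarrow> real"
  assumes "d \<le> CARD('n)"
  shows "minimizers (CARD('n) - d) (dual_plucker p) w = uminus ` minimizers d p (- w)"
proof -
  have cost: "reduced_cost (dual_plucker p) w (- I) = reduced_cost p (- w) I - (\<Sum>i\<in>UNIV. w $ i)"
    for I
    using sum.union_disjoint [of I "- I" "\<lambda>i. w $ i"]
    by (simp add: reduced_cost_def dual_plucker_def sum_negf Compl_eq_Diff_UNIV [symmetric])
  have card: "card (- I) = CARD('n) - d \<longleftrightarrow> card I = d" for I :: "'n set"
    using assms card_mono [of UNIV I] by (auto simp: card_complement)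
  have compl: "- I \<in> minimizers (CARD('n) - d) (dual_plucker p) w \<longleftrightarrow> I \<in> minimizers d p (- w)" for I
  proof -
    have "- I \<in> minimizers (CARD('n) - d) (dual_plucker p) w \<longleftrightarrow> card (- I) = CARD('n) - d \<and>
        (\<forall>J. card (- J) = CARD('n) - d \<longrightarrow>
          reduced_cost (dual_plucker p) w (- I) \<le> reduced_cost (dual_plucker p) w (- J))"
      unfolding minimizers_iff by (metis double_complement)
    then show ?thesis by (simp add: cost card minimizers_iff)
  qed
  show ?thesis
  proof (intro set_eqI)
    fix I
    show "I \<in> minimizers (CARD('n) - d) (dual_plucker p) w \<longleftrightarrow> I \<in> uminus ` minimizers d p (- w)"
      using compl [of "- I"] by (auto simp: image_iff intro: bexI [of _ "- I"])
  qed
qed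

lemma reduced_cost_add_mult:
  "reduced_cost p (\<chi> i. w $ i + t * v i) I = reduced_cost p w I - t * sum v I"
  by (simp add: reduced_cost_def sum.distrib sum_distrib_left)

lemma reduced_cost_shift:
  fixes p :: "'n::finite set \<Rightarrow> real" and A B :: "'n set" and w :: "real ^ 'n" and t :: real
  defines "w' \<equiv> (\<chi> x. w $ x + t * (indicat_real A x - indicat_real (- B) x))"
  shows "reduced_cost p w' I = reduced_cost p w I - t * card A + t * (card (A - I) + card (I - B))"
proof -
  have "card A = card (I \<inter> A) + card (A - I)"
    using card_Int_Diff [of A I] by (simp add: Int_commute)
  then show ?thesis
    unfolding w'_def reduced_cost_add_mult
    by (simp add: sum_subtractf sum_indicat_real Diff_eq [of I B] algebra_simps)
qed

text \<open>Large weights on \<open>A\<close> and large negative ones outside \<open>B\<close> force all minimizers to lie between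
  \<open>A\<close> and \<open>B\<close>.\<close>

lemma minimizers_between:
  fixes p :: "'n::finite set \<Rightarrow> real" and A B :: "'n set" and d :: nat
  defines "D \<equiv> {I. card I = d \<and> A \<subseteq> I \<and> I \<subseteq> B}"
  assumes "D \<noteq> {}"
  obtains w' where "minimizers d p w' = {I \<in> D. \<forall>J\<in>D. reduced_cost p w I \<le> reduced_cost p w J}"
proof -
  obtain K where bound: "\<And>I. \<bar>reduced_cost p w I\<bar> \<le> K"
    using obtains_abs_bound [of "reduced_cost p w"] by blast
  define t where "t = 2 * K + 1"
  define w' where "w' = (\<chi> x. w $ x + t * (indicat_real A x - indicat_real (- B) x))"
  have "0 \<le> t" using bound [of "{}"] by (simp add: t_def)
  have inside: "reduced_cost p w' I = reduced_cost p w I - t * card A" if "I \<in> D" for I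
    using that by (simp add: w'_def reduced_cost_shift D_def Diff_eq_empty_iff [THEN iffD2])
  have outside: "reduced_cost p w I - t * card A + t \<le> reduced_cost p w' I"
    if "card I = d" "I \<notin> D" for I
  proof -
    have "A - I \<noteq> {} \<or> I - B \<noteq> {}" using that by (auto simp: D_def)
    then have "1 \<le> card (A - I) + card (I - B)" by (auto simp: Suc_le_eq card_gt_0_iff)
    then have "t \<le> t * (card (A - I) + card (I - B))"
      using mult_left_mono [OF _ \<open>0 \<le> t\<close>, of 1] by simp
    then show ?thesis by (simp add: w'_def reduced_cost_shift)
  qed
  have less: "reduced_cost p w' I < reduced_cost p w' J" if "I \<in> D" "card J = d" "J \<notin> D" for I J
    using inside [OF that(1)] outside [OF that(2,3)] bound [of I] bound [of J] by (simp add: t_def)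
  have "minimizers d p w' = {I \<in> D. \<forall>J\<in>D. reduced_cost p w I \<le> reduced_cost p w J}"
  proof (intro equalityI subsetI)
    fix I assume I_min: "I \<in> minimizers d p w'"
    obtain J where "J \<in> D" using assms(2) by blast
    then have "I \<in> D" using less [of J I] minimizersD [OF I_min] by (force simp: D_def)
    moreover have "reduced_cost p w' I \<le> reduced_cost p w' J" if "J \<in> D" for J
      using that minimizersD(2) [OF I_min] by (simp add: D_def)
    ultimately show "I \<in> {I \<in> D. \<forall>J\<in>D. reduced_cost p w I \<le> reduced_cost p w J}"
      by (simp add: inside)
  next
    fix I assume I_opt: "I \<in> {I \<in> D. \<forall>J\<in>D. reduced_cost p w I \<le> reduced_cost p w J}"
    have "reduced_cost p w' I \<le> reduced_cost p w' J" if "card J = d" for J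
      using I_opt less [of I J] that by (cases "J \<in> D") (auto simp: inside)
    then show "I \<in> minimizers d p w'" using I_opt by (simp add: minimizers_iff D_def)
  qed
  then show thesis by (rule that)
qed

lemma card_add_2_between:
  fixes S :: "'n::finite set"
  assumes "distinct [i, j, k, l]" "{i, j, k, l} \<inter> S = {}"
  shows "{I. card I = card S + 2 \<and> S \<subseteq> I \<and> I \<subseteq> S \<union> {i, j, k, l}} =
    (\<union>) S ` {{i, j}, {k, l}, {i, k}, {j, l}, {i, l}, {j, k}}" (is "?D = (\<union>) S ` ?pairs")
proof -
  have pairs: "{x, y} \<in> ?pairs \<longleftrightarrow> x \<noteq> y \<and> {x, y} \<subseteq> {i, j, k, l}" for x y
    using assms(1) by (auto simp: doubleton_eq_iff)
  show ?thesis
  proof (intro equalityI subsetI)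
    fix I assume "I \<in> ?D"
    then have sub: "S \<subseteq> I" "I \<subseteq> S \<union> {i, j, k, l}" and "card I = card S + 2" by auto
    then have "card (I - S) = 2" by (auto simp: card_Diff_subset)
    then obtain x y where diff: "I - S = {x, y}" "x \<noteq> y" by (auto simp: card_2_iff)
    then have I_eq: "I = S \<union> {x, y}" and "{x, y} \<subseteq> {i, j, k, l}" using sub by auto
    then have "{x, y} \<in> ?pairs" using pairs [of x y] diff(2) by simp
    with I_eq show "I \<in> (\<union>) S ` ?pairs" by (rule image_eqI)
  next
    fix I assume "I \<in> (\<union>) S ` ?pairs"
    then obtain P where "I = S \<union> P" and P_pair: "P \<in> ?pairs" by (rule imageE)
    moreover from P_pair obtain x y where "P = {x, y}" by blast
    ultimately have "I = S \<union> {x, y}" "x \<noteq> y" "{x, y} \<subseteq> {i, j, k, l}"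
      using pairs [of x y] by simp_all
    moreover from this have "x \<notin> S" "y \<notin> S" using assms(2) by auto
    ultimately show "I \<in> ?D" by auto
  qed
qed

lemma four_point_weights:
  fixes ij kl ik jl il jk :: real
  assumes "ij + kl < ik + jl" "ij + kl < il + jk"
  obtains wi wj wk wl where "wi + wj = ij" "wk + wl = kl"
    "wi + wk < ik" "wj + wl < jl" "wi + wl < il" "wj + wk < jk"
proof -
  define s where "s = (ij + kl - jl + ik) / 2"
  define t where "t = (ij - jk + il - kl) / 2"
  show thesis
    by (rule that [of "(s + t) / 2" "ij - (s + t) / 2" "(s - t) / 2" "kl - (s - t) / 2"])
      (use assms in \<open>simp_all add: s_def t_def field_simps\<close>)
qed

lemma diagonal_reduced_costs:
  fixes p :: "'n::finite set \<Rightarrow> real"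
  assumes "distinct [i, j, k, l]" "{i, j, k, l} \<inter> S = {}"
    and "p (S \<union> {i, j}) + p (S \<union> {k, l}) < p (S \<union> {i, k}) + p (S \<union> {j, l})"
    and "p (S \<union> {i, j}) + p (S \<union> {k, l}) < p (S \<union> {i, l}) + p (S \<union> {j, k})"
  obtains w where "reduced_cost p w (S \<union> {i, j}) = 0" "reduced_cost p w (S \<union> {k, l}) = 0"
    "0 < reduced_cost p w (S \<union> {i, k})" "0 < reduced_cost p w (S \<union> {j, l})"
    "0 < reduced_cost p w (S \<union> {i, l})" "0 < reduced_cost p w (S \<union> {j, k})"
proof -
  obtain wi wj wk wl where weights:
    "wi + wj = p (S \<union> {i, j})" "wk + wl = p (S \<union> {k, l})"
    "wi + wk < p (S \<union> {i, k})" "wj + wl < p (S \<union> {j, l})"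
    "wi + wl < p (S \<union> {i, l})" "wj + wk < p (S \<union> {j, k})"
    using assms(3,4) by (rule four_point_weights)
  define w where "w = (\<chi> x. if x = i then wi else if x = j then wj
     else if x = k then wk else if x = l then wl else 0)"
  have w_apply: "w $ i = wi" "w $ j = wj" "w $ k = wk" "w $ l = wl" "\<And>x. x \<in> S \<Longrightarrow> w $ x = 0"
    using assms(1,2) by (auto simp: w_def)
  have cost: "reduced_cost p w (S \<union> {x, y}) = p (S \<union> {x, y}) - (w $ x + w $ y)"
    if "x \<notin> S" "y \<notin> S" "x \<noteq> y" for x y
    using that w_apply(5) by (simp add: reduced_cost_def)
  show thesis
    by (rule that; subst cost) (use assms(1,2) weights in \<open>simp_all add: w_apply\<close>)
qed

lemma minimizers_diagonal:
  fixes p :: "'n::finite set \<Rightarrow> real"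
  assumes "card S + 2 = d" "distinct [i, j, k, l]" "{i, j, k, l} \<inter> S = {}"
    and "p (S \<union> {i, j}) + p (S \<union> {k, l}) < p (S \<union> {i, k}) + p (S \<union> {j, l})"
    and "p (S \<union> {i, j}) + p (S \<union> {k, l}) < p (S \<union> {i, l}) + p (S \<union> {j, k})"
  obtains w where "minimizers d p w = {S \<union> {i, j}, S \<union> {k, l}}"
proof -
  obtain w where costs: "reduced_cost p w (S \<union> {i, j}) = 0" "reduced_cost p w (S \<union> {k, l}) = 0"
    "0 < reduced_cost p w (S \<union> {i, k})" "0 < reduced_cost p w (S \<union> {j, l})"
    "0 < reduced_cost p w (S \<union> {i, l})" "0 < reduced_cost p w (S \<union> {j, k})"
    using assms(2-5) by (rule diagonal_reduced_costs)
  define D where "D = {I. card I = d \<and> S \<subseteq> I \<and> I \<subseteq> S \<union> {i, j, k, l}}"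
  have D_eq: "D = (\<union>) S ` {{i, j}, {k, l}, {i, k}, {j, l}, {i, l}, {j, k}}"
    unfolding D_def assms(1) [symmetric] using assms(2,3) by (intro card_add_2_between)
  have D_cases: "I = S \<union> {i, j} \<or> I = S \<union> {k, l} \<or> 0 < reduced_cost p w I" if "I \<in> D" for I
    using that costs(3-6) unfolding D_eq by blast
  have diagonal: "S \<union> {i, j} \<in> D" "S \<union> {k, l} \<in> D" unfolding D_eq by blast+
  then have "D \<noteq> {}" by blast
  then obtain w' where "minimizers d p w' = {I \<in> D. \<forall>J\<in>D. reduced_cost p w I \<le> reduced_cost p w J}"
    unfolding D_def by (rule minimizers_between)
  also have "\<dots> = {S \<union> {i, j}, S \<union> {k, l}}"
  proof (intro equalityI subsetI)
    fix I assume "I \<in> {I \<in> D. \<forall>J\<in>D. reduced_cost p w I \<le> reduced_cost p w J}"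
    then have "I \<in> D" "reduced_cost p w I \<le> 0" using diagonal(1) costs(1) by force+
    then show "I \<in> {S \<union> {i, j}, S \<union> {k, l}}" using D_cases by fastforce
  next
    fix I assume "I \<in> {S \<union> {i, j}, S \<union> {k, l}}"
    then have "I \<in> D" "reduced_cost p w I = 0" using diagonal costs(1,2) by blast+
    moreover have "0 \<le> reduced_cost p w J" if "J \<in> D" for J
      using D_cases [OF that] costs(1,2) by fastforce
    ultimately show "I \<in> {I \<in> D. \<forall>J\<in>D. reduced_cost p w I \<le> reduced_cost p w J}" by simp
  qed
  finally show thesis by (rule that)
qed

lemma tropical_pluckerI_minimizers:
  fixes p :: "'n::finite set \<Rightarrow> real"
  assumes "d \<le> CARD('n)"
    and "\<And>w S i j k l. distinct [i, j, k, l] \<Longrightarrow> {i, j, k, l} \<inter> S = {} \<Longrightarrow>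
      minimizers d p w \<noteq> {S \<union> {i, j}, S \<union> {k, l}}"
  shows "tropical_plucker d p"
  unfolding tropical_plucker_def
proof (intro conjI allI impI assms(1))
  fix S :: "'n set" and i j k l
  assume distinct_indices: "card S + 2 = d" "distinct [i, j, k, l]" "{i, j, k, l} \<inter> S = {}"
  let ?a = "p (S \<union> {i, j}) + p (S \<union> {k, l})" and ?b = "p (S \<union> {i, k}) + p (S \<union> {j, l})"
    and ?c = "p (S \<union> {i, l}) + p (S \<union> {j, k})"
  have "\<not> (?a < ?b \<and> ?a < ?c)"
    using minimizers_diagonal [OF distinct_indices] assms(2) [OF distinct_indices(2,3)] by blast
  moreover have "\<not> (?b < ?a \<and> ?b < ?c)"
    using minimizers_diagonal [of S d i k j l p] assms(2) [of i k j l S] distinct_indices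
    by (auto simp: insert_commute [of k j])
  moreover have "\<not> (?c < ?a \<and> ?c < ?b)"
    using minimizers_diagonal [of S d i l j k p] assms(2) [of i l j k S] distinct_indices
    by (auto simp: insert_commute [of l j] insert_commute [of l k])
  ultimately show "min3_attained_twice ?a ?b ?c"
    unfolding min3_attained_twice_def by linarith
qed

subsection \<open>Reconstruction of a valuation from its tropical linear space\<close>

text \<open>The \<open>x\<close> below is a valuated cocircuit, with large finite coordinates in place of \<open>\<infinity>\<close>.\<close>

lemma cocircuit_point:
  fixes p :: "'n::finite set \<Rightarrow> real"
  assumes "valuated_matroid d p" "card S + 1 = d"
  obtains x where "x \<in> tropical_linear_space d p" "\<And>i. i \<notin> S \<Longrightarrow> x $ i = p (insert i S)"
    "\<And>i. i \<in> S \<Longrightarrow> c \<le> x $ i"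
proof -
  obtain K where bound: "\<And>I. \<bar>p I\<bar> \<le> K" using obtains_abs_bound [of p] by blast
  define x where "x = (\<chi> i. if i \<in> S then max (3 * K) c else p (insert i S))"
  have x_in: "3 * K \<le> x $ i" "c \<le> x $ i" if "i \<in> S" for i using that by (simp_all add: x_def)
  have x_out: "x $ i = p (insert i S)" if "i \<notin> S" for i using that by (simp add: x_def)
  have "min_attained_twice J (\<lambda>j. p (J - {j}) + x $ j)" if card_J: "card J = d + 1" for J
  proof -
    let ?g = "\<lambda>j. p (J - {j}) + x $ j"
    have "\<not> J \<subseteq> S" using card_mono [of S J] card_J assms(2) by auto
    then have "J - S \<noteq> {}" by blast
    then obtain j where j_in: "j \<in> J - S" and min: "\<And>k. k \<in> J - S \<Longrightarrow> ?g j \<le> ?g k"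
      using finite_obtains_minimizer [of "J - S" ?g] by auto
    have "card (insert j S) = d" "card (J - {j}) = d" using j_in card_J assms(2) by auto
    then obtain f where f_exchange: "f \<in> J - {j}" "f \<notin> insert j S"
      "p (insert f (insert j S - {j})) + p (insert j (J - {j} - {f}))
        \<le> p (insert j S) + p (J - {j})"
      by (rule valuated_matroidE [OF assms(1)]) auto
    have "insert j S - {j} = S" "insert j (J - {j} - {f}) = J - {f}" using j_in f_exchange by auto
    then have "?g f \<le> ?g j" using f_exchange j_in x_out by simp
    moreover have "?g j \<le> ?g k" if "k \<in> J" for k
    proof (cases "k \<in> S")
      case True
      have "?g j \<le> 2 * K" using bound [of "J - {j}"] bound [of "insert j S"] x_out j_in by auto
      also have "\<dots> \<le> ?g k" using bound [of "J - {k}"] x_in(1) [OF True] by auto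
      finally show ?thesis .
    qed (use that min in blast)
    ultimately show ?thesis
      unfolding min_attained_twice_def using j_in f_exchange(1)
      by (intro bexI [of _ j] bexI [of _ f]) (auto intro: order_antisym)
  qed
  then have "x \<in> tropical_linear_space d p" by (simp add: tropical_linear_space_def)
  then show thesis using that x_in(2) x_out by blast
qed

lemma tropical_linear_space_rank_le:
  fixes p p' :: "'n::finite set \<Rightarrow> real"
  assumes "valuated_matroid d p" "d \<le> CARD('n)"
    and "tropical_linear_space d p \<subseteq> tropical_linear_space d' p'"
  shows "d \<le> d'"
proof (rule ccontr)
  assume "\<not> d \<le> d'"
  have "d - 1 \<le> CARD('n)" using assms(2) by simp
  then obtain S :: "'n set" where "card S = d - 1" by (rule exists_set_of_card)
  then have card_S: "card S + 1 = d" "d' \<le> card S" using \<open>\<not> d \<le> d'\<close> by auto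
  then obtain S' where S'_sub: "S' \<subseteq> S" "card S' = d'" by (meson obtain_subset_with_card_n)
  have "S \<noteq> UNIV" using card_S assms(2) by auto
  then obtain i where i_notin: "i \<notin> S" by blast
  obtain K where bound: "\<And>I. \<bar>p' I\<bar> \<le> K" using obtains_abs_bound [of p'] by blast
  obtain x where x_in: "x \<in> tropical_linear_space d p" "\<And>i. i \<notin> S \<Longrightarrow> x $ i = p (insert i S)"
    and large: "\<And>j. j \<in> S \<Longrightarrow> p (insert i S) + 2 * K + 1 \<le> x $ j"
    using cocircuit_point [OF assms(1) card_S(1)] by metis
  have "card (insert i S') = d' + 1" using S'_sub i_notin by (subst card_insert_disjoint) auto
  then have "min_attained_twice (insert i S') (\<lambda>j. p' (insert i S' - {j}) + x $ j)"
    using x_in(1) assms(3) unfolding tropical_linear_space_def by blast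
  then obtain a where "a \<in> S'" "p' (insert i S' - {a}) + x $ a \<le> p' (insert i S' - {i}) + x $ i"
    unfolding min_attained_twice_def by (metis insertE insertI1)
  then show False
    using bound [of "insert i S' - {a}"] bound [of "insert i S' - {i}"] large [of a]
      x_in(2) [OF i_notin] S'_sub
    by auto
qed

lemma constant_by_exchange:
  fixes f :: "'n::finite set \<Rightarrow> 'b"
  assumes "\<And>S i j. card S + 1 = d \<Longrightarrow> i \<notin> S \<Longrightarrow> j \<notin> S \<Longrightarrow> f (insert i S) = f (insert j S)"
    and "card I = d" "card J = d"
  shows "f I = f J"
  using assms(2)
proof (induction "card (I - J)" arbitrary: I rule: less_induct)
  case less
  show ?case
  proof (cases "I - J = {}")
    case True
    then show ?thesis using less.prems assms(3) card_subset_eq [of J I] by auto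
  next
    case False
    then obtain i where i_in: "i \<in> I" "i \<notin> J" by blast
    have "\<not> J \<subseteq> I" using less.prems assms(3) i_in card_subset_eq [of I J] by auto
    then obtain j where j_in: "j \<in> J" "j \<notin> I" by blast
    have "card (insert j (I - {i}) - J) < card (I - J)"
      using i_in j_in by (intro psubset_card_mono) auto
    moreover have "card (insert j (I - {i})) = d" using i_in j_in less.prems card_swap by metis
    ultimately have "f (insert j (I - {i})) = f J" using less.hyps by blast
    moreover have "f (insert j (I - {i})) = f (insert i (I - {i}))"
      using i_in j_in less.prems card_Suc_Diff1 [of I i] by (intro assms(1)) auto
    ultimately show ?thesis using i_in by (simp add: insert_absorb)
  qed
qed

lemma tropical_linear_space_subset_diff_constant:
  fixes p p' :: "'n::finite set \<Rightarrow> real"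
  assumes "valuated_matroid d p"
    and "tropical_linear_space d p \<subseteq> tropical_linear_space d p'"
    and "card I = d" "card J = d"
  shows "p' I - p I = p' J - p J"
proof (rule constant_by_exchange [where f = "\<lambda>I. p' I - p I", OF _ assms(3,4)])
  fix S :: "'n set" and i j
  assume S_ij: "card S + 1 = d" "i \<notin> S" "j \<notin> S"
  show "p' (insert i S) - p (insert i S) = p' (insert j S) - p (insert j S)"
  proof (cases "i = j")
    case False
    obtain K where bound: "\<And>I. \<bar>p' I\<bar> \<le> K" using obtains_abs_bound [of p'] by blast
    obtain x where x_in: "x \<in> tropical_linear_space d p" "\<And>i. i \<notin> S \<Longrightarrow> x $ i = p (insert i S)"
      and large: "\<And>j. j \<in> S \<Longrightarrow> p (insert i S) + 2 * K + 1 \<le> x $ j"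
      using cocircuit_point [OF assms(1) S_ij(1)] by metis
    let ?J = "insert i (insert j S)"
    let ?g = "\<lambda>k. p' (?J - {k}) + x $ k"
    have "card ?J = d + 1" using S_ij False by simp
    then have "min_attained_twice ?J ?g"
      using x_in(1) assms(2) unfolding tropical_linear_space_def by blast
    then obtain a b where attained: "a \<in> ?J" "b \<in> ?J" "a \<noteq> b" "?g a = ?g b"
      "\<And>c. c \<in> ?J \<Longrightarrow> ?g a \<le> ?g c"
      unfolding min_attained_twice_def by blast
    have "?g i < ?g k" if "k \<in> S" for k
      using bound [of "?J - {k}"] bound [of "?J - {i}"] large [OF that] x_in(2) [OF S_ij(2)] by auto
    then have "a \<notin> S" "b \<notin> S" using attained by (metis insertI1 linorder_not_less)+
    then have "?g i = ?g j" using attained by auto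
    moreover have "?J - {i} = insert j S" "?J - {j} = insert i S" using S_ij False by auto
    ultimately show ?thesis using x_in(2) [OF S_ij(2)] x_in(2) [OF S_ij(3)] by simp
  qed simp
qed

lemma tropical_linear_space_eqD:
  fixes p p' :: "'n::finite set \<Rightarrow> real"
  assumes "tropical_plucker d p" "tropical_plucker d' p'"
    and spaces_eq: "tropical_linear_space d p = tropical_linear_space d' p'"
  shows "d = d'" and "minimizers d p = minimizers d' p'"
proof -
  have val: "valuated_matroid d p" "valuated_matroid d' p'"
    using assms(1,2) by (simp_all add: tropical_plucker_valuated_matroid)
  moreover have "d \<le> CARD('n)" "d' \<le> CARD('n)"
    using assms(1,2) by (simp_all add: tropical_plucker_def)
  ultimately show d_eq: "d = d'"
    using tropical_linear_space_rank_le spaces_eq by (metis order_antisym order_refl)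
  have sub: "valuated_matroid d' p" "tropical_linear_space d' p \<subseteq> tropical_linear_space d' p'"
    using val(1) spaces_eq d_eq by simp_all
  have "minimizers d' p' w = minimizers d' p w" for w
  proof (rule minimizers_cong)
    fix I J :: "'n set" assume "card I = d'" "card J = d'"
    then show "p' I - p I = p' J - p J"
      by (rule tropical_linear_space_subset_diff_constant [OF sub])
  qed
  then show "minimizers d p = minimizers d' p'" by (simp add: d_eq fun_eq_iff)
qed

subsection \<open>Stable intersections\<close>

lemma valuated_matroid_reduced_cost:
  fixes p :: "'n::finite set \<Rightarrow> real"
  assumes "valuated_matroid d p"
  shows "valuated_matroid d (reduced_cost p w)"
  unfolding valuated_matroid_def
proof (intro allI impI ballI)
  fix I B :: "'n set" and i assume bases: "card I = d" "card B = d" "i \<in> I - B"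
  then obtain j where exchange: "j \<in> B" "j \<notin> I"
    "p (insert j (I - {i})) + p (insert i (B - {j})) \<le> p I + p B"
    using valuated_matroidE [OF assms] by blast
  have "(\<Sum>k\<in>insert j (I - {i}). w $ k) + (\<Sum>k\<in>insert i (B - {j}). w $ k) =
      (\<Sum>k\<in>I. w $ k) + (\<Sum>k\<in>B. w $ k)"
    using bases exchange by (simp add: sum_diff1)
  then show "\<exists>j\<in>B - I. reduced_cost p w (insert j (I - {i})) + reduced_cost p w (insert i (B - {j}))
      \<le> reduced_cost p w I + reduced_cost p w B"
    using exchange by (intro bexI [of _ j]) (auto simp: reduced_cost_def)
qed

lemma Union_minimizers_imp_tropical_linear_space:
  fixes p :: "'n::finite set \<Rightarrow> real"
  assumes "valuated_matroid d p" and loopless: "\<Union>(minimizers d p w) = UNIV"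
  shows "w \<in> tropical_linear_space d p"
  unfolding tropical_linear_space_def
proof (intro CollectI allI impI)
  fix J :: "'n set" assume card_J: "card J = d + 1"
  let ?c = "reduced_cost p w"
  have cost: "p (J - {j}) + w $ j = ?c (J - {j}) + (\<Sum>i\<in>J. w $ i)" if "j \<in> J" for j
    using that by (simp add: reduced_cost_def sum_diff1)
  have "J \<noteq> {}" using card_J by auto
  then obtain j where j_in: "j \<in> J" and min: "\<And>k. k \<in> J \<Longrightarrow> ?c (J - {j}) \<le> ?c (J - {k})"
    using finite_obtains_minimizer [of J "\<lambda>j. ?c (J - {j})"] by auto
  have "j \<in> \<Union>(minimizers d p w)" by (simp add: loopless)
  then obtain B where B_min: "B \<in> minimizers d p w" "j \<in> B" by blast
  have "card (J - {j}) = d" "j \<notin> J - {j}" using j_in card_J by auto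
  then obtain f where f_exchange: "f \<in> J - {j}" "f \<notin> B"
    "?c (insert f (B - {j})) + ?c (insert j (J - {j} - {f})) \<le> ?c B + ?c (J - {j})"
    using valuated_matroidE
      [OF valuated_matroid_reduced_cost [OF assms(1)] minimizersD(1) [OF B_min(1)] _ B_min(2)]
    by metis
  have "?c B \<le> ?c (insert f (B - {j}))"
    using card_swap [OF B_min(2) f_exchange(2)] minimizersD [OF B_min(1)] by simp
  moreover have "insert j (J - {j} - {f}) = J - {f}" using j_in f_exchange by auto
  ultimately have "?c (J - {f}) \<le> ?c (J - {j})" using f_exchange by simp
  then have "?c (J - {f}) = ?c (J - {j})" using min [of f] f_exchange by simp
  then show "min_attained_twice J (\<lambda>j. p (J - {j}) + w $ j)"
    unfolding min_attained_twice_def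
    using j_in f_exchange min cost by (intro bexI [of _ j] bexI [of _ f]) auto
qed

lemma Un_eq_UNIV_iff_card_Int:
  fixes I I' :: "'n::finite set"
  assumes "CARD('n) \<le> card I + card I'"
  shows "I \<union> I' = UNIV \<longleftrightarrow> card (I \<inter> I') = card I + card I' - CARD('n)"
proof -
  have "I \<union> I' = UNIV \<longleftrightarrow> card (I \<union> I') = CARD('n)" by (metis card_subset_eq finite subset_UNIV)
  then show ?thesis using card_Un_Int [of I I'] assms card_mono [of UNIV "I \<union> I'"] by auto
qed

lemma sum_Int_of_Un_eq_UNIV:
  fixes I I' :: "'n::finite set" and w :: "'n \<Rightarrow> real"
  assumes "I \<union> I' = UNIV"
  shows "sum w (I \<inter> I') = sum w I + sum w I' - sum w UNIV"
  using sum.union_inter [of I I' w] assms by simp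

lemma obtain_Int_with_cards:
  fixes J :: "'n::finite set"
  assumes "d \<le> CARD('n)" "d' \<le> CARD('n)" "CARD('n) \<le> d + d'" "card J = d + d' - CARD('n)"
  obtains I I' where "card I = d" "card I' = d'" "I \<inter> I' = J"
proof -
  have "CARD('n) - d \<le> card (- J)" using assms by (simp add: card_complement)
  then obtain K where K_sub: "K \<subseteq> - J" "card K = CARD('n) - d" by (meson obtain_subset_with_card_n)
  then have "J \<inter> K = {}" by blast
  then have "card (- K) = d" "card (J \<union> K) = d'"
    using K_sub(2) assms by (simp_all add: card_complement card_Un_disjoint)
  moreover have "(- K) \<inter> (J \<union> K) = J" using K_sub(1) by blast
  ultimately show thesis by (rule that)
qed

lemma complement_disjoint_product_iff:
  "K \<in> (uminus ` M) \<otimes> (uminus ` M') \<longleftrightarrow> (\<exists>I\<in>M. \<exists>I'\<in>M'. I \<union> I' = UNIV \<and> K = - (I \<inter> I'))"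
proof
  assume "K \<in> (uminus ` M) \<otimes> (uminus ` M')"
  then obtain I I' where "K = - I \<union> - I'" "I \<in> M" "I' \<in> M'" "- I \<inter> - I' = {}"
    by (elim disjoint_productE imageE) auto
  then show "\<exists>I\<in>M. \<exists>I'\<in>M'. I \<union> I' = UNIV \<and> K = - (I \<inter> I')"
    by (intro bexI [of _ I] bexI [of _ I']) auto
next
  assume "\<exists>I\<in>M. \<exists>I'\<in>M'. I \<union> I' = UNIV \<and> K = - (I \<inter> I')"
  then obtain I I' where "I \<in> M" "I' \<in> M'" "K = - I \<union> - I'" "- I \<inter> - I' = {}" by auto
  then show "K \<in> (uminus ` M) \<otimes> (uminus ` M')" by (simp add: disjoint_productI)
qed

lemma finite_pair_sums:
  fixes f g :: "'a::finite \<Rightarrow> 'b::plus"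
  shows "finite {f x + g y | x y. P x y}"
  by (rule finite_subset [of _ "(\<lambda>(x, y). f x + g y) ` UNIV"]) auto

context
  fixes p p' :: "'n::finite set \<Rightarrow> real" and d d' r :: nat and q
  assumes dims: "d \<le> CARD('n)" "d' \<le> CARD('n)" "CARD('n) \<le> d + d'"
  defines "r \<equiv> d + d' - CARD('n)" and "q \<equiv> stable_intersection d p d' p'"
begin

lemma reduced_cost_stable_intersection_le:
  assumes "card I = d" "card I' = d'" "I \<union> I' = UNIV"
  shows "reduced_cost q w (I \<inter> I') \<le> reduced_cost p w I + reduced_cost p' w I' + (\<Sum>i\<in>UNIV. w $ i)"
proof -
  have "q (I \<inter> I') \<le> p I + p' I'"
    unfolding q_def stable_intersection_def
    using assms(1,2) by (intro Min_le finite_pair_sums) blast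
  then show ?thesis
    using sum_Int_of_Un_eq_UNIV [OF assms(3), of "($) w"] by (simp add: reduced_cost_def)
qed

lemma reduced_cost_stable_intersection_attained:
  assumes "card J = r"
  obtains I I' where "card I = d" "card I' = d'" "I \<inter> I' = J" "I \<union> I' = UNIV"
    "reduced_cost q w J = reduced_cost p w I + reduced_cost p' w I' + (\<Sum>i\<in>UNIV. w $ i)"
proof -
  let ?A = "{p I + p' I' | I I'. card I = d \<and> card I' = d' \<and> I \<inter> I' = J}"
  obtain A A' where "card A = d" "card A' = d'" "A \<inter> A' = J"
    using obtain_Int_with_cards [OF dims assms [unfolded r_def]] .
  then have "?A \<noteq> {}" by blast
  moreover have "finite ?A" by (rule finite_pair_sums)
  ultimately have "Min ?A \<in> ?A" by (rule Min_in [rotated])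
  then obtain I I' where attained: "card I = d" "card I' = d'" "I \<inter> I' = J" "q J = p I + p' I'"
    unfolding q_def stable_intersection_def by auto
  then have "I \<union> I' = UNIV"
    using Un_eq_UNIV_iff_card_Int [of I I'] dims(3) assms by (simp add: r_def)
  then show thesis
    using that [OF attained(1-3)] sum_Int_of_Un_eq_UNIV [of I I' "($) w"] attained(3,4)
    by (simp add: reduced_cost_def)
qed

lemma stable_minimizer_attained:
  assumes "J \<in> minimizers r q w"
  obtains I I' where "card I = d" "card I' = d'" "I \<inter> I' = J" "I \<union> I' = UNIV"
    "\<And>A A'. card A = d \<Longrightarrow> card A' = d' \<Longrightarrow> A \<union> A' = UNIV \<Longrightarrow>
       reduced_cost p w I + reduced_cost p' w I' \<le> reduced_cost p w A + reduced_cost p' w A'"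
proof -
  obtain I I' where attained: "card I = d" "card I' = d'" "I \<inter> I' = J" "I \<union> I' = UNIV"
    "reduced_cost q w J = reduced_cost p w I + reduced_cost p' w I' + (\<Sum>i\<in>UNIV. w $ i)"
    using minimizersD(1) [OF assms] by (rule reduced_cost_stable_intersection_attained)
  have "reduced_cost p w I + reduced_cost p' w I' \<le> reduced_cost p w A + reduced_cost p' w A'"
    if cover: "card A = d" "card A' = d'" "A \<union> A' = UNIV" for A A'
  proof -
    have "card (A \<inter> A') = r"
      using Un_eq_UNIV_iff_card_Int [of A A'] cover dims(3) by (simp add: r_def)
    then have "reduced_cost q w J \<le> reduced_cost q w (A \<inter> A')" by (rule minimizersD(2) [OF assms])
    then show ?thesis
      using reduced_cost_stable_intersection_le [OF cover, of w] attained(5) by linarith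
  qed
  then show thesis using that [OF attained(1-4)] by blast
qed

lemma Union_stable_minimizers_subset:
  assumes "valuated_matroid d p"
  shows "\<Union>(minimizers r q w) \<subseteq> \<Union>(minimizers d p w)"
proof
  fix e assume "e \<in> \<Union>(minimizers r q w)"
  then obtain J where J_min: "J \<in> minimizers r q w" "e \<in> J" by blast
  obtain I I' where attained: "card I = d" "card I' = d'" "I \<inter> I' = J" "I \<union> I' = UNIV"
    and opt: "\<And>A A'. card A = d \<Longrightarrow> card A' = d' \<Longrightarrow> A \<union> A' = UNIV \<Longrightarrow>
       reduced_cost p w I + reduced_cost p' w I' \<le> reduced_cost p w A + reduced_cost p' w A'"
    using stable_minimizer_attained [OF J_min(1)] by blast
  obtain B where B_min: "B \<in> minimizers d p w" using minimizers_nonempty [OF dims(1)] by blast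
  show "e \<in> \<Union>(minimizers d p w)"
  proof (cases "e \<in> B")
    case False
    have e_in: "e \<in> I" "e \<in> I'" using attained(3) J_min(2) by auto
    obtain f where exchange: "f \<in> B" "f \<notin> I"
      "reduced_cost p w (insert f (I - {e})) + reduced_cost p w (insert e (B - {f})) \<le>
         reduced_cost p w I + reduced_cost p w B"
      using valuated_matroid_reduced_cost [OF assms] attained(1) minimizersD(1) [OF B_min] e_in(1)
        False
      by (rule valuated_matroidE)
    have "card (insert f (I - {e})) = d"
      using card_swap [OF e_in(1) exchange(2)] attained(1) by simp
    then have "reduced_cost p w I + reduced_cost p' w I' \<le>
        reduced_cost p w (insert f (I - {e})) + reduced_cost p' w I'"
      using attained e_in by (intro opt) auto
    then have "reduced_cost p w (insert e (B - {f})) \<le> reduced_cost p w B"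
      using exchange(3) by linarith
    moreover have "card (insert e (B - {f})) = d"
      using card_swap [OF exchange(1) False] minimizersD(1) [OF B_min] by simp
    ultimately have "insert e (B - {f}) \<in> minimizers d p w" by (intro minimizers_le [OF B_min])
    then show ?thesis by blast
  qed (use B_min in blast)
qed

lemma Int_in_minimizers_stable_intersection:
  assumes "I \<in> minimizers d p w" "I' \<in> minimizers d' p' w" "I \<union> I' = UNIV"
  shows "I \<inter> I' \<in> minimizers r q w"
proof -
  note cards = minimizersD(1) [OF assms(1)] minimizersD(1) [OF assms(2)]
  have "reduced_cost q w (I \<inter> I') \<le> reduced_cost q w J" if card_J: "card J = r" for J
  proof -
    obtain A A' where attained: "card A = d" "card A' = d'" "A \<inter> A' = J" "A \<union> A' = UNIV"
      "reduced_cost q w J = reduced_cost p w A + reduced_cost p' w A' + (\<Sum>i\<in>UNIV. w $ i)"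
      using card_J by (rule reduced_cost_stable_intersection_attained)
    then show ?thesis
      using reduced_cost_stable_intersection_le [OF cards assms(3), of w]
        minimizersD(2) [OF assms(1) attained(1)] minimizersD(2) [OF assms(2) attained(2)]
          by linarith
  qed
  moreover have "card (I \<inter> I') = r"
    using Un_eq_UNIV_iff_card_Int [of I I'] assms(3) cards dims(3) by (simp add: r_def)
  ultimately show ?thesis by (simp add: minimizers_iff)
qed

lemma minimizers_stable_intersection:
  assumes "(uminus ` minimizers d p w) \<otimes> (uminus ` minimizers d' p' w) \<noteq> {}"
  shows "uminus ` minimizers r q w = (uminus ` minimizers d p w) \<otimes> (uminus ` minimizers d' p' w)"
proof (intro equalityI subsetI)
  obtain I0 I0' where cover: "I0 \<in> minimizers d p w" "I0' \<in> minimizers d' p' w" "I0 \<union> I0' = UNIV"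
    using assms complement_disjoint_product_iff by (metis ex_in_conv)
  fix K assume "K \<in> uminus ` minimizers r q w"
  then obtain J where J_min: "K = - J" "J \<in> minimizers r q w" by blast
  obtain I I' where attained: "card I = d" "card I' = d'" "I \<inter> I' = J" "I \<union> I' = UNIV"
    and opt: "\<And>A A'. card A = d \<Longrightarrow> card A' = d' \<Longrightarrow> A \<union> A' = UNIV \<Longrightarrow>
       reduced_cost p w I + reduced_cost p' w I' \<le> reduced_cost p w A + reduced_cost p' w A'"
    using stable_minimizer_attained [OF J_min(2)] by blast
  have "reduced_cost p w I + reduced_cost p' w I' \<le> reduced_cost p w I0 + reduced_cost p' w I0'"
    using minimizersD(1) cover by (intro opt)
  moreover have "reduced_cost p w I0 \<le> reduced_cost p w I"
    "reduced_cost p' w I0' \<le> reduced_cost p' w I'"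
    using minimizersD(2) [OF cover(1) attained(1)] minimizersD(2) [OF cover(2) attained(2)] .
  ultimately have "I \<in> minimizers d p w" "I' \<in> minimizers d' p' w"
    using minimizers_le [OF cover(1) attained(1)] minimizers_le [OF cover(2) attained(2)]
    by linarith+
  then show "K \<in> (uminus ` minimizers d p w) \<otimes> (uminus ` minimizers d' p' w)"
    unfolding complement_disjoint_product_iff using attained(3,4) J_min(1) by blast
next
  fix K assume "K \<in> (uminus ` minimizers d p w) \<otimes> (uminus ` minimizers d' p' w)"
  then obtain I I' where "I \<in> minimizers d p w" "I' \<in> minimizers d' p' w" "I \<union> I' = UNIV"
    and "K = - (I \<inter> I')"
    unfolding complement_disjoint_product_iff by blast
  then show "K \<in> uminus ` minimizers r q w"
    by (simp only: Int_in_minimizers_stable_intersection imageI)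
qed

end

lemma stable_intersection_commute:
  "stable_intersection d p d' p' = stable_intersection d' p' d p"
  unfolding stable_intersection_def fun_eq_iff
  by (intro allI arg_cong [where f = Min]) (auto simp: Int_commute add.commute)

subsection \<open>Maximal cells\<close>

text \<open>The weight moves in the direction \<open>v\<close> until some set of larger \<open>v\<close>-weight than \<open>B\<close> becomes a
  minimizer.\<close>

lemma minimizers_critical_step:
  fixes p :: "'n::finite set \<Rightarrow> real" and v :: "'n \<Rightarrow> real" and w :: "real ^ 'n"
  assumes B_min: "B \<in> minimizers d p w" and heavier: "card I0 = d" "sum v B < sum v I0"
  obtains t I where "{B, I} \<subseteq> minimizers d p (\<chi> i. w $ i + t * v i)" "sum v B < sum v I"
proof -
  define G where "G = {I. card I = d \<and> sum v B < sum v I}"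
  define rate where "rate I = (reduced_cost p w I - reduced_cost p w B) / (sum v I - sum v B)" for I
  have "G \<noteq> {}" using heavier by (auto simp: G_def)
  then obtain I where I_G: "I \<in> G" and rate_min: "\<And>J. J \<in> G \<Longrightarrow> rate I \<le> rate J"
    using finite_obtains_minimizer [of G rate] by auto
  have "0 \<le> rate I"
    using I_G minimizersD(2) [OF B_min] by (auto simp: rate_def G_def intro: divide_nonneg_nonneg)
  define w' where "w' = (\<chi> i. w $ i + rate I * v i)"
  have cost: "reduced_cost p w' J = reduced_cost p w J - rate I * sum v J" for J
    unfolding w'_def by (rule reduced_cost_add_mult)
  have "reduced_cost p w' B \<le> reduced_cost p w' J" if "card J = d" for J
  proof (cases "J \<in> G")
    case True
    then have "rate I * (sum v J - sum v B) \<le> reduced_cost p w J - reduced_cost p w B"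
      using rate_min [OF True] by (simp add: rate_def [of J] G_def pos_le_divide_eq)
    then show ?thesis by (simp add: cost algebra_simps)
  next
    case False
    then have "rate I * sum v J \<le> rate I * sum v B"
      using \<open>0 \<le> rate I\<close> that by (intro mult_left_mono) (auto simp: G_def)
    then show ?thesis using minimizersD(2) [OF B_min that] by (simp add: cost)
  qed
  then have B_min': "B \<in> minimizers d p w'"
    using minimizersD(1) [OF B_min] by (simp add: minimizers_iff)
  have "rate I * (sum v I - sum v B) = reduced_cost p w I - reduced_cost p w B"
    using I_G by (simp add: rate_def G_def)
  then have "reduced_cost p w' I = reduced_cost p w' B" by (simp add: cost algebra_simps)
  then have "I \<in> minimizers d p w'" using minimizers_le [OF B_min'] I_G by (simp add: G_def)
  then show thesis using B_min' I_G that [of I "rate I"] by (simp add: w'_def G_def)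
qed

lemma minimizers_enlarge:
  fixes p :: "'n::finite set \<Rightarrow> real"
  assumes const: "weight_constant v (minimizers d p w)"
    and B_min: "B \<in> minimizers d p w" and heavier: "card I0 = d" "sum v B < sum v I0"
  obtains w' where "minimizers d p w \<subset> minimizers d p w'"
proof -
  obtain t I where tied: "{B, I} \<subseteq> minimizers d p (\<chi> i. w $ i + t * v i)"
    and less: "sum v B < sum v I"
    by (rule minimizers_critical_step [OF B_min heavier])
  define w' where "w' = (\<chi> i. w $ i + t * v i)"
  have B_min': "B \<in> minimizers d p w'" and I_min': "I \<in> minimizers d p w'"
    using tied by (simp_all add: w'_def)
  have "minimizers d p w \<subseteq> minimizers d p w'"
  proof
    fix J assume J_min: "J \<in> minimizers d p w"
    have "reduced_cost p w' J = reduced_cost p w' B"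
      using weight_constantD [OF const J_min B_min] minimizers_eq [OF J_min B_min]
      by (simp add: w'_def reduced_cost_add_mult)
    then show "J \<in> minimizers d p w'"
      by (intro minimizers_le [OF B_min'] minimizersD(1) [OF J_min]) simp
  qed
  moreover have "I \<notin> minimizers d p w" using weight_constantD [OF const _ B_min, of I] less by auto
  ultimately show thesis using that I_min' by blast
qed

lemma maximal_minimizers_connected:
  fixes p :: "'n::finite set \<Rightarrow> real"
  assumes dims: "0 < d" "d < CARD('n)"
    and max: "\<And>w'. \<not> minimizers d p w \<subset> minimizers d p w'"
  shows "connected_family (minimizers d p w)"
  unfolding connected_family_def
proof (intro allI impI, rule ccontr)
  fix u :: "'n \<Rightarrow> real" and e f
  assume u_const: "weight_constant u (minimizers d p w)" and u_diff: "u e \<noteq> u f"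
  obtain B where B_min: "B \<in> minimizers d p w"
    using minimizers_nonempty [of d p w] dims by auto
  have "sum u I \<le> sum u B" if "card I = d" for I
    using minimizers_enlarge [OF u_const B_min that] max by (meson linorder_not_less)
  moreover have "sum u B \<le> sum u I" if "card I = d" for I
    using minimizers_enlarge [OF weight_constant_uminus [OF u_const] B_min that] max
    by (simp add: sum_negf) (meson linorder_not_less)
  ultimately have all_eq: "sum u I = sum u B" if "card I = d" for I
    using that by (metis order_antisym)
  have "e \<noteq> f" using u_diff by auto
  then have "card (UNIV - {e, f}) = CARD('n) - 2" by (subst card_Diff_subset) auto
  then have "d - 1 \<le> card (UNIV - {e, f})" using dims by simp
  then obtain S where S_sub: "S \<subseteq> UNIV - {e, f}" "card S = d - 1"
    by (meson obtain_subset_with_card_n)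
  then have "e \<notin> S" "f \<notin> S" by auto
  moreover from this have "card (insert e S) = d" "card (insert f S) = d" using S_sub dims by auto
  then have "sum u (insert e S) = sum u (insert f S)" by (simp only: all_eq)
  ultimately show False using u_diff by simp
qed

lemma minimizers_subset_connected:
  fixes p :: "'n::finite set \<Rightarrow> real"
  assumes "0 < d" "d < CARD('n)"
  obtains w' where "minimizers d p w \<subseteq> minimizers d p w'" "connected_family (minimizers d p w')"
proof -
  obtain M where M_max: "M \<in> range (minimizers d p)" "minimizers d p w \<subseteq> M"
    and max: "\<forall>N\<in>range (minimizers d p). M \<subseteq> N \<longrightarrow> M = N"
    using finite_has_maximal2 [of "range (minimizers d p)" "minimizers d p w"] by auto
  from M_max(1) obtain w' where M_eq: "M = minimizers d p w'" by (rule rangeE)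
  have "connected_family (minimizers d p w')"
    using max by (intro maximal_minimizers_connected assms) (auto simp: M_eq)
  then show thesis using that M_max(2) by (simp add: M_eq)
qed

lemma minimizers_eq_argmax_weight:
  fixes p :: "'n::finite set \<Rightarrow> real"
  assumes "d \<le> CARD('n)" "minimizers d p w \<subseteq> minimizers d p w'"
  shows "minimizers d p w = argmax_weight (\<lambda>i. w $ i - w' $ i) (minimizers d p w')"
proof -
  obtain B where B_min: "B \<in> minimizers d p w" using minimizers_nonempty [OF assms(1)] by blast
  have cost: "reduced_cost p w I = reduced_cost p w' B - (\<Sum>i\<in>I. w $ i - w' $ i)"
    if "I \<in> minimizers d p w'" for I
    using minimizers_eq [OF that, of B] B_min assms(2)
    by (auto simp: reduced_cost_def sum_subtractf)
  show ?thesis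
  proof (intro equalityI subsetI)
    fix I assume I_in: "I \<in> minimizers d p w"
    show "I \<in> argmax_weight (\<lambda>i. w $ i - w' $ i) (minimizers d p w')"
    proof (rule argmax_weightI)
      show "I \<in> minimizers d p w'" using I_in assms(2) by blast
      fix J assume J_in: "J \<in> minimizers d p w'"
      show "(\<Sum>i\<in>J. w $ i - w' $ i) \<le> (\<Sum>i\<in>I. w $ i - w' $ i)"
        using minimizersD(2) [OF I_in minimizersD(1) [OF J_in]] cost [OF J_in] cost [of I] I_in
          assms(2) by auto
    qed
  next
    fix I assume I_in: "I \<in> argmax_weight (\<lambda>i. w $ i - w' $ i) (minimizers d p w')"
    then have "reduced_cost p w I \<le> reduced_cost p w B"
      using argmax_weightD [OF I_in] cost [of I] cost [of B] B_min assms(2) by auto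
    then show "I \<in> minimizers d p w"
      using minimizers_le [OF B_min] minimizersD(1) [OF argmax_weightD(1) [OF I_in]] by blast
  qed
qed

subsection \<open>Regular subdivisions\<close>

lemma inner_indicator_vec: "x \<bullet> indicator_vec I = (\<Sum>i\<in>I. x $ i)"
  by (simp add: indicator_vec_def inner_sum_right inner_axis)

lemma convex_hull_subset_halfspace:
  assumes "\<And>x. x \<in> V \<Longrightarrow> a \<bullet> x \<le> b"
  shows "convex hull V \<subseteq> {x. a \<bullet> x \<le> b}"
  by (rule hull_minimal) (use assms in \<open>auto simp: convex_halfspace_le\<close>)

lemma convex_hull_Int_supporting_hyperplane:
  fixes V :: "'a::euclidean_space set"
  assumes "finite V" "\<And>x. x \<in> V \<Longrightarrow> a \<bullet> x \<le> b"
  shows "convex hull V \<inter> {x. a \<bullet> x = b} = convex hull (V \<inter> {x. a \<bullet> x = b})" (is "?F = _")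
proof (rule antisym)
  have "?F face_of convex hull V"
    using convex_hull_subset_halfspace [of V a b] assms(2)
    by (intro face_of_Int_supporting_hyperplane_le) auto
  then obtain S where S_hull: "S \<subseteq> V" "?F = convex hull S"
    using face_of_convex_hull_subset [OF finite_imp_compact [OF assms(1)]] by blast
  have "S \<subseteq> ?F" unfolding S_hull(2) by (rule hull_subset)
  then have "S \<subseteq> V \<inter> {x. a \<bullet> x = b}" using S_hull(1) by blast
  then show "?F \<subseteq> convex hull (V \<inter> {x. a \<bullet> x = b})" unfolding S_hull(2) by (rule hull_mono)
  show "convex hull (V \<inter> {x. a \<bullet> x = b}) \<subseteq> ?F"
    by (intro Int_greatest hull_mono hull_minimal) (auto simp: convex_hyperplane)
qed

definition lift_vertex :: "('n::finite set \<Rightarrow> real) \<Rightarrow> 'n set \<Rightarrow> (real ^ 'n) \<times> real" where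
  "lift_vertex p I = (indicator_vec I, p I)"

lemma lifted_hypersimplex_eq:
  "lifted_hypersimplex d p = convex hull (lift_vertex p ` {I. card I = d})"
  unfolding lifted_hypersimplex_def lift_vertex_def by (simp add: setcompr_eq_image)

lemma inner_lift_vertex: "(- c *\<^sub>R w, c) \<bullet> lift_vertex p I = c * reduced_cost p w I"
  by (simp add: lift_vertex_def inner_indicator_vec reduced_cost_def algebra_simps sum_negf
      sum_distrib_left)

lemma lower_face_lifted_hypersimplex:
  fixes p :: "'n::finite set \<Rightarrow> real"
  assumes "c < 0" "lifted_hypersimplex d p \<subseteq> {x. (- c *\<^sub>R w, c) \<bullet> x \<le> b}"
    and "F = lifted_hypersimplex d p \<inter> {x. (- c *\<^sub>R w, c) \<bullet> x = b}" "F \<noteq> {}"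
  shows "fst ` F = matroid_polytope (minimizers d p w)"
proof -
  let ?V = "lift_vertex p ` {I. card I = d}" and ?a = "(- c *\<^sub>R w, c)"
  have below: "?a \<bullet> x \<le> b" if "x \<in> ?V" for x
    using assms(2) hull_inc [OF that, of convex] unfolding lifted_hypersimplex_eq by blast
  have "F = convex hull (?V \<inter> {x. ?a \<bullet> x = b})"
    unfolding assms(3) lifted_hypersimplex_eq
    by (intro convex_hull_Int_supporting_hyperplane below) auto
  also have "?V \<inter> {x. ?a \<bullet> x = b} = lift_vertex p ` {I. card I = d \<and> c * reduced_cost p w I = b}"
    unfolding inner_lift_vertex [symmetric] by blast
  finally have F_eq:
    "F = convex hull (lift_vertex p ` {I. card I = d \<and> c * reduced_cost p w I = b})" .
  then obtain I0 where tight: "card I0 = d" "c * reduced_cost p w I0 = b" using assms(4) by auto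
  have "reduced_cost p w I0 \<le> reduced_cost p w I" if "card I = d" for I
  proof -
    have "c * reduced_cost p w I \<le> c * reduced_cost p w I0"
      using below [of "lift_vertex p I"] that unfolding inner_lift_vertex tight(2) by blast
    then show ?thesis using assms(1) by simp
  qed
  then have "{I. card I = d \<and> c * reduced_cost p w I = b} = minimizers d p w"
    using tight assms(1) by (auto simp: minimizers_iff intro: order_antisym)
  then have "fst ` F = convex hull (fst ` lift_vertex p ` minimizers d p w)"
    unfolding F_eq by (simp add: convex_hull_linear_image [OF linear_fst])
  also have "fst ` lift_vertex p ` minimizers d p w = indicator_vec ` minimizers d p w"
    by (simp add: image_image lift_vertex_def)
  finally show ?thesis by (simp add: matroid_polytope_def)
qed

lemma regular_subdivision_eq:
  fixes p :: "'n::finite set \<Rightarrow> real"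
  assumes "d \<le> CARD('n)"
  shows "regular_subdivision d p = range (\<lambda>w. matroid_polytope (minimizers d p w))"
proof (intro equalityI subsetI)
  fix C assume "C \<in> regular_subdivision d p"
  then obtain F a b where C_eq: "C = fst ` F" and F_face: "F \<noteq> {}" "snd a < 0"
    "lifted_hypersimplex d p \<subseteq> {x. a \<bullet> x \<le> b}" "F = lifted_hypersimplex d p \<inter> {x. a \<bullet> x = b}"
    unfolding regular_subdivision_def lower_face_def by blast
  define w where "w = (- 1 / snd a) *\<^sub>R fst a"
  have "a = (- snd a *\<^sub>R w, snd a)" using F_face(2) by (simp add: w_def prod_eq_iff)
  then have "fst ` F = matroid_polytope (minimizers d p w)"
    using lower_face_lifted_hypersimplex [of "snd a" d p w b F] F_face by metis
  then show "C \<in> range (\<lambda>w. matroid_polytope (minimizers d p w))" using C_eq by blast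
next
  fix C assume "C \<in> range (\<lambda>w. matroid_polytope (minimizers d p w))"
  then obtain w where C_eq: "C = matroid_polytope (minimizers d p w)" by blast
  obtain I0 where I0_min: "I0 \<in> minimizers d p w" using minimizers_nonempty [OF assms] by blast
  let ?a = "(- (- 1) *\<^sub>R w, - 1 :: real)" and ?b = "- 1 * reduced_cost p w I0"
  let ?F = "lifted_hypersimplex d p \<inter> {x. ?a \<bullet> x = ?b}"
  have below: "lifted_hypersimplex d p \<subseteq> {x. ?a \<bullet> x \<le> ?b}"
    unfolding lifted_hypersimplex_eq
  proof (rule convex_hull_subset_halfspace)
    fix x assume "x \<in> lift_vertex p ` {I. card I = d}"
    then obtain I where "card I = d" "x = lift_vertex p I" by blast
    then show "?a \<bullet> x \<le> ?b"
      unfolding \<open>x = _\<close> inner_lift_vertex using minimizersD(2) [OF I0_min] by simp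
  qed
  have "lift_vertex p I0 \<in> ?F"
    unfolding lifted_hypersimplex_eq using minimizersD(1) [OF I0_min]
    by (auto simp: inner_lift_vertex [of "- 1", simplified] intro!: hull_inc)
  then have "?F \<noteq> {}" by blast
  then have "lower_face ?F (lifted_hypersimplex d p)"
    unfolding lower_face_def using below by (intro conjI exI [of _ ?a] exI [of _ ?b]) auto
  moreover have "fst ` ?F = C"
    unfolding C_eq by (rule lower_face_lifted_hypersimplex [OF _ below refl \<open>?F \<noteq> {}\<close>]) simp
  ultimately show "C \<in> regular_subdivision d p" unfolding regular_subdivision_def by blast
qed

lemma maximal_cell_connected:
  fixes p :: "'n::finite set \<Rightarrow> real"
  assumes "0 < d" "d < CARD('n)" "maximal_cell d p C"
  obtains w where "C = matroid_polytope (minimizers d p w)" "connected_family (minimizers d p w)"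
proof -
  have cells: "regular_subdivision d p = range (\<lambda>w. matroid_polytope (minimizers d p w))"
    using assms(2) by (intro regular_subdivision_eq) simp
  obtain w where C_eq: "C = matroid_polytope (minimizers d p w)"
    using assms(3) by (auto simp: maximal_cell_def cells)
  obtain w' where larger: "minimizers d p w \<subseteq> minimizers d p w'"
    "connected_family (minimizers d p w')"
    by (rule minimizers_subset_connected [OF assms(1,2)])
  have "C \<subseteq> matroid_polytope (minimizers d p w')"
    unfolding C_eq matroid_polytope_def using larger(1) by (intro hull_mono image_mono)
  then have "C = matroid_polytope (minimizers d p w')"
    using assms(3) by (auto simp: maximal_cell_def cells)
  then show thesis using larger(2) by (rule that)
qed

subsection \<open>Transversality\<close>

lemma closure_affine_Int_open:
  fixes A :: "'a::euclidean_space set"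
  assumes "affine A" "open U" "convex U" "x \<in> A \<inter> U"
  shows "affine hull closure (A \<inter> U) = A" "x \<in> rel_interior (closure (A \<inter> U))"
proof -
  have "affine hull (A \<inter> U) = affine hull A"
    using assms by (intro affine_hull_affine_Int_open) auto
  then show "affine hull closure (A \<inter> U) = A" using assms(1) by (simp add: hull_same)
  have "rel_interior (closure (A \<inter> U)) = rel_interior (U \<inter> A)"
    using assms(1,3)
    by (simp add: convex_rel_interior_closure convex_Int affine_imp_convex Int_commute)
  also have "\<dots> = U \<inter> A"
    using rel_interior_convex_Int_affine [OF assms(3,1)] assms(2,4) by (auto simp: interior_open)
  finally show "x \<in> rel_interior (closure (A \<inter> U))" using assms(4) by blast
qed

definition equal_costs :: "('n::finite set \<Rightarrow> real) \<Rightarrow> 'n set set \<Rightarrow> (real ^ 'n) set" where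
  "equal_costs p M = {x. \<forall>I\<in>M. \<forall>J\<in>M. reduced_cost p x I = reduced_cost p x J}"

definition less_costs :: "('n::finite set \<Rightarrow> real) \<Rightarrow> 'n set set \<Rightarrow> 'n set set \<Rightarrow> (real ^ 'n) set" where
  "less_costs p M N = {x. \<forall>I\<in>M. \<forall>J\<in>N. reduced_cost p x I < reduced_cost p x J}"

lemma reduced_cost_diff:
  "reduced_cost p x J - reduced_cost p x I = p J - p I - (indicator_vec J - indicator_vec I) \<bullet> x"
  by (simp add: reduced_cost_def inner_commute [of "_ - _" x] inner_diff_right inner_indicator_vec)

lemma equal_costs_hyperplanes:
  "equal_costs p M = (\<Inter>I\<in>M. \<Inter>J\<in>M. {x. (indicator_vec J - indicator_vec I) \<bullet> x = p J - p I})"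
proof -
  have "reduced_cost p x I = reduced_cost p x J \<longleftrightarrow>
      (indicator_vec J - indicator_vec I) \<bullet> x = p J - p I"
    for x I J
    using reduced_cost_diff [of p x J I] by linarith
  then show ?thesis by (auto simp: equal_costs_def)
qed

lemma less_costs_halfspaces:
  "less_costs p M N = (\<Inter>I\<in>M. \<Inter>J\<in>N. {x. (indicator_vec J - indicator_vec I) \<bullet> x < p J - p I})"
proof -
  have "reduced_cost p x I < reduced_cost p x J \<longleftrightarrow>
      (indicator_vec J - indicator_vec I) \<bullet> x < p J - p I"
    for x I J
    using reduced_cost_diff [of p x J I] by linarith
  then show ?thesis by (auto simp: less_costs_def)
qed

lemma affine_equal_costs: "affine (equal_costs p M)"
  unfolding equal_costs_hyperplanes by (auto intro!: affine_Inter affine_hyperplane)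

lemma convex_less_costs: "convex (less_costs p M N)"
  unfolding less_costs_halfspaces by (intro convex_INT convex_halfspace_lt)

lemma open_less_costs: "open (less_costs p M N)"
  unfolding less_costs_halfspaces by (intro open_INT finite ballI open_halfspace_lt)

lemma minimizers_stratum_eq:
  fixes p :: "'n::finite set \<Rightarrow> real" and d :: nat
  defines "M \<equiv> minimizers d p"
  assumes "d \<le> CARD('n)"
  shows "{x. M x = M w} = equal_costs p (M w) \<inter> less_costs p (M w) {J. card J = d \<and> J \<notin> M w}"
proof (intro set_eqI iffI)
  fix x assume "x \<in> {x. M x = M w}"
  then have x_min: "minimizers d p x = M w" by (simp add: M_def)
  have "reduced_cost p x I < reduced_cost p x J" if "I \<in> M w" "card J = d" "J \<notin> M w" for I J
    using that minimizers_le [of I d p x J] unfolding x_min by (meson not_le)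
  moreover have "reduced_cost p x I = reduced_cost p x J" if "I \<in> M w" "J \<in> M w" for I J
    using minimizers_eq [of I d p x J] that unfolding x_min by blast
  ultimately show "x \<in> equal_costs p (M w) \<inter> less_costs p (M w) {J. card J = d \<and> J \<notin> M w}"
    unfolding equal_costs_def less_costs_def by blast
next
  fix x assume "x \<in> equal_costs p (M w) \<inter> less_costs p (M w) {J. card J = d \<and> J \<notin> M w}"
  then have equal: "\<And>I J. I \<in> M w \<Longrightarrow> J \<in> M w \<Longrightarrow> reduced_cost p x I = reduced_cost p x J"
    and less: "\<And>I J. I \<in> M w \<Longrightarrow> card J = d \<Longrightarrow> J \<notin> M w \<Longrightarrow> reduced_cost p x I < reduced_cost p x J"
    unfolding equal_costs_def less_costs_def by blast+
  have card_M: "card I = d" if "I \<in> M w" for I using that minimizersD(1) by (simp add: M_def)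
  obtain B where B_in: "B \<in> M w" using minimizers_nonempty [OF assms(2)] by (metis M_def)
  have "I \<in> M w" if "I \<in> M x" for I
    using less [OF B_in, of I] minimizersD [OF that [unfolded M_def]] card_M [OF B_in]
    by (meson not_le)
  moreover have "I \<in> M x" if I_in: "I \<in> M w" for I
  proof -
    have "reduced_cost p x I \<le> reduced_cost p x J" if "card J = d" for J
      using equal [OF I_in, of J] less [OF I_in that] by (cases "J \<in> M w") auto
    then show ?thesis using card_M [OF I_in] by (simp add: M_def minimizers_iff)
  qed
  ultimately show "x \<in> {x. M x = M w}" by blast
qed

definition constant_space :: "'n::finite set set \<Rightarrow> (real ^ 'n) set" where
  "constant_space M = {x. weight_constant (($) x) M}"

lemma subspace_constant_space: "subspace (constant_space M)"
proof (rule subspaceI)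
  show "0 \<in> constant_space M" by (simp add: constant_space_def weight_constant_def)
next
  fix x y assume "x \<in> constant_space M" "y \<in> constant_space M"
  moreover have "($) (x + y) = (\<lambda>i. x $ i + y $ i)" by (simp add: fun_eq_iff)
  ultimately show "x + y \<in> constant_space M" by (simp add: constant_space_def weight_constant_add)
next
  fix c x assume "x \<in> constant_space M"
  moreover have "($) (c *\<^sub>R x) = (\<lambda>i. c * x $ i)" by (simp add: fun_eq_iff)
  ultimately show "c *\<^sub>R x \<in> constant_space M"
    by (simp add: constant_space_def weight_constant_mult)
qed

lemma equal_costs_diff:
  assumes "x \<in> equal_costs p M" "y \<in> equal_costs p M"
  shows "x - y \<in> constant_space M"
proof -
  have "sum (($) (x - y)) I = reduced_cost p y I - reduced_cost p x I" for I
    by (simp add: reduced_cost_def sum_subtractf)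
  moreover have "reduced_cost p x I = reduced_cost p x J" "reduced_cost p y I = reduced_cost p y J"
    if "I \<in> M" "J \<in> M" for I J
    using assms that unfolding equal_costs_def by blast+
  ultimately show ?thesis
    unfolding constant_space_def weight_constant_def by (intro CollectI ballI) metis
qed

lemma minimizers_stratum:
  fixes p :: "'n::finite set \<Rightarrow> real"
  assumes "d \<le> CARD('n)"
  shows "w \<in> rel_interior (closure {x. minimizers d p x = minimizers d p w})"
    and "direction_space (closure {x. minimizers d p x = minimizers d p w}) \<subseteq>
      constant_space (minimizers d p w)"
proof -
  let ?C = "{x. minimizers d p x = minimizers d p w}" and ?A = "equal_costs p (minimizers d p w)"
    and ?U = "less_costs p (minimizers d p w) {J. card J = d \<and> J \<notin> minimizers d p w}"
  have stratum_eq: "?C = ?A \<inter> ?U" by (rule minimizers_stratum_eq [OF assms])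
  then have "w \<in> ?A \<inter> ?U" by blast
  note closure = closure_affine_Int_open
    [OF affine_equal_costs open_less_costs convex_less_costs this, folded stratum_eq]
  show "w \<in> rel_interior (closure ?C)" by (rule closure(2))
  show "direction_space (closure ?C) \<subseteq> constant_space (minimizers d p w)"
    unfolding direction_space_def closure(1) using equal_costs_diff by blast
qed

lemma meet_transversely_imp_transverse_families:
  fixes p p' :: "'n::finite set \<Rightarrow> real"
  assumes val: "valuated_matroid d p" "valuated_matroid d' p'"
    and dims: "d \<le> CARD('n)" "d' \<le> CARD('n)" and transverse: "meet_transversely d p d' p'"
    and loopless: "\<Union>(minimizers d p w) = UNIV" "\<Union>(minimizers d' p' w) = UNIV"
  shows "transverse_families (minimizers d p w) (minimizers d' p' w)"
proof -
  let ?M = "minimizers d p w" and ?M' = "minimizers d' p' w"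
  let ?C = "{x. minimizers d p x = ?M}" and ?C' = "{x. minimizers d' p' x = ?M'}"
  have "?C \<subseteq> tropical_linear_space d p" "?C' \<subseteq> tropical_linear_space d' p'"
    using Union_minimizers_imp_tropical_linear_space [OF val(1)]
      Union_minimizers_imp_tropical_linear_space [OF val(2)] loopless by auto
  then have "closure ?C \<in> tls_faces d p" "closure ?C' \<in> tls_faces d' p'"
    unfolding tls_faces_def by blast+
  moreover have "w \<in> rel_interior (closure ?C) \<inter> rel_interior (closure ?C')"
    using minimizers_stratum(1) dims by blast
  ultimately have "span (direction_space (closure ?C) \<union> direction_space (closure ?C')) = UNIV"
    using transverse unfolding meet_transversely_def by blast
  moreover have "span (direction_space (closure ?C) \<union> direction_space (closure ?C')) \<subseteq>
      span (constant_space ?M \<union> constant_space ?M')"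
    using minimizers_stratum(2) dims by (intro span_mono Un_mono)
  ultimately have sum: "\<exists>v\<in>constant_space ?M. \<exists>v'\<in>constant_space ?M'. x = v + v'" for x
    unfolding span_Un span_eq_iff [THEN iffD2, OF subspace_constant_space] by blast
  show ?thesis
    unfolding transverse_families_def
  proof
    fix u :: "'n \<Rightarrow> real"
    obtain v v' where "v \<in> constant_space ?M" "v' \<in> constant_space ?M'" "(\<chi> i. u i) = v + v'"
      using sum by blast
    then show "\<exists>v v'. (\<forall>x. u x = v x + v' x) \<and> weight_constant v ?M \<and> weight_constant v' ?M'"
      by (intro exI [of _ "($) v"] exI [of _ "($) v'"]) (auto simp: constant_space_def vec_eq_iff)
  qed
qed

subsection \<open>Cycles and even subgraphs\<close>

definition degree_in :: "('e \<Rightarrow> 'v set) \<Rightarrow> 'e set \<Rightarrow> 'v \<Rightarrow> nat" where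
  "degree_in ends C x = card {e \<in> C. x \<in> ends e}"

definition even_subgraph :: "('e \<Rightarrow> 'v set) \<Rightarrow> 'e set \<Rightarrow> bool" where
  "even_subgraph ends C \<longleftrightarrow> (\<forall>x. even (degree_in ends C x))"

definition loopless :: "('e \<Rightarrow> 'v set) \<Rightarrow> 'e set \<Rightarrow> bool" where
  "loopless ends A \<longleftrightarrow> (\<forall>e\<in>A. \<exists>u v. u \<noteq> v \<and> ends e = {u, v})"

lemma looplessE:
  assumes "loopless ends A" "e \<in> A"
  obtains u v where "u \<noteq> v" "ends e = {u, v}"
  using assms unfolding loopless_def by blast

lemma loopless_subset: "loopless ends E \<Longrightarrow> A \<subseteq> E \<Longrightarrow> loopless ends A"
  by (auto simp: loopless_def)

text \<open>Each visit of the closed walk to a vertex uses one edge to arrive and a different one to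
  leave.\<close>

lemma graph_cycle_even_subgraph:
  assumes "graph_cycle ends C" "loopless ends C"
  shows "even_subgraph ends C"
  unfolding even_subgraph_def
proof
  fix x
  obtain es vs where cycle: "length vs = length es" "distinct es" "set es = C"
    and ends: "\<And>i. i < length es \<Longrightarrow> ends (es ! i) = {vs ! i, vs ! (Suc i mod length es)}"
    using assms(1) unfolding graph_cycle_def by blast
  have ends_rotate: "ends (es ! i) = {vs ! i, rotate1 vs ! i}" if "i < length es" for i
    using ends [OF that] cycle(1) that by (simp add: nth_rotate1)
  let ?out = "{i. i < length es \<and> vs ! i = x}" and ?in = "{i. i < length es \<and> rotate1 vs ! i = x}"
  have "{e \<in> C. x \<in> ends e} = (!) es ` (?out \<union> ?in)"
    unfolding cycle(3) [symmetric] by (force simp: in_set_conv_nth ends_rotate)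
  moreover have "inj_on ((!) es) (?out \<union> ?in)" using cycle(2) by (intro inj_on_nth) auto
  ultimately have "degree_in ends C x = card (?out \<union> ?in)"
    unfolding degree_in_def by (simp only: card_image)
  also have "\<dots> = card ?out + card ?in"
  proof (rule card_Un_disjoint)
    have "rotate1 vs ! i \<noteq> vs ! i" if "i < length es" for i
      using looplessE [OF assms(2), of "es ! i"] that cycle(3) ends_rotate [OF that]
      by (metis doubleton_eq_iff nth_mem)
    then show "?out \<inter> ?in = {}" by auto
  qed auto
  also have "card ?in = length (filter (\<lambda>v. v = x) (rotate1 vs))"
    using cycle(1) by (simp add: length_filter_conv_card)
  also have "\<dots> = length (filter (\<lambda>v. v = x) vs)" by (cases vs) auto
  also have "card ?out = length (filter (\<lambda>v. v = x) vs)"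
    using cycle(1) by (simp add: length_filter_conv_card)
  finally show "even (degree_in ends C x)" by simp
qed

definition graph_path :: "('e \<Rightarrow> 'v set) \<Rightarrow> 'e set \<Rightarrow> 'e list \<Rightarrow> 'v list \<Rightarrow> bool" where
  "graph_path ends C es vs \<longleftrightarrow> length vs = Suc (length es) \<and> distinct vs \<and> set es \<subseteq> C \<and>
     (\<forall>i<length es. ends (es ! i) = {vs ! i, vs ! Suc i})"

lemma graph_path_incident_iff:
  assumes "graph_path ends C es vs" "i < length es" "j < length vs"
  shows "vs ! j \<in> ends (es ! i) \<longleftrightarrow> j = i \<or> j = Suc i"
  using assms by (auto simp: graph_path_def nth_eq_iff_index_eq)

lemma graph_path_distinct_edges:
  assumes "graph_path ends C es vs"
  shows "distinct es"
  unfolding distinct_conv_nth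
proof (intro allI impI notI)
  fix i j assume indices: "i < length es" "j < length es" "i \<noteq> j" "es ! i = es ! j"
  then have "vs ! i \<in> ends (es ! j)" "vs ! Suc i \<in> ends (es ! j)"
    using assms unfolding graph_path_def by (metis insertI1 insertI2)+
  then have "(i = j \<or> i = Suc j) \<and> (Suc i = j \<or> Suc i = Suc j)"
    using graph_path_incident_iff [OF assms indices(2)] indices(1) assms
    by (auto simp: graph_path_def)
  then show False using indices(3) by auto
qed

lemma graph_path_length_le:
  assumes "graph_path ends C es vs" "finite (\<Union>(ends ` C))"
  shows "length es \<le> card (\<Union>(ends ` C))"
proof -
  have "set (tl vs) \<subseteq> \<Union>(ends ` C)"
  proof
    fix x assume "x \<in> set (tl vs)"
    then obtain i where "i < length es" "x = vs ! Suc i"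
      using assms(1) by (auto simp: in_set_conv_nth graph_path_def nth_tl)
    then show "x \<in> \<Union>(ends ` C)" using assms(1) by (force simp: graph_path_def)
  qed
  then have "card (set (tl vs)) \<le> card (\<Union>(ends ` C))" using assms(2) by (rule card_mono [rotated])
  moreover have "card (set (tl vs)) = length es"
    using assms(1) by (simp add: graph_path_def distinct_card distinct_tl)
  ultimately show ?thesis by simp
qed

lemma graph_path_Cons:
  assumes "graph_path ends C es vs" "g \<in> C" "ends g = {y, vs ! 0}" "y \<notin> set vs"
  shows "graph_path ends C (g # es) (y # vs)"
  using assms by (auto simp: graph_path_def nth_Cons split: nat.splits)

lemma graph_path_close:
  assumes "graph_path ends C es vs" "g \<in> C" "g \<noteq> es ! 0"
    and "ends g = {vs ! i, vs ! 0}" "0 < i" "i \<le> length es"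
  shows "\<exists>D\<subseteq>C. graph_cycle ends D"
proof -
  have path: "length vs = Suc (length es)" "distinct vs" "set es \<subseteq> C"
    "\<And>j. j < length es \<Longrightarrow> ends (es ! j) = {vs ! j, vs ! Suc j}"
    using assms(1) by (auto simp: graph_path_def)
  let ?es = "take i es @ [g]" and ?vs = "take (Suc i) vs"
  have "g \<notin> set es"
  proof
    assume "g \<in> set es"
    then obtain j where j_eq: "j < length es" "g = es ! j" by (auto simp: in_set_conv_nth)
    moreover have "vs ! 0 \<in> ends g" using assms(4) by simp
    ultimately have "j = 0" using graph_path_incident_iff [OF assms(1), of j 0] path(1) by auto
    then show False using assms(3) j_eq(2) by simp
  qed
  then have "g \<notin> set (take i es)" by (meson in_set_takeD)
  then have "distinct ?es" using graph_path_distinct_edges [OF assms(1)] by simp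
  moreover have "length ?es = Suc i" "length ?vs = Suc i" "distinct ?vs"
    using assms(6) path by simp_all
  moreover have "ends (?es ! j) = {?vs ! j, ?vs ! (Suc j mod Suc i)}" if "j < Suc i" for j
  proof (cases "j = i")
    case True
    then show ?thesis using assms(4,6) path(1) by (simp add: nth_append)
  next
    case False
    then show ?thesis using that path(4) [of j] assms(6) by (simp add: nth_append)
  qed
  ultimately have "graph_cycle ends (set ?es)"
    unfolding graph_cycle_def by (intro exI [of _ ?es] exI [of _ ?vs]) simp
  moreover have "set ?es \<subseteq> C" using path(3) assms(2) set_take_subset [of i es] by auto
  ultimately show ?thesis by blast
qed

text \<open>A longest path closes up to a cycle at its first vertex, which has degree at least 2.\<close>

lemma even_subgraph_contains_cycle:
  assumes "finite C" "loopless ends C" "C \<noteq> {}" "even_subgraph ends C"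
  shows "\<exists>D\<subseteq>C. graph_cycle ends D"
proof -
  have finite_vertices: "finite (\<Union>(ends ` C))" using assms(1,2) by (auto simp: loopless_def)
  let ?P = "\<lambda>(es, vs). graph_path ends C es vs"
  obtain e0 where e0_in: "e0 \<in> C" using assms(3) by blast
  then obtain u v where "u \<noteq> v" "ends e0 = {u, v}" by (rule looplessE [OF assms(2)])
  then have start: "?P ([e0], [u, v])" using e0_in by (simp add: graph_path_def)
  have bound: "\<forall>path. ?P path \<longrightarrow> length (fst path) < Suc (card (\<Union>(ends ` C)))"
    using graph_path_length_le [OF _ finite_vertices] by (auto simp: less_Suc_eq_le)
  obtain es vs where path: "graph_path ends C es vs"
    and longest: "\<And>fs ws. graph_path ends C fs ws \<Longrightarrow> length fs \<le> length es"
    using ex_has_greatest_nat [OF start bound] by auto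
  have len: "0 < length es" using longest [of "[e0]" "[u, v]"] start by auto
  have "es ! 0 \<in> {e \<in> C. vs ! 0 \<in> ends e}" using path len by (auto simp: graph_path_def)
  moreover have "{e \<in> C. vs ! 0 \<in> ends e} \<noteq> {es ! 0}"
  proof
    assume "{e \<in> C. vs ! 0 \<in> ends e} = {es ! 0}"
    then have "degree_in ends C (vs ! 0) = 1" by (simp add: degree_in_def)
    then show False using assms(4) unfolding even_subgraph_def by (metis odd_one)
  qed
  ultimately obtain g where g_edge: "g \<in> C" "vs ! 0 \<in> ends g" "g \<noteq> es ! 0" by blast
  obtain a b where ends_g: "a \<noteq> b" "ends g = {a, b}" using looplessE [OF assms(2) g_edge(1)] .
  define y where "y = (if vs ! 0 = a then b else a)"
  have y_end: "ends g = {y, vs ! 0}" "y \<noteq> vs ! 0" using ends_g g_edge(2) by (auto simp: y_def)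
  have "y \<in> set vs"
  proof (rule ccontr)
    assume "y \<notin> set vs"
    from longest [OF graph_path_Cons [OF path g_edge(1) y_end(1) this]] show False by simp
  qed
  then obtain i where i_eq: "i < length vs" "y = vs ! i" by (metis in_set_conv_nth)
  then have "0 < i" "i \<le> length es" using y_end(2) path by (auto simp: graph_path_def intro: gr0I)
  then show ?thesis using graph_path_close [OF path g_edge(1,3)] y_end(1) i_eq(2) by simp
qed

lemma forest_iff_even:
  assumes "finite A" "loopless ends A"
  shows "forest ends A \<longleftrightarrow> (\<forall>C\<subseteq>A. even_subgraph ends C \<longrightarrow> C = {})"
proof -
  have subgraph: "finite C" "loopless ends C" if "C \<subseteq> A" for C
    using that assms loopless_subset finite_subset by blast+
  have "\<exists>C\<subseteq>A. graph_cycle ends C" if "C \<subseteq> A" "even_subgraph ends C" "C \<noteq> {}" for C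
    using even_subgraph_contains_cycle [OF subgraph [OF that(1)] that(3,2)] that(1) by blast
  moreover have "even_subgraph ends C \<and> C \<noteq> {}" if "C \<subseteq> A" "graph_cycle ends C" for C
    using graph_cycle_even_subgraph [OF that(2) subgraph(2) [OF that(1)]] that(2)
    by (auto simp: graph_cycle_def)
  ultimately show ?thesis unfolding forest_def by metis
qed

subsection \<open>Cycle matroids of series-parallel graphs\<close>

lemma even_subgraph_image:
  assumes "inj_on s C" "\<And>c. c \<in> C \<Longrightarrow> ends (s c) = ends' c"
  shows "even_subgraph ends (s ` C) \<longleftrightarrow> even_subgraph ends' C"
proof -
  have "degree_in ends (s ` C) x = degree_in ends' C x" for x
  proof -
    have "{c \<in> s ` C. x \<in> ends c} = s ` {c \<in> C. x \<in> ends' c}" using assms(2) by auto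
    moreover have "inj_on s {c \<in> C. x \<in> ends' c}" using assms(1) by (rule inj_on_subset) auto
    ultimately show ?thesis by (simp add: degree_in_def card_image)
  qed
  then show ?thesis by (simp add: even_subgraph_def)
qed

lemma forest_image:
  assumes "finite A" "loopless ends' A" "inj_on s A" "\<And>c. c \<in> A \<Longrightarrow> ends (s c) = ends' c"
  shows "forest ends (s ` A) \<longleftrightarrow> forest ends' A"
proof -
  have "loopless ends (s ` A)" using assms by (auto simp: loopless_def)
  moreover have "even_subgraph ends (s ` C) \<longleftrightarrow> even_subgraph ends' C" if "C \<subseteq> A" for C
    using that assms by (intro even_subgraph_image) (auto intro: inj_on_subset)
  ultimately show ?thesis
    using forest_iff_even [OF assms(1,2)] forest_iff_even [of "s ` A" ends] assms(1)
    by (simp add: all_subset_image)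
qed

lemma forest_parallel_extension:
  assumes "finite E" "loopless ends E" "e \<in> E" "f \<notin> E" "A \<subseteq> E"
  defines "ends' \<equiv> ends(f := ends e)"
  shows "forest ends' A \<longleftrightarrow> forest ends A"
    and "e \<notin> A \<Longrightarrow> forest ends' (insert f A) \<longleftrightarrow> forest ends (insert e A)"
    and "e \<in> A \<Longrightarrow> \<not> forest ends' (insert f A)"
proof -
  have "finite A" using assms(1,5) by (rule finite_subset [rotated])
  have "f \<notin> A" using assms(4,5) by blast
  have loopless': "loopless ends' (insert f A)"
    using assms(2-5) by (auto simp: loopless_def ends'_def)
  have "ends' c = ends c" if "c \<in> A" for c using that \<open>f \<notin> A\<close> by (auto simp: ends'_def)
  then show "forest ends' A \<longleftrightarrow> forest ends A"
    using forest_image [OF \<open>finite A\<close> loopless_subset [OF assms(2,5)], of id ends'] by simp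
  {
    assume "e \<notin> A"
    let ?s = "id(f := e)"
    have "?s ` insert f A = insert e A" using \<open>f \<notin> A\<close> by auto
    moreover have "inj_on ?s (insert f A)" using \<open>f \<notin> A\<close> \<open>e \<notin> A\<close> by (auto simp: inj_on_def)
    ultimately show "forest ends' (insert f A) \<longleftrightarrow> forest ends (insert e A)"
      using forest_image [of "insert f A" ends' ?s ends] \<open>finite A\<close> loopless' \<open>f \<notin> A\<close>
      by (auto simp: ends'_def)
  next
    assume "e \<in> A"
    have "e \<noteq> f" using assms(3,4) by blast
    have "even (degree_in ends' {e, f} x)" for x
    proof -
      have "{c \<in> {e, f}. x \<in> ends' c} = (if x \<in> ends e then {e, f} else {})"
        using \<open>e \<noteq> f\<close> by (auto simp: ends'_def)
      then show ?thesis using \<open>e \<noteq> f\<close> by (simp add: degree_in_def)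
    qed
    then have "even_subgraph ends' {e, f}" unfolding even_subgraph_def by blast
    moreover have "{e, f} \<subseteq> insert f A" using \<open>e \<in> A\<close> by blast
    ultimately show "\<not> forest ends' (insert f A)"
      using forest_iff_even [OF _ loopless'] \<open>finite A\<close> by (metis finite.insertI insert_not_empty)
  }
qed

lemma series_extension_endpoints:
  assumes "loopless ends E" "e \<in> E" "ends e = {u, v}" "w \<notin> \<Union>(ends ` E)"
  shows "u \<noteq> v" "w \<noteq> u" "w \<noteq> v"
  using assms by (auto simp: loopless_def doubleton_eq_iff)

lemma loopless_series_extension:
  assumes "loopless ends E" "e \<in> E" "ends e = {u, v}" "w \<notin> \<Union>(ends ` E)"
  shows "loopless (ends(e := {u, w}, f := {w, v})) (insert f E)"
  unfolding loopless_def
proof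
  fix c assume "c \<in> insert f E"
  then show "\<exists>a b. a \<noteq> b \<and> (ends(e := {u, w}, f := {w, v})) c = {a, b}"
    using series_extension_endpoints [OF assms] assms(1)
    by (cases "c = f"; cases "c = e") (auto simp: loopless_def)
qed

lemma even_subgraph_series_extension:
  assumes "finite E" "loopless ends E" "e \<in> E" "f \<notin> E" "ends e = {u, v}" "w \<notin> \<Union>(ends ` E)"
    and "C \<subseteq> insert f E"
  defines "ends' \<equiv> ends(e := {u, w}, f := {w, v})"
  shows "even_subgraph ends' C \<longleftrightarrow> (e \<in> C \<longleftrightarrow> f \<in> C) \<and> even_subgraph ends (C - {f})"
proof -
  note endpoints = series_extension_endpoints [OF assms(2,3,5,6)]
  have "e \<noteq> f" using assms(3,4) by blast
  have w_notin: "w \<notin> ends c" if "c \<in> C" "c \<noteq> f" for c using that assms(6,7) by blast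
  have edges_w: "{c \<in> C. w \<in> ends' c} = C \<inter> {e, f}" using w_notin by (auto simp: ends'_def)
  have even_w: "even (degree_in ends' C w) \<longleftrightarrow> (e \<in> C \<longleftrightarrow> f \<in> C)"
    unfolding degree_in_def edges_w using \<open>e \<noteq> f\<close>
    by (cases "e \<in> C"; cases "f \<in> C") (auto simp: Int_insert_right)
  have "{c \<in> C - {f}. w \<in> ends c} = {}" using w_notin by blast
  then have "degree_in ends (C - {f}) w = 0" unfolding degree_in_def by (metis card.empty)
  moreover have "degree_in ends' C x = degree_in ends (C - {f}) x"
    if "x \<noteq> w" and iff: "e \<in> C \<longleftrightarrow> f \<in> C" for x
  proof (cases "x = v \<and> e \<in> C")
    case True
    let ?S = "{c \<in> C - {e, f}. v \<in> ends c}"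
    have "finite ?S" using assms(1,7) by (auto intro: finite_subset)
    moreover have "{c \<in> C. v \<in> ends' c} = insert f ?S" "{c \<in> C - {f}. v \<in> ends c} = insert e ?S"
      using True iff endpoints \<open>e \<noteq> f\<close> assms(5) by (auto simp: ends'_def)
    ultimately show ?thesis using True unfolding degree_in_def by simp
  next
    case False
    then have "{c \<in> C. x \<in> ends' c} = {c \<in> C - {f}. x \<in> ends c}"
      using iff endpoints \<open>e \<noteq> f\<close> assms(5) that(1) by (auto simp: ends'_def)
    then show ?thesis unfolding degree_in_def by simp
  qed
  ultimately show ?thesis
    unfolding even_subgraph_def using even_w by (metis even_zero)
qed

lemma forest_series_extension_iff_even:
  assumes "finite E" "loopless ends E" "e \<in> E" "f \<notin> E" "ends e = {u, v}" "w \<notin> \<Union>(ends ` E)"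
    and "A \<subseteq> insert f E"
  shows "forest (ends(e := {u, w}, f := {w, v})) A \<longleftrightarrow>
    (\<forall>C\<subseteq>A. (e \<in> C \<longleftrightarrow> f \<in> C) \<and> even_subgraph ends (C - {f}) \<longrightarrow> C = {})"
proof -
  let ?ends' = "ends(e := {u, w}, f := {w, v})"
  have "finite A" using assms(1,7) by (auto intro: finite_subset)
  moreover have "loopless ?ends' A"
    by (rule loopless_subset [OF loopless_series_extension [OF assms(2,3,5,6)] assms(7)])
  moreover have "even_subgraph ?ends' C \<longleftrightarrow> (e \<in> C \<longleftrightarrow> f \<in> C) \<and> even_subgraph ends (C - {f})"
    if "C \<subseteq> A" for C
    using that assms(7) by (intro even_subgraph_series_extension [OF assms(1-6)]) auto
  ultimately show ?thesis using forest_iff_even [of A ?ends'] by blast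
qed

lemma forest_series_extension:
  assumes "finite E" "loopless ends E" "e \<in> E" "f \<notin> E" "ends e = {u, v}" "w \<notin> \<Union>(ends ` E)"
    and "A \<subseteq> E - {e}"
  defines "ends' \<equiv> ends(e := {u, w}, f := {w, v})"
  shows "X \<in> {A, insert e A, insert f A} \<Longrightarrow> forest ends' X \<longleftrightarrow> forest ends A"
    and "forest ends' (insert e (insert f A)) \<longleftrightarrow> forest ends (insert e A)"
proof -
  have notin: "e \<notin> A" "f \<notin> A" "e \<noteq> f" using assms(3,4,7) by auto
  have forest: "forest ends Y \<longleftrightarrow> (\<forall>C\<subseteq>Y. even_subgraph ends C \<longrightarrow> C = {})" if Y_sub: "Y \<subseteq> E" for Y
    by (rule forest_iff_even
        [OF finite_subset [OF Y_sub assms(1)] loopless_subset [OF assms(2) Y_sub]])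
  note forest' = forest_series_extension_iff_even [OF assms(1-6), folded ends'_def]
  show "forest ends' X \<longleftrightarrow> forest ends A" if X_in: "X \<in> {A, insert e A, insert f A}"
  proof -
    have "(C \<subseteq> X \<and> (e \<in> C \<longleftrightarrow> f \<in> C)) \<longleftrightarrow> C \<subseteq> A" for C using X_in notin by blast
    moreover have "C - {f} = C" if "C \<subseteq> A" for C using that notin(2) by blast
    moreover have "A \<subseteq> E" "X \<subseteq> insert f E" using X_in assms(3,7) by auto
    ultimately show ?thesis using forest forest' by metis
  qed
  have subsets: "insert e A \<subseteq> E" "insert e (insert f A) \<subseteq> insert f E" using assms(3,7) by auto
  show "forest ends' (insert e (insert f A)) \<longleftrightarrow> forest ends (insert e A)"
    unfolding forest [OF subsets(1)] forest' [OF subsets(2)]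
  proof (intro iffI allI impI)
    fix C assume even': "\<forall>C\<subseteq>insert e (insert f A).
        (e \<in> C \<longleftrightarrow> f \<in> C) \<and> even_subgraph ends (C - {f}) \<longrightarrow> C = {}"
      and C_even: "C \<subseteq> insert e A" "even_subgraph ends C"
    let ?D = "if e \<in> C then insert f C else C"
    have "?D \<subseteq> insert e (insert f A)" "e \<in> ?D \<longleftrightarrow> f \<in> ?D" "?D - {f} = C" using C_even notin by auto
    then have "?D = {}" using even' C_even(2) by metis
    then show "C = {}" by (auto split: if_splits)
  next
    fix C assume even: "\<forall>C\<subseteq>insert e A. even_subgraph ends C \<longrightarrow> C = {}"
      and C_even: "C \<subseteq> insert e (insert f A)" "(e \<in> C \<longleftrightarrow> f \<in> C) \<and> even_subgraph ends (C - {f})"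
    have "C - {f} \<subseteq> insert e A" using C_even by blast
    then have "C - {f} = {}" using even C_even(2) by blast
    then show "C = {}" using C_even(2) notin by blast
  qed
qed

lemma series_parallel_graph_loopless: "series_parallel_graph E ends \<Longrightarrow> finite E \<and> loopless ends E"
proof (induction rule: series_parallel_graph.induct)
  case (single_edge u v ends e)
  then show ?case by (auto simp: loopless_def)
next
  case (parallel_extension E ends e f)
  then show ?case by (auto simp: loopless_def)
next
  case (series_extension E ends e f u v w)
  then show ?case by (intro conjI finite.insertI loopless_series_extension) simp_all
qed

text \<open>Being contained in a base is easier to follow through an extension than maximality is.\<close>

definition generates_forests :: "('a \<Rightarrow> 'v set) \<Rightarrow> 'a set \<Rightarrow> 'a set set \<Rightarrow> bool" where
  "generates_forests ends E M \<longleftrightarrow> M \<subseteq> Pow E \<and> (\<forall>A\<subseteq>E. forest ends A \<longleftrightarrow> (\<exists>B\<in>M. A \<subseteq> B))"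

lemma generates_forests_bases:
  assumes "generates_forests ends E M" "finite E" "\<And>B. B \<in> M \<Longrightarrow> card B = r"
  shows "cycle_matroid_bases E ends = M"
proof -
  have M_sub: "M \<subseteq> Pow E" and forest: "\<And>A. A \<subseteq> E \<Longrightarrow> forest ends A \<longleftrightarrow> (\<exists>B\<in>M. A \<subseteq> B)"
    using assms(1) by (simp_all add: generates_forests_def)
  have antichain: "A = B" if "A \<in> M" "B \<in> M" "A \<subseteq> B" for A B
    using card_subset_eq [of B A] finite_subset [of B E] that M_sub assms(2,3) by auto
  let ?bases = "{B. B \<subseteq> E \<and> forest ends B \<and> (\<forall>A. B \<subseteq> A \<longrightarrow> A \<subseteq> E \<longrightarrow> forest ends A \<longrightarrow> A = B)}"
  have "?bases = M"
  proof (intro equalityI subsetI)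
    fix B assume "B \<in> ?bases"
    then have B_base: "B \<subseteq> E" "forest ends B" "\<And>A. B \<subseteq> A \<Longrightarrow> A \<subseteq> E \<Longrightarrow> forest ends A \<Longrightarrow> A = B" by blast+
    obtain A where A_sup: "A \<in> M" "B \<subseteq> A" using forest [OF B_base(1)] B_base(2) by blast
    then have "A \<subseteq> E" "forest ends A" using M_sub forest by blast+
    then show "B \<in> M" using A_sup B_base(3) by blast
  next
    fix B assume B_base: "B \<in> M"
    then have "B \<subseteq> E" "forest ends B" using M_sub forest by blast+
    moreover have "A = B" if A_sup: "B \<subseteq> A" "A \<subseteq> E" "forest ends A" for A
    proof -
      obtain B' where B'_sup: "B' \<in> M" "A \<subseteq> B'" using forest [OF A_sup(2)] A_sup(3) by blast
      then have "B = B'" using antichain B_base A_sup(1) by blast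
      then show ?thesis using A_sup(1) B'_sup(2) by blast
    qed
    ultimately show "B \<in> ?bases" by blast
  qed
  then show ?thesis by (simp only: cycle_matroid_bases_def)
qed

definition series_parallel_generated :: "'a set \<Rightarrow> 'a set set \<Rightarrow> bool" where
  "series_parallel_generated E M \<longleftrightarrow>
     (\<exists>ends :: 'a \<Rightarrow> nat set. series_parallel_graph E ends \<and> generates_forests ends E M)"

lemma series_parallel_generated_edge: "series_parallel_generated {e} {{e}}"
proof -
  define ends :: "'a \<Rightarrow> nat set" where "ends = (\<lambda>_. {0, 1})"
  have graph: "series_parallel_graph {e} ends"
    by (rule series_parallel_graph.single_edge [of 0 1]) (auto simp: ends_def)
  have "\<not> even_subgraph ends {e}"
  proof
    assume "even_subgraph ends {e}"
    then have "even (degree_in ends {e} 0)" unfolding even_subgraph_def by blast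
    then show False by (simp add: degree_in_def ends_def)
  qed
  then have "forest ends A" if "A \<subseteq> {e}" for A
    using forest_iff_even [of A ends] series_parallel_graph_loopless [OF graph] that
      loopless_subset [of ends "{e}" A] finite_subset [of A "{e}"]
    by (auto simp: subset_singleton_iff)
  then have "generates_forests ends {e} {{e}}" by (auto simp: generates_forests_def)
  then show ?thesis using graph unfolding series_parallel_generated_def by blast
qed

lemma all_subset_insert:
  "(\<forall>A\<subseteq>insert e E. P A) \<longleftrightarrow> (\<forall>A\<subseteq>E. P A \<and> P (insert e A))"
  unfolding Pow_iff [symmetric] Ball_def [symmetric] Pow_insert by auto

lemma generates_forests_insert_iff:
  assumes "P \<subseteq> Pow E" "R \<subseteq> Pow E" "e \<notin> E"
  shows "generates_forests ends (insert e E) ({{e}} \<otimes> P \<union> R) \<longleftrightarrow>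
    (\<forall>A\<subseteq>E. (forest ends A \<longleftrightarrow> (\<exists>B\<in>P \<union> R. A \<subseteq> B)) \<and>
      (forest ends (insert e A) \<longleftrightarrow> (\<exists>B\<in>P. A \<subseteq> B)))"
proof -
  have product: "{{e}} \<otimes> P = insert e ` P" using assms(1,3) by (rule disjoint_product_singleton)
  have "insert e ` P \<union> R \<subseteq> Pow (insert e E)" using assms(1,2) by auto
  moreover have "(\<exists>B\<in>insert e ` P \<union> R. A \<subseteq> B) \<longleftrightarrow> (\<exists>B\<in>P \<union> R. A \<subseteq> B)" if "A \<subseteq> E" for A
  proof -
    have "e \<notin> A" using that assms(3) by blast
    then show ?thesis by (simp add: bex_Un subset_insert)
  qed
  moreover have "(\<exists>B\<in>insert e ` P \<union> R. insert e A \<subseteq> B) \<longleftrightarrow> (\<exists>B\<in>P. A \<subseteq> B)" if "A \<subseteq> E" for A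
  proof -
    have "e \<notin> A" using that assms(3) by blast
    moreover have "e \<notin> B" if "B \<in> R" for B using that assms(2,3) by blast
    ultimately show ?thesis by (auto simp: bex_Un subset_insert)
  qed
  ultimately show ?thesis unfolding generates_forests_def product all_subset_insert by simp
qed

lemma generates_forests_parallel_extension:
  assumes "finite E" "loopless ends (insert e E)"
    and "generates_forests ends (insert e E) ({{e}} \<otimes> P \<union> R)" "P \<subseteq> Pow E" "R \<subseteq> Pow E"
    and "e \<notin> E" "f \<notin> insert e E"
  shows "generates_forests (ends(f := ends e)) (insert e (insert f E))
    ({{e}} \<otimes> P \<union> ({{f}} \<otimes> P \<union> R))"
proof -
  let ?ends' = "ends(f := ends e)"
  have product: "{{f}} \<otimes> P = insert f ` P"
    using assms(4,7) by (intro disjoint_product_singleton) auto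
  have notin: "f \<notin> B" if "B \<in> P \<union> R" for B using that assms(4,5,7) by auto
  have "(forest ?ends' A \<longleftrightarrow> (\<exists>B\<in>P \<union> (insert f ` P \<union> R). A \<subseteq> B)) \<and>
      (forest ?ends' (insert e A) \<longleftrightarrow> (\<exists>B\<in>P. A \<subseteq> B)) \<and>
      (forest ?ends' (insert f A) \<longleftrightarrow> (\<exists>B\<in>P \<union> (insert f ` P \<union> R). insert f A \<subseteq> B)) \<and>
      (forest ?ends' (insert e (insert f A)) \<longleftrightarrow> (\<exists>B\<in>P. insert f A \<subseteq> B))"
    if "A \<subseteq> E" for A
  proof -
    have A_sub: "e \<notin> A" "f \<notin> A" "A \<subseteq> insert e E" "insert e A \<subseteq> insert e E"
      using that assms(6,7) by auto
    have "(forest ends A \<longleftrightarrow> (\<exists>B\<in>P \<union> R. A \<subseteq> B)) \<and> (forest ends (insert e A) \<longleftrightarrow> (\<exists>B\<in>P. A \<subseteq> B))"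
      using assms(3) that unfolding generates_forests_insert_iff [OF assms(4-6)] by blast
    moreover note extension = forest_parallel_extension [OF _ assms(2) insertI1 assms(7)]
    have "forest ?ends' A \<longleftrightarrow> forest ends A" "forest ?ends' (insert e A) \<longleftrightarrow> forest ends (insert e A)"
      "forest ?ends' (insert f A) \<longleftrightarrow> forest ends (insert e A)"
      "\<not> forest ?ends' (insert e (insert f A))"
      using extension(1) [OF _ A_sub(3)] extension(1) [OF _ A_sub(4)] extension(2) [OF _ A_sub(3,1)]
        extension(3) [OF _ A_sub(4) insertI1] assms(1) by (simp_all add: insert_commute)
    ultimately show ?thesis using A_sub(2) notin by (auto simp: bex_Un subset_insert)
  qed
  then show ?thesis
    using assms(4-7) by (subst generates_forests_insert_iff) (auto simp: product all_subset_insert)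
qed

lemma generates_forests_series_extension:
  assumes "finite E" "loopless ends (insert e E)"
    and "generates_forests ends (insert e E) ({{e}} \<otimes> P \<union> R)" "P \<subseteq> Pow E" "R \<subseteq> Pow E"
    and "e \<notin> E" "f \<notin> insert e E" "ends e = {u, v}" "w \<notin> \<Union>(ends ` insert e E)"
  shows "generates_forests (ends(e := {u, w}, f := {w, v})) (insert e (insert f E))
    ({{e}} \<otimes> ({{f}} \<otimes> P \<union> R) \<union> {{f}} \<otimes> R)"
proof -
  let ?ends' = "ends(e := {u, w}, f := {w, v})"
  have product: "{{f}} \<otimes> P = insert f ` P" "{{f}} \<otimes> R = insert f ` R"
    using disjoint_product_singleton [OF assms(4)] disjoint_product_singleton [OF assms(5)] assms(7)
    by simp_all
  have notin: "f \<notin> B" if "B \<in> P \<union> R" for B using that assms(4,5,7) by auto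
  have "(forest ?ends' A \<longleftrightarrow> (\<exists>B\<in>(insert f ` P \<union> R) \<union> insert f ` R. A \<subseteq> B)) \<and>
      (forest ?ends' (insert e A) \<longleftrightarrow> (\<exists>B\<in>insert f ` P \<union> R. A \<subseteq> B)) \<and>
      (forest ?ends' (insert f A) \<longleftrightarrow> (\<exists>B\<in>(insert f ` P \<union> R) \<union> insert f ` R. insert f A \<subseteq> B)) \<and>
      (forest ?ends' (insert e (insert f A)) \<longleftrightarrow> (\<exists>B\<in>insert f ` P \<union> R. insert f A \<subseteq> B))"
    if "A \<subseteq> E" for A
  proof -
    have A_sub: "f \<notin> A" "A \<subseteq> insert e E - {e}" using that assms(6,7) by auto
    have "(forest ends A \<longleftrightarrow> (\<exists>B\<in>P \<union> R. A \<subseteq> B)) \<and> (forest ends (insert e A) \<longleftrightarrow> (\<exists>B\<in>P. A \<subseteq> B))"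
      using assms(3) that unfolding generates_forests_insert_iff [OF assms(4-6)] by blast
    moreover have "forest ?ends' X \<longleftrightarrow> forest ends A" if "X \<in> {A, insert e A, insert f A}" for X
      using assms(1)
      by (intro forest_series_extension(1) [OF _ assms(2) insertI1 assms(7-9) A_sub(2) that]) simp
    moreover have "forest ?ends' (insert e (insert f A)) \<longleftrightarrow> forest ends (insert e A)"
      using assms(1)
      by (intro forest_series_extension(2) [OF _ assms(2) insertI1 assms(7-9) A_sub(2)]) simp
    ultimately show ?thesis using A_sub(1) notin by (auto simp: bex_Un subset_insert)
  qed
  moreover have "insert f ` P \<union> R \<subseteq> Pow (insert f E)" "insert f ` R \<subseteq> Pow (insert f E)"
    using assms(4,5) by auto
  ultimately show ?thesis
    using assms(6,7) by (subst product generates_forests_insert_iff)+ (auto simp: all_subset_insert)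
qed

lemma series_parallel_generated_parallel:
  fixes E :: "'a set"
  assumes "series_parallel_generated (insert e E) ({{e}} \<otimes> P \<union> R)" "P \<subseteq> Pow E" "R \<subseteq> Pow E"
    and "e \<notin> E" "f \<notin> insert e E"
  shows "series_parallel_generated (insert e (insert f E)) ({{e}} \<otimes> P \<union> ({{f}} \<otimes> P \<union> R))"
proof -
  obtain ends :: "'a \<Rightarrow> nat set" where graph: "series_parallel_graph (insert e E) ends"
    and gen: "generates_forests ends (insert e E) ({{e}} \<otimes> P \<union> R)"
    using assms(1) unfolding series_parallel_generated_def by blast
  have "series_parallel_graph (insert e (insert f E)) (ends(f := ends e))"
    using series_parallel_graph.parallel_extension [OF graph insertI1 assms(5)]
    by (simp add: insert_commute)
  moreover have "generates_forests (ends(f := ends e)) (insert e (insert f E))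
      ({{e}} \<otimes> P \<union> ({{f}} \<otimes> P \<union> R))"
    using series_parallel_graph_loopless [OF graph]
    by (intro generates_forests_parallel_extension [OF _ _ gen assms(2-5)]) auto
  ultimately show ?thesis unfolding series_parallel_generated_def by blast
qed

lemma series_parallel_generated_series:
  fixes E :: "'a set"
  assumes "series_parallel_generated (insert e E) ({{e}} \<otimes> P \<union> R)" "P \<subseteq> Pow E" "R \<subseteq> Pow E"
    and "e \<notin> E" "f \<notin> insert e E"
  shows "series_parallel_generated (insert e (insert f E)) ({{e}} \<otimes> ({{f}} \<otimes> P \<union> R) \<union> {{f}} \<otimes> R)"
proof -
  obtain ends :: "'a \<Rightarrow> nat set" where graph: "series_parallel_graph (insert e E) ends"
    and gen: "generates_forests ends (insert e E) ({{e}} \<otimes> P \<union> R)"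
    using assms(1) unfolding series_parallel_generated_def by blast
  have fin: "finite E" "finite (insert e E)" and loopless: "loopless ends (insert e E)"
    using series_parallel_graph_loopless [OF graph] by auto
  obtain u v where ends_e: "ends e = {u, v}"
    using looplessE [OF loopless insertI1] by metis
  have "finite (\<Union>(ends ` insert e E))" using fin loopless by (auto simp: loopless_def)
  then obtain w where new_vertex: "w \<notin> \<Union>(ends ` insert e E)"
    using ex_new_if_finite [OF infinite_UNIV_nat] by blast
  have "series_parallel_graph (insert e (insert f E)) (ends(e := {u, w}, f := {w, v}))"
    using series_parallel_graph.series_extension [OF graph insertI1 assms(5) ends_e new_vertex]
    by (simp add: insert_commute)
  then show ?thesis
    using generates_forests_series_extension [OF fin(1) loopless gen assms(2-5) ends_e new_vertex]
    unfolding series_parallel_generated_def by blast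
qed

text \<open>Replacing the edge \<open>e\<close> of a series-parallel graph by the network \<open>a\<close>.\<close>

definition substitutable :: "'a net \<Rightarrow> 'a \<Rightarrow> bool" where
  "substitutable a e \<longleftrightarrow> (\<forall>E P R. edges a \<inter> E = {} \<longrightarrow> P \<subseteq> Pow E \<longrightarrow> R \<subseteq> Pow E \<longrightarrow>
     series_parallel_generated (insert e E) ({{e}} \<otimes> P \<union> R) \<longrightarrow>
     series_parallel_generated (edges a \<union> E) (trees a \<otimes> P \<union> cuts a \<otimes> R))"

lemma substitutableI:
  assumes "\<And>E P R. edges a \<inter> E = {} \<Longrightarrow> P \<subseteq> Pow E \<Longrightarrow> R \<subseteq> Pow E \<Longrightarrow>
    series_parallel_generated (insert e E) ({{e}} \<otimes> P \<union> R) \<Longrightarrow>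
    series_parallel_generated (edges a \<union> E) (trees a \<otimes> P \<union> cuts a \<otimes> R)"
  shows "substitutable a e"
  using assms unfolding substitutable_def by blast

lemma substitutableD:
  assumes "substitutable a e" "edges a \<inter> E = {}" "P \<subseteq> Pow E" "R \<subseteq> Pow E"
    and "series_parallel_generated (insert e E) ({{e}} \<otimes> P \<union> R)"
  shows "series_parallel_generated (edges a \<union> E) (trees a \<otimes> P \<union> cuts a \<otimes> R)"
  using assms unfolding substitutable_def by blast

lemma substitute_two:
  assumes "substitutable a e" "substitutable b f" "f \<in> edges b" "edges a \<inter> edges b = {}"
    and "(edges a \<union> edges b) \<inter> E = {}" "A \<subseteq> Pow E" "B \<subseteq> Pow E" "C \<subseteq> Pow E" "D \<subseteq> Pow E"
    and "series_parallel_generated (insert e (insert f E))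
      ({{e}} \<otimes> ({{f}} \<otimes> A \<union> B) \<union> ({{f}} \<otimes> C \<union> D))"
  shows "series_parallel_generated (edges a \<union> edges b \<union> E)
    (trees a \<otimes> (trees b \<otimes> A \<union> cuts b \<otimes> B) \<union> cuts a \<otimes> (trees b \<otimes> C \<union> cuts b \<otimes> D))"
proof -
  have sub_f: "{{f}} \<otimes> X \<union> Y \<subseteq> Pow (insert f E)" if "X \<subseteq> Pow E" "Y \<subseteq> Pow E" for X Y
    using that disjoint_product_subset_Pow [of "{{f}}" "{f}" X E] by auto
  have sub_a: "trees a \<otimes> X \<union> cuts a \<otimes> Y \<subseteq> Pow (edges a \<union> E)" if "X \<subseteq> Pow E" "Y \<subseteq> Pow E" for X Y
    using disjoint_product_subset_Pow [OF trees_subset that(1)]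
      disjoint_product_subset_Pow [OF cuts_subset that(2)] by simp
  have "edges a \<inter> insert f E = {}" using assms(3-5) by blast
  from substitutableD [OF assms(1) this sub_f sub_f assms(10)] assms(6-9)
  have "series_parallel_generated (edges a \<union> insert f E)
      (trees a \<otimes> ({{f}} \<otimes> A \<union> B) \<union> cuts a \<otimes> ({{f}} \<otimes> C \<union> D))" by blast
  then have "series_parallel_generated (insert f (edges a \<union> E))
      ({{f}} \<otimes> (trees a \<otimes> A \<union> cuts a \<otimes> C) \<union> (trees a \<otimes> B \<union> cuts a \<otimes> D))"
    by (simp add: disjoint_product_algebra)
  moreover have "edges b \<inter> (edges a \<union> E) = {}" using assms(4,5) by blast
  ultimately have "series_parallel_generated (edges b \<union> (edges a \<union> E))
      (trees b \<otimes> (trees a \<otimes> A \<union> cuts a \<otimes> C) \<union> cuts b \<otimes> (trees a \<otimes> B \<union> cuts a \<otimes> D))"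
    using substitutableD [OF assms(2) _ sub_a sub_a] assms(6-9) by blast
  then show ?thesis by (simp add: disjoint_product_algebra)
qed

lemma substitutable_Par:
  assumes "substitutable a e" "substitutable b f" "e \<in> edges a" "f \<in> edges b"
    and disjoint: "edges a \<inter> edges b = {}"
  shows "substitutable (Par a b) e"
proof (rule substitutableI)
  fix E P R assume "edges (Par a b) \<inter> E = {}" and sub: "P \<subseteq> Pow E" "R \<subseteq> Pow E"
    and gen: "series_parallel_generated (insert e E) ({{e}} \<otimes> P \<union> R)"
  then have disjoint_E: "(edges a \<union> edges b) \<inter> E = {}" by simp
  then have "e \<notin> E" "f \<notin> insert e E" using assms(3-5) by auto
  from series_parallel_generated_parallel [OF gen sub this]
  have "series_parallel_generated (insert e (insert f E))
      ({{e}} \<otimes> ({{f}} \<otimes> {} \<union> P) \<union> ({{f}} \<otimes> P \<union> R))" by simp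
  from substitute_two [OF assms(1,2,4) disjoint disjoint_E _ sub(1,1,2) this]
  show "series_parallel_generated (edges (Par a b) \<union> E) (trees (Par a b) \<otimes> P \<union> cuts (Par a b) \<otimes> R)"
    by (simp add: disjoint_product_algebra)
qed

lemma substitutable_Ser:
  assumes "substitutable a e" "substitutable b f" "e \<in> edges a" "f \<in> edges b"
    and disjoint: "edges a \<inter> edges b = {}"
  shows "substitutable (Ser a b) e"
proof (rule substitutableI)
  fix E P R assume "edges (Ser a b) \<inter> E = {}" and sub: "P \<subseteq> Pow E" "R \<subseteq> Pow E"
    and gen: "series_parallel_generated (insert e E) ({{e}} \<otimes> P \<union> R)"
  then have disjoint_E: "(edges a \<union> edges b) \<inter> E = {}" by simp
  then have "e \<notin> E" "f \<notin> insert e E" using assms(3-5) by auto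
  from series_parallel_generated_series [OF gen sub this]
  have "series_parallel_generated (insert e (insert f E))
      ({{e}} \<otimes> ({{f}} \<otimes> P \<union> R) \<union> ({{f}} \<otimes> R \<union> {}))" by simp
  from substitute_two [OF assms(1,2,4) disjoint disjoint_E sub(1,2,2) _ this]
  show "series_parallel_generated (edges (Ser a b) \<union> E) (trees (Ser a b) \<otimes> P \<union> cuts (Ser a b) \<otimes> R)"
    by (simp add: disjoint_product_algebra)
qed

lemma wf_net_substitutable: "wf_net a \<Longrightarrow> \<exists>e\<in>edges a. substitutable a e"
proof (induction a)
  case (Edge e)
  then show ?case by (simp add: substitutable_def)
next
  case (Par a b)
  then obtain e f where "e \<in> edges a" "substitutable a e" "f \<in> edges b" "substitutable b f" by auto
  then have "substitutable (Par a b) e" using substitutable_Par [of a e b f] Par.prems by simp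
  then show ?case using \<open>e \<in> edges a\<close> by auto
next
  case (Ser a b)
  then obtain e f where "e \<in> edges a" "substitutable a e" "f \<in> edges b" "substitutable b f" by auto
  then have "substitutable (Ser a b) e" using substitutable_Ser [of a e b f] Ser.prems by simp
  then show ?case using \<open>e \<in> edges a\<close> by auto
qed

lemma trees_series_parallel_matroid:
  fixes a :: "'n::finite net"
  assumes "wf_net a" "edges a = UNIV"
  shows "series_parallel_matroid (trees a)"
proof -
  obtain e where "substitutable a e" using wf_net_substitutable [OF assms(1)] by blast
  from substitutableD [OF this, of "{}" "{{}}" "{}"]
  have "series_parallel_generated UNIV (trees a)"
    using series_parallel_generated_edge [of e] assms(2) by simp
  then obtain ends :: "'n \<Rightarrow> nat set" where "series_parallel_graph UNIV ends"
    and gen: "generates_forests ends UNIV (trees a)"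
    unfolding series_parallel_generated_def by blast
  moreover have "cycle_matroid_bases UNIV ends = trees a"
    by (rule generates_forests_bases [OF gen finite card_tree])
  ultimately show ?thesis unfolding series_parallel_matroid_def by blast
qed

lemma exists_series_net:
  assumes "finite S" "S \<noteq> {}"
  shows "\<exists>a. wf_net a \<and> edges a = S \<and> trees a = {S}"
  using assms
proof (induction S rule: finite_ne_induct)
  case (singleton x)
  then show ?case by (intro exI [of _ "Edge x"]) auto
next
  case (insert x S)
  then obtain a where "wf_net a" "edges a = S" "trees a = {S}" by blast
  then show ?case using insert
    by (intro exI [of _ "Ser (Edge x) a"]) (auto simp: disjoint_product_singleton [of _ S])
qed

lemma exists_parallel_net:
  assumes "finite S" "S \<noteq> {}"
  shows "\<exists>a. wf_net a \<and> edges a = S \<and> trees a = (\<lambda>x. {x}) ` S \<and> cuts a = {{}}"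
  using assms
proof (induction S rule: finite_ne_induct)
  case (singleton x)
  then show ?case by (intro exI [of _ "Edge x"]) auto
next
  case (insert x S)
  then obtain a where "wf_net a" "edges a = S" "trees a = (\<lambda>x. {x}) ` S" "cuts a = {{}}" by blast
  then show ?case using insert by (intro exI [of _ "Par (Edge x) a"]) auto
qed

subsection \<open>Series-parallel valuations\<close>

definition series_parallel_valuation :: "nat \<Rightarrow> ('n::finite set \<Rightarrow> real) \<Rightarrow> bool" where
  "series_parallel_valuation d p \<longleftrightarrow> (\<forall>w. series_parallel_sum UNIV (minimizers d p w))"

lemma series_parallel_sum_uminus:
  fixes M :: "'n::finite set set"
  shows "series_parallel_sum UNIV (uminus ` M) \<longleftrightarrow> series_parallel_sum UNIV M"
proof -
  have "series_parallel_sum UNIV (uminus ` N)" if "series_parallel_sum UNIV N" for N :: "'n set set"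
    using series_parallel_sum_Diff [OF that] by (simp add: Compl_eq_Diff_UNIV [abs_def])
  from this [of M] this [of "uminus ` M"] show ?thesis by (auto simp: image_image)
qed

lemma weight_constant_uminus_image:
  fixes u :: "'n::finite \<Rightarrow> real"
  shows "weight_constant u (uminus ` M) \<longleftrightarrow> weight_constant u M"
proof -
  have "sum u (- I) = sum u UNIV - sum u I" for I by (simp add: Compl_eq_Diff_UNIV sum_diff)
  then show ?thesis unfolding weight_constant_def ball_simps by simp
qed

lemma UNIV_neq_singleton:
  fixes e :: "'n::finite"
  assumes "2 \<le> CARD('n)"
  shows "UNIV \<noteq> {e}"
proof
  assume "UNIV = {e}"
  then have "CARD('n) = 1" by (metis is_singletonI is_singleton_altdef)
  then show False using assms by simp
qed

lemma series_parallel_valuation_trivial: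
  fixes p :: "'n::finite set \<Rightarrow> real"
  assumes "d = 0 \<or> d = CARD('n)"
  shows "series_parallel_valuation d p"
proof -
  have empty: "series_parallel_sum UNIV {{} :: 'n set}"
    by (rule net_sum_superset [OF net_sum.empty]) auto
  then have "series_parallel_sum UNIV {UNIV :: 'n set}"
    using series_parallel_sum_uminus [of "{{} :: 'n set}"] by simp
  then show ?thesis
    unfolding series_parallel_valuation_def
    using assms empty by (auto simp: minimizers_zero minimizers_full)
qed

lemma series_parallel_valuation_connectedI:
  fixes p :: "'n::finite set \<Rightarrow> real"
  assumes "0 < d" "d < CARD('n)"
    and "\<And>w. connected_family (minimizers d p w) \<Longrightarrow> series_parallel_sum UNIV (minimizers d p w)"
  shows "series_parallel_valuation d p"
  unfolding series_parallel_valuation_def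
proof
  fix w
  obtain w' where larger: "minimizers d p w \<subseteq> minimizers d p w'"
    "connected_family (minimizers d p w')"
    by (rule minimizers_subset_connected [OF assms(1,2)])
  have "UNIV \<noteq> {e :: 'n}" for e using assms(1,2) by (intro UNIV_neq_singleton) simp
  then obtain x where x_block: "block x" "edges x = UNIV" "minimizers d p w' = trees x"
    using connected_series_parallel_sum [OF assms(3) [OF larger(2)] larger(2)] by blast
  have "minimizers d p w = argmax_weight (\<lambda>i. w $ i - w' $ i) (trees x)"
    using minimizers_eq_argmax_weight [OF _ larger(1)] assms(2) x_block(3) by simp
  then show "series_parallel_sum UNIV (minimizers d p w)"
    using series_parallel_sum_argmax_weight [OF block_wf [OF x_block(1)]] x_block(2) by simp
qed

lemma series_parallel_valuation_tropical_plucker: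
  fixes p :: "'n::finite set \<Rightarrow> real"
  assumes "series_parallel_valuation d p" "d \<le> CARD('n)"
  shows "tropical_plucker d p"
proof (rule tropical_pluckerI_minimizers [OF assms(2)])
  fix w S i j k l
  have "series_parallel_sum UNIV (minimizers d p w)"
    using assms(1) by (simp add: series_parallel_valuation_def)
  moreover assume "distinct [i, j, k, l :: 'n]" "{i, j, k, l} \<inter> S = {}"
  ultimately show "minimizers d p w \<noteq> {S \<union> {i, j}, S \<union> {k, l}}"
    by (rule series_parallel_sum_not_diagonal)
qed

lemma series_parallel_valuation_hyperplane:
  fixes p :: "'n::finite set \<Rightarrow> real"
  shows "series_parallel_valuation (CARD('n) - 1) p"
  unfolding series_parallel_valuation_def
proof
  fix w
  define S where "S = {j. - {j} \<in> minimizers (CARD('n) - 1) p w}"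
  have "\<exists>j. I = - {j}" if I_min: "I \<in> minimizers (CARD('n) - 1) p w" for I
  proof -
    have "card (- I) = 1" using minimizersD(1) [OF I_min] by (simp add: card_complement)
    then show ?thesis by (metis card_1_singletonE double_complement)
  qed
  then have complements: "minimizers (CARD('n) - 1) p w = uminus ` (\<lambda>j. {j}) ` S"
    unfolding S_def by blast
  obtain I where "I \<in> minimizers (CARD('n) - 1) p w"
    using minimizers_nonempty [of "CARD('n) - 1" p w] by auto
  then have "S \<noteq> {}" unfolding complements by blast
  then obtain a where "wf_net a" "edges a = S" "trees a = (\<lambda>j. {j}) ` S"
    using exists_parallel_net [of S] by auto
  then have "series_parallel_sum S ((\<lambda>j. {j}) ` S)" using series_parallel_sum_trees by metis
  then show "series_parallel_sum UNIV (minimizers (CARD('n) - 1) p w)"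
    unfolding complements series_parallel_sum_uminus by (rule net_sum_superset) auto
qed

lemma series_parallel_valuation_dual:
  fixes p :: "'n::finite set \<Rightarrow> real"
  assumes "d \<le> CARD('n)" "series_parallel_valuation d p"
  shows "series_parallel_valuation (CARD('n) - d) (dual_plucker p)"
  using assms(2) unfolding series_parallel_valuation_def
  by (simp add: minimizers_dual [OF assms(1)] series_parallel_sum_uminus)

lemma series_parallel_sum_loopless_uminus:
  fixes M :: "'n::finite set set"
  assumes "series_parallel_sum UNIV M" "\<Union>M = UNIV"
  shows "net_sum block UNIV (uminus ` M)"
proof (rule series_parallel_sum_coloop_free)
  show "series_parallel_sum UNIV (uminus ` M)" using assms(1) series_parallel_sum_uminus by blast
  show "\<Inter>(uminus ` M) = {}" using assms(2) by (metis Compl_UNIV_eq uminus_Sup)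
qed

lemma series_parallel_sum_stable_intersection:
  fixes p p' :: "'n::finite set \<Rightarrow> real" and d d' :: nat
  defines "M \<equiv> minimizers d p" and "M' \<equiv> minimizers d' p'"
  assumes val: "valuated_matroid d p" "valuated_matroid d' p'"
    and dims: "d \<le> CARD('n)" "d' \<le> CARD('n)" "CARD('n) \<le> d + d'"
    and transverse: "meet_transversely d p d' p'"
    and sums: "series_parallel_sum UNIV (M w)" "series_parallel_sum UNIV (M' w)"
    and loopless: "\<Union>(M w) = UNIV" "\<Union>(M' w) = UNIV"
  shows "series_parallel_sum UNIV
      (minimizers (d + d' - CARD('n)) (stable_intersection d p d' p') w)"
    (is "series_parallel_sum UNIV ?N")
proof -
  have "transverse_families (uminus ` M w) (uminus ` M' w)"
    using meet_transversely_imp_transverse_families [OF val dims(1,2) transverse] loopless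
    by (simp add: M_def M'_def transverse_families_def weight_constant_uminus_image)
  moreover have "net_sum block UNIV (uminus ` M w)" "net_sum block UNIV (uminus ` M' w)"
    using sums loopless by (simp_all add: series_parallel_sum_loopless_uminus)
  ultimately have product: "net_sum block UNIV ((uminus ` M w) \<otimes> (uminus ` M' w))"
    using net_sum_transverse_product [of UNIV "uminus ` M w" UNIV "uminus ` M' w"] by simp
  have "uminus ` ?N = (uminus ` M w) \<otimes> (uminus ` M' w)"
    using minimizers_stable_intersection [OF dims] net_sum_nonempty [OF product]
    by (simp add: M_def M'_def)
  then have "series_parallel_sum UNIV (uminus ` ?N)"
    using net_sum_weaken [OF product block_or_coloopI] by simp
  then show ?thesis by (simp add: series_parallel_sum_uminus)
qed

lemma series_parallel_valuation_stable_intersection: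
  fixes p p' :: "'n::finite set \<Rightarrow> real"
  assumes plucker: "tropical_plucker d p" "tropical_plucker d' p'"
    and valuations: "series_parallel_valuation d p" "series_parallel_valuation d' p'"
    and "CARD('n) \<le> d + d'" "meet_transversely d p d' p'"
  shows "series_parallel_valuation (d + d' - CARD('n)) (stable_intersection d p d' p')"
    (is "series_parallel_valuation ?r ?q")
proof (cases "?r = 0 \<or> ?r = CARD('n)")
  case True
  then show ?thesis by (rule series_parallel_valuation_trivial)
next
  case False
  have val: "valuated_matroid d p" "valuated_matroid d' p'"
    using plucker by (simp_all add: tropical_plucker_valuated_matroid)
  have dims: "d \<le> CARD('n)" "d' \<le> CARD('n)"
    using plucker by (simp_all add: tropical_plucker_rank_le)
  have rank: "0 < ?r" "?r < CARD('n)" using False dims by auto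
  show ?thesis
  proof (rule series_parallel_valuation_connectedI [OF rank])
    fix w
    let ?N = "minimizers ?r ?q w"
    assume "connected_family ?N"
    then have "e \<in> \<Union>?N" for e
      by (rule connected_family_Union) (use rank in \<open>auto intro!: UNIV_neq_singleton\<close>)
    moreover have "\<Union>?N \<subseteq> \<Union>(minimizers d p w)"
      by (rule Union_stable_minimizers_subset [OF dims assms(5) val(1)])
    moreover have "\<Union>?N \<subseteq> \<Union>(minimizers d' p' w)"
      using Union_stable_minimizers_subset [OF dims(2,1) _ val(2), of p w] assms(5)
      by (simp add: add.commute stable_intersection_commute [of d p])
    ultimately have "\<Union>(minimizers d p w) = UNIV" "\<Union>(minimizers d' p' w) = UNIV" by blast+
    moreover have "series_parallel_sum UNIV (minimizers d p w)"
      "series_parallel_sum UNIV (minimizers d' p' w)"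
      using valuations by (simp_all add: series_parallel_valuation_def)
    ultimately show "series_parallel_sum UNIV ?N"
      by (intro series_parallel_sum_stable_intersection val dims assms(5,6))
  qed
qed

lemma series_parallel_valuation_transfer:
  assumes "tropical_linear_space d p = tropical_linear_space d' p'"
    and "tropical_plucker d p" "tropical_plucker d' p'" "series_parallel_valuation d' p'"
  shows "series_parallel_valuation d p"
  using assms(4) tropical_linear_space_eqD [OF assms(2,3,1)]
  by (simp add: series_parallel_valuation_def)

lemma constructible_imp_series_parallel_valuation:
  fixes p :: "'n::finite set \<Rightarrow> real"
  assumes "constructible L" "tropical_linear_space d p = L" "tropical_plucker d p"
  shows "series_parallel_valuation d p"
  using assms
proof (induction L arbitrary: d p rule: constructible.induct)
  case (hyperplane p0)
  then show ?case
    using series_parallel_valuation_transfer series_parallel_valuation_hyperplane by blast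
next
  case (dual d0 p0)
  have "d0 \<le> CARD('n)" by (rule tropical_plucker_rank_le [OF dual.hyps(1)])
  moreover have "series_parallel_valuation d0 p0" by (rule dual.IH [OF refl dual.hyps(1)])
  ultimately have "series_parallel_valuation (CARD('n) - d0) (dual_plucker p0)"
    by (rule series_parallel_valuation_dual)
  then show ?case
    by (rule series_parallel_valuation_transfer
        [OF dual.prems tropical_plucker_dual [OF dual.hyps(1)]])
next
  case (transverse_intersection d1 p1 d2 p2)
  note hyps = transverse_intersection.hyps
  have "series_parallel_valuation d1 p1" "series_parallel_valuation d2 p2"
    using transverse_intersection.IH hyps(1,3) by simp_all
  then have valuation:
    "series_parallel_valuation (d1 + d2 - CARD('n)) (stable_intersection d1 p1 d2 p2)"
    by (rule series_parallel_valuation_stable_intersection [OF hyps(1,3) _ _ hyps(5,6)])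
  moreover have "d1 + d2 - CARD('n) \<le> CARD('n)"
    using tropical_plucker_rank_le [OF hyps(1)] tropical_plucker_rank_le [OF hyps(3)] by linarith
  ultimately have "tropical_plucker (d1 + d2 - CARD('n)) (stable_intersection d1 p1 d2 p2)"
    by (rule series_parallel_valuation_tropical_plucker)
  then show ?case
    using valuation by (rule series_parallel_valuation_transfer [OF transverse_intersection.prems])
qed

lemma series_parallel_tls_full:
  fixes p :: "'n::finite set \<Rightarrow> real"
  shows "series_parallel_tls CARD('n) p"
proof -
  obtain a :: "'n net" where "wf_net a" "edges a = UNIV" "trees a = {UNIV}"
    using exists_series_net [of "UNIV :: 'n set"] by auto
  then have "series_parallel_matroid {UNIV :: 'n set}"
    using trees_series_parallel_matroid [of a] by simp
  then show ?thesis
    by (auto simp: series_parallel_tls_def maximal_cell_def regular_subdivision_eq minimizers_full)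
qed

lemma series_parallel_valuation_tls:
  fixes p :: "'n::finite set \<Rightarrow> real"
  assumes "0 < d" "d < CARD('n)" "series_parallel_valuation d p"
  shows "series_parallel_tls d p"
  unfolding series_parallel_tls_def
proof (intro allI impI)
  fix C assume "maximal_cell d p C"
  then obtain w where cell: "C = matroid_polytope (minimizers d p w)"
    "connected_family (minimizers d p w)"
    by (rule maximal_cell_connected [OF assms(1,2)])
  have "UNIV \<noteq> {e :: 'n}" for e using assms(1,2) by (intro UNIV_neq_singleton) simp
  moreover have "series_parallel_sum UNIV (minimizers d p w)"
    using assms(3) by (simp add: series_parallel_valuation_def)
  ultimately obtain x where "block x" "edges x = UNIV" "minimizers d p w = trees x"
    using connected_series_parallel_sum [OF _ cell(2)] by blast
  then show "\<exists>M. series_parallel_matroid M \<and> C = matroid_polytope M"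
    using trees_series_parallel_matroid block_wf cell(1) by metis
qed

theorem mainTheorem2:
  fixes p :: "'n::finite set \<Rightarrow> real" and d :: nat
  assumes "tropical_plucker d p"
    and "0 < d"
    and "constructible (tropical_linear_space d p)"
  shows "series_parallel_tls d p"
proof (cases "d = CARD('n)")
  case True
  then show ?thesis by (simp add: series_parallel_tls_full)
next
  case False
  then have "d < CARD('n)" using tropical_plucker_rank_le [OF assms(1)] by simp
  moreover have "series_parallel_valuation d p"
    using assms(3) refl assms(1) by (rule constructible_imp_series_parallel_valuation)
  ultimately show ?thesis by (rule series_parallel_valuation_tls [OF assms(2)])
qed

end
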